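(* Let $2\le k\le n$, $q=n-k+1$, let $\Omega\subset\mathbb R^n$ be a bounded smooth uniformly convex domain, and let $f_1,f_2\in C^\infty(\overline\Omega)$ be positive. Suppose that for a fixed $E\in\mathrm{Gr}(k-1,n)$, with $\phi_E(x)=\frac12|P_Ex|^2$, $$\Lambda_{f_1}(t\phi_E|_{\partial\Omega})=\Lambda_{f_2}(t\phi_E|_{\partial\Omega})\quad\text{on }\partial\Omega$$ for all sufficiently large $t$. Then, with $V=E^\perp$, $$\int_{\Omega\cap(y+V)}(f_1-f_2)\,d\mathcal H^q=0\qquad\text{for every }y\in E .$$
   Context: For a symmetric matrix $M$, $\sigma_j(M)$ is the $j$-th elementary symmetric function of its eigenvalues; $\Gamma_k=\{\lambda\in\mathbb R^n:\sigma_j(\lambda)>0,\ 1\le j\le k\}$; a $C^2$ function $u$ is $k$-admissible if the eigenvalues of $D^2u(x)$ lie in $\Gamma_k$ for all $x\in\Omega$. Uniformly convex means that all principal curvatures of $\partial\Omega$ are bounded below by a positive constant. For positive $f\in C^\infty(\overline\Omega)$ and $g\in C^\infty(\partial\Omega)$, $u_g\in C^\infty(\overline\Omega)$ is the unique smooth $k$-admissible solution of $\sigma_k(D^2u_g)=f$ in $\Omega$, $u_g=g$ on $\partial\Omega$ (existence and uniqueness: Caffarelli–Nirenberg–Spruck), and $\Lambda_f(g)=\partial_\nu u_g|_{\partial\Omega}$ with $\nu$ the outward unit normal. Positive means positive on $\overline\Omega$. $\mathrm{Gr}(m,n)$ is the Grassmannian of $m$-dimensional linear subspaces of $\mathbb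 R^n$, $P_E$ is orthogonal projection onto $E$, and $\mathcal H^q$ is $q$-dimensional Hausdorff measure. *)

theory Defs
  imports "HOL-Analysis.Analysis" "HOL-Computational_Algebra.Polynomial"
begin

section \<open>Eigenvalues, elementary symmetric functions, Garding cones\<close>

definition char_polynomial :: "real^'n^'n \<Rightarrow> real poly" where
  "char_polynomial M = det (\<chi> i j. (if i = j then [:0, 1:] else 0) - [:M $ i $ j:])"

text \<open>
  The eigenvalues listed with algebraic multiplicity, in some order.  Only functions that are
  symmetric in the entries are ever applied to this vector.  It exists whenever the characteristic
  polynomial splits over the reals, in particular for every symmetric matrix.
\<close>
definition eigenvalues :: "real^'n^'n \<Rightarrow> real^'n" where
  "eigenvalues M = (SOME \<mu>. char_polynomial M = (\<Prod>i\<in>UNIV. [:- (\<mu> $ i), 1:]))"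

definition elem_sym :: "nat \<Rightarrow> real^'n \<Rightarrow> real" where
  "elem_sym j \<mu> = (\<Sum>S | S \<subseteq> UNIV \<and> card S = j. \<Prod>i\<in>S. \<mu> $ i)"

definition sigma_mat :: "nat \<Rightarrow> real^'n^'n \<Rightarrow> real" where
  "sigma_mat j M = elem_sym j (eigenvalues M)"

definition Gamma_cone :: "nat \<Rightarrow> (real^'n) set" where
  "Gamma_cone k = {\<mu>. \<forall>j. 1 \<le> j \<and> j \<le> k \<longrightarrow> elem_sym j \<mu> > 0}"

section \<open>Derivatives and smoothness classes\<close>

definition partial_deriv :: "'n \<Rightarrow> (real^'n \<Rightarrow> real) \<Rightarrow> real^'n \<Rightarrow> real" where
  "partial_deriv i u x = frechet_derivative u (at x) (axis i 1)"

definition grad :: "(real^'n \<Rightarrow> real) \<Rightarrow> real^'n \<Rightarrow> real^'n" where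
  "grad u x = (\<chi> i. partial_deriv i u x)"

definition hessian :: "(real^'n \<Rightarrow> real) \<Rightarrow> real^'n \<Rightarrow> real^'n^'n" where
  "hessian u x = (\<chi> i j. partial_deriv i (partial_deriv j u) x)"

text \<open>The partial derivatives here are those in full neighbourhoods, so this is meant for open \<open>U\<close>.\<close>
primrec Ck_on :: "nat \<Rightarrow> (real^'n) set \<Rightarrow> (real^'n \<Rightarrow> real) \<Rightarrow> bool" where
  "Ck_on 0 U u \<longleftrightarrow> continuous_on U u"
| "Ck_on (Suc m) U u \<longleftrightarrow>
     (\<forall>x\<in>U. u differentiable (at x)) \<and> (\<forall>i. Ck_on m U (partial_deriv i u))"

definition Cinf_on :: "(real^'n) set \<Rightarrow> (real^'n \<Rightarrow> real) \<Rightarrow> bool" where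
  "Cinf_on U u \<longleftrightarrow> (\<forall>m. Ck_on m U u)"

text \<open>
  For open \<open>\<Omega>\<close>, \<open>Ck_closure m \<Omega> u\<close> says that \<open>u\<close> belongs to
  \<open>C\<^sup>m\<close> of the closure of \<open>\<Omega>\<close>: \<open>u\<close> is continuous on the closure and all
  its partial derivatives in \<open>\<Omega>\<close> up to order \<open>m\<close> extend continuously to the closure.
  Values of \<open>u\<close> off the closure are irrelevant.
\<close>
primrec Ck_closure :: "nat \<Rightarrow> (real^'n) set \<Rightarrow> (real^'n \<Rightarrow> real) \<Rightarrow> bool" where
  "Ck_closure 0 \<Omega> u \<longleftrightarrow> continuous_on (closure \<Omega>) u"
| "Ck_closure (Suc m) \<Omega> u \<longleftrightarrow>
     continuous_on (closure \<Omega>) u \<and> (\<forall>x\<in>\<Omega>. u differentiable (at x)) \<and>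
     (\<forall>i. \<exists>g. Ck_closure m \<Omega> g \<and> (\<forall>x\<in>\<Omega>. g x = partial_deriv i u x))"

definition Cinf_closure :: "(real^'n) set \<Rightarrow> (real^'n \<Rightarrow> real) \<Rightarrow> bool" where
  "Cinf_closure \<Omega> u \<longleftrightarrow> (\<forall>m. Ck_closure m \<Omega> u)"

section \<open>Smooth and uniformly convex domains\<close>

definition local_defining_function ::
    "(real^'n) set \<Rightarrow> real^'n \<Rightarrow> (real^'n) set \<Rightarrow> (real^'n \<Rightarrow> real) \<Rightarrow> bool" where
  "local_defining_function \<Omega> p U \<rho> \<longleftrightarrow>
     open U \<and> p \<in> U \<and> Cinf_on U \<rho> \<and> (\<forall>x\<in>U. grad \<rho> x \<noteq> 0) \<and>
     \<Omega> \<inter> U = {x \<in> U. \<rho> x < 0} \<and> frontier \<Omega> \<inter> U = {x \<in> U. \<rho> x = 0}"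

definition smooth_domain :: "(real^'n) set \<Rightarrow> bool" where
  "smooth_domain \<Omega> \<longleftrightarrow>
     open \<Omega> \<and> connected \<Omega> \<and> \<Omega> \<noteq> {} \<and>
     (\<forall>p\<in>frontier \<Omega>. \<exists>U \<rho>. local_defining_function \<Omega> p U \<rho>)"

text \<open>The vector below does not depend on the choice of the local defining function.\<close>
definition outward_unit_normal :: "(real^'n) set \<Rightarrow> real^'n \<Rightarrow> real^'n" where
  "outward_unit_normal \<Omega> p =
     (THE \<nu>. \<exists>U \<rho>. local_defining_function \<Omega> p U \<rho> \<and> \<nu> = sgn (grad \<rho> p))"

text \<open>
  The principal curvatures at \<open>p\<close> are the eigenvalues, on the tangent space, of the derivative
  of the outward unit normal field.  The normal field is extended off the boundary
  by \<open>sgn (grad \<rho> x)\<close>, which does not affect its derivative in tangential directions.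
  With this sign the unit sphere, as the boundary of the ball, has principal curvatures \<open>1\<close>.
\<close>
definition principal_curvature :: "(real^'n) set \<Rightarrow> real^'n \<Rightarrow> real \<Rightarrow> bool" where
  "principal_curvature \<Omega> p \<kappa> \<longleftrightarrow>
     (\<exists>U \<rho> N'. local_defining_function \<Omega> p U \<rho> \<and>
        ((\<lambda>x. sgn (grad \<rho> x)) has_derivative N') (at p) \<and>
        (\<exists>\<tau>. \<tau> \<noteq> 0 \<and> orthogonal \<tau> (grad \<rho> p) \<and> N' \<tau> = \<kappa> *\<^sub>R \<tau>))"

definition uniformly_convex :: "(real^'n) set \<Rightarrow> bool" where
  "uniformly_convex \<Omega> \<longleftrightarrow>
     (\<exists>c>0. \<forall>p\<in>frontier \<Omega>. \<forall>\<kappa>. principal_curvature \<Omega> p \<kappa> \<longrightarrow> c \<le> \<kappa>)"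

section \<open>The Dirichlet problem and the Dirichlet-to-Neumann map\<close>

definition admissible :: "nat \<Rightarrow> (real^'n) set \<Rightarrow> (real^'n \<Rightarrow> real) \<Rightarrow> bool" where
  "admissible k \<Omega> u \<longleftrightarrow>
     Ck_on 2 \<Omega> u \<and> (\<forall>x\<in>\<Omega>. eigenvalues (hessian u x) \<in> Gamma_cone k)"

definition hessian_solution ::
    "nat \<Rightarrow> (real^'n) set \<Rightarrow> (real^'n \<Rightarrow> real) \<Rightarrow> (real^'n \<Rightarrow> real) \<Rightarrow> (real^'n \<Rightarrow> real) \<Rightarrow> bool" where
  "hessian_solution k \<Omega> f g u \<longleftrightarrow>
     Cinf_closure \<Omega> u \<and> admissible k \<Omega> u \<and>
     (\<forall>x\<in>\<Omega>. sigma_mat k (hessian u x) = f x) \<and> (\<forall>x\<in>frontier \<Omega>. u x = g x)"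

text \<open>One-sided, so that only values of \<open>u\<close> on the closure of \<open>\<Omega>\<close> enter.\<close>
definition has_normal_derivative ::
    "(real^'n) set \<Rightarrow> (real^'n \<Rightarrow> real) \<Rightarrow> real^'n \<Rightarrow> real \<Rightarrow> bool" where
  "has_normal_derivative \<Omega> u p d \<longleftrightarrow>
     ((\<lambda>s. u (p + s *\<^sub>R outward_unit_normal \<Omega> p)) has_real_derivative d) (at_left 0)"

text \<open>
  \<open>has_DN_map k \<Omega> f g h\<close> reads: the Dirichlet-to-Neumann map for the right-hand side
  \<open>f\<close> sends the boundary data \<open>g\<close> to \<open>h\<close>.  It is a relation, as \<open>(has_derivative)\<close> is,
  because the map is given by solving a boundary value problem.  By the Caffarelli-Nirenberg-Spruck
  theorem the solution \<open>u\<close> exists and is unique on the closure of \<open>\<Omega>\<close> when \<open>\<Omega>\<close> is a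
  bounded smooth uniformly convex domain, \<open>f\<close> is smooth and positive, and \<open>g\<close> is smooth, so that
  the relation is then the graph of a function (into functions on the boundary).
\<close>
definition has_DN_map ::
    "nat \<Rightarrow> (real^'n) set \<Rightarrow> (real^'n \<Rightarrow> real) \<Rightarrow> (real^'n \<Rightarrow> real) \<Rightarrow> (real^'n \<Rightarrow> real) \<Rightarrow> bool" where
  "has_DN_map k \<Omega> f g h \<longleftrightarrow>
     (\<exists>u. hessian_solution k \<Omega> f g u \<and> (\<forall>p\<in>frontier \<Omega>. has_normal_derivative \<Omega> u p (h p)))"

section \<open>Grassmannian, orthogonal projection, Hausdorff measure\<close>

definition Grassmannian :: "nat \<Rightarrow> (real^'n) set set" where
  "Grassmannian m = {E. subspace E \<and> dim E = m}"

definition orth_proj :: "(real^'n) set \<Rightarrow> real^'n \<Rightarrow> real^'n" where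
  "orth_proj E x = (THE y. y \<in> E \<and> (\<forall>z\<in>E. orthogonal (x - y) z))"

definition phi :: "(real^'n) set \<Rightarrow> real^'n \<Rightarrow> real" where
  "phi E x = (1/2) * (norm (orth_proj E x))\<^sup>2"

text \<open>
  Boundedness is required because the library's \<open>diameter\<close> is not meaningful on unbounded sets;
  the case distinction only matters for \<open>q = 0\<close>, where empty pieces must not be counted.
\<close>
definition hausdorff_content :: "nat \<Rightarrow> real \<Rightarrow> 'a::euclidean_space set \<Rightarrow> ennreal" where
  "hausdorff_content q \<delta> A =
     (INF C \<in> {C :: nat \<Rightarrow> 'a set. A \<subseteq> (\<Union>i. C i) \<and> (\<forall>i. bounded (C i) \<and> diameter (C i) \<le> \<delta>)}.
        \<Sum>i. if C i = {} then 0
            else ennreal (unit_ball_vol (real q) * (diameter (C i) / 2) ^ q))"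

definition hausdorff_outer :: "nat \<Rightarrow> 'a::euclidean_space set \<Rightarrow> ennreal" where
  "hausdorff_outer q A = (SUP \<delta>\<in>{0<..}. hausdorff_content q \<delta> A)"

text \<open>Normalised so that on \<open>q\<close>-dimensional subspaces it is Lebesgue measure.\<close>
definition hausdorff_measure :: "nat \<Rightarrow> 'a::euclidean_space measure" where
  "hausdorff_measure q = measure_of UNIV (sets borel) (hausdorff_outer q)"

end

theory Submission
  imports Defs "HOL-Computational_Algebra.Fundamental_Theorem_Algebra" "HOL-Combinatorics.Permutations"
    "HOL-Real_Asymp.Real_Asymp"
begin

text \<open>
  Write the two solutions with boundary data \<open>t \<phi>\<^sub>E\<close> as \<open>t \<phi>\<^sub>E + w\<^sub>1\<close> and \<open>t \<phi>\<^sub>E + w\<^sub>2\<close>, and let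
  \<open>P = D\<^sup>2 \<phi>\<^sub>E\<close>, a projection of rank \<open>k - 1\<close>.  Since \<open>\<sigma>\<^sub>k(t P) = 0\<close>, comparison gives
  \<open>- K \<le> w\<^sub>i < 0\<close> with \<open>K\<close> independent of \<open>t\<close>.  Put \<open>z = w\<^sub>2 - w\<^sub>1\<close>, which has zero Cauchy data,
  \<open>M\<^sub>s = t P + D\<^sup>2(w\<^sub>1 + s z)\<close>, and let \<open>L\<^sub>s\<close> be the derivative of \<open>\<sigma>\<^sub>k\<close> at \<open>M\<^sub>s\<close>.  By Garding's
  theorem \<open>L\<^sub>s\<close> is elliptic, and its coefficients are divergence free.  Hence \<open>\<integral> L\<^sub>s(D\<^sup>2 z) = 0\<close>, so that
  the integral of \<open>\<sigma>\<^sub>k(M\<^sub>s)\<close> does not depend on \<open>s\<close>, while \<open>\<integral> L\<^sub>s(D\<^sup>2(w\<^sub>1 + s z)) \<ge> 0\<close> because the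
  function vanishes on the boundary and is negative inside.  Euler's identity
  \<open>k \<sigma>\<^sub>k(M\<^sub>s) = L\<^sub>s(M\<^sub>s)\<close> therefore yields \<open>t \<integral> L\<^sub>s(P) \<le> k \<integral> f\<close>.  For a test function \<open>\<psi>\<close> of \<open>P x\<close> alone,
  \<open>\<plusminus>D\<^sup>2 \<psi> \<le> C P\<close>, so for some \<open>s\<close> the number \<open>\<integral> \<psi> (f\<^sub>2 - f\<^sub>1) = \<integral> \<psi> L\<^sub>s(D\<^sup>2 z) = \<integral> z L\<^sub>s(D\<^sup>2 \<psi>)\<close> is \<open>O(1/t)\<close>,
  hence zero.  Letting \<open>\<psi>\<close> concentrate at a point of \<open>E\<close> gives the identity on its slice.
\<close>

section \<open>Principal minors and the spectrum of a symmetric matrix\<close>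

text \<open>The eigenvalue vector is a choice without regularity, so \<sigma>_k is carried as the
  sum of the principal \<open>k\<close>-minors, a polynomial in the matrix entries. Its derivative,
  the continuity of its coefficients and the cancellation in its divergence then become identities
  between finite sums over permutations.

  The second derivatives of the remainders w_i are never bounded uniformly in \<open>t\<close>. Two
  controls survive: the sup bound, because the lower barrier sees of t P only that it is positive
  semidefinite, and the single integral of L_s(P). The rank k - 1 is the largest for which
  \<sigma>_k(t P) vanishes, which is what makes the remainders negative. The test functions are
  constant along \<open>V\<close> because their Hessians are then dominated by P alone, the one
  matrix whose linearised integral gains the factor 1/t.

  Every integral over the segment of matrices M_s is a polynomial in \<open>s\<close>, so a mean
  value theorem for polynomials supplies the one parameter at which all estimates are
  combined.\<close>

definition minor_sum :: "nat \<Rightarrow> 'a::comm_ring_1^'n^'n \<Rightarrow> 'a" where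
  "minor_sum k M = (\<Sum>S | card S = k. \<Sum>\<pi> | \<pi> permutes S. of_int (sign \<pi>) * (\<Prod>i\<in>S. M $ i $ \<pi> i))"

lemma prod_scalar_off:
  fixes x :: "'a::comm_ring_1" and S :: "'n::finite set"
  assumes "\<pi> permutes UNIV"
  shows "(\<Prod>i\<in>UNIV - S. if i = \<pi> i then x else 0) = (if \<pi> permutes S then x ^ (CARD('n) - card S) else 0)"
proof (cases "\<pi> permutes S")
  case True
  then have "(\<Prod>i\<in>UNIV - S. if i = \<pi> i then x else 0) = (\<Prod>i\<in>UNIV - S. x)"
    by (intro prod.cong) (auto simp: permutes_def)
  with True show ?thesis by (simp add: card_Diff_subset)
next
  case False
  then obtain i where "i \<notin> S" "\<pi> i \<noteq> i"
    using assms unfolding permutes_def by auto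
  then have "(\<Prod>i\<in>UNIV - S. if i = \<pi> i then x else 0) = 0"
    by (intro prod_zero) (auto intro!: bexI[of _ i])
  with False show ?thesis by simp
qed

text \<open>Expand every factor of the Leibniz formula into entry plus diagonal shift. The set
  \<open>S\<close> of rows contributing an entry must contain all rows moved by the permutation,
  since the shift vanishes off the diagonal; grouping by the size of \<open>S\<close> leaves the
  principal minors.\<close>

lemma det_add_scalar:
  fixes A :: "'a::comm_ring_1^'n^'n"
  shows "det (A + mat x) = (\<Sum>k\<le>CARD('n). minor_sum k A * x ^ (CARD('n) - k))"
proof -
  let ?g = "\<lambda>S \<pi>. of_int (sign \<pi>) * (\<Prod>i\<in>S. A $ i $ \<pi> i) * x ^ (CARD('n) - card S)"
  have "det (A + mat x) = (\<Sum>\<pi> | \<pi> permutes UNIV. \<Sum>S\<in>UNIV. if \<pi> permutes S then ?g S \<pi> else 0)"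
    unfolding det_def
  proof (intro sum.cong refl)
    fix \<pi> :: "'n \<Rightarrow> 'n" assume "\<pi> \<in> {\<pi>. \<pi> permutes UNIV}"
    then have p: "\<pi> permutes UNIV" by simp
    have "(\<Prod>i\<in>UNIV. (A + mat x) $ i $ \<pi> i) = (\<Prod>i\<in>UNIV. A $ i $ \<pi> i + (if i = \<pi> i then x else 0))"
      by (simp add: mat_def)
    also have "\<dots> = (\<Sum>S\<in>UNIV. (\<Prod>i\<in>S. A $ i $ \<pi> i) * (if \<pi> permutes S then x ^ (CARD('n) - card S) else 0))"
      by (subst prod_add) (simp_all add: prod_scalar_off[OF p])
    finally show "of_int (sign \<pi>) * (\<Prod>i\<in>UNIV. (A + mat x) $ i $ \<pi> i) = (\<Sum>S\<in>UNIV. if \<pi> permutes S then ?g S \<pi> else 0)"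
      by (simp add: sum_distrib_left mult.assoc if_distrib cong: if_cong)
  qed
  also have "\<dots> = (\<Sum>S\<in>UNIV. \<Sum>\<pi> | \<pi> permutes UNIV. if \<pi> permutes S then ?g S \<pi> else 0)"
    by (rule sum.swap)
  also have "\<dots> = (\<Sum>S\<in>UNIV. \<Sum>\<pi> | \<pi> permutes S. ?g S \<pi>)"
    by (intro sum.cong refl sum.mono_neutral_cong_right) (auto intro: permutes_subset)
  also have "\<dots> = (\<Sum>k\<le>CARD('n). \<Sum>S | S \<in> UNIV \<and> card S = k. \<Sum>\<pi> | \<pi> permutes S. ?g S \<pi>)"
    by (rule sum.group[symmetric]) (auto intro: card_mono)
  also have "\<dots> = (\<Sum>k\<le>CARD('n). minor_sum k A * x ^ (CARD('n) - k))"
    by (intro sum.cong refl) (simp add: minor_sum_def sum_distrib_right)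
  finally show ?thesis .
qed

lemma minor_sum_diag:
  fixes d :: "'a::comm_ring_1^'n"
  shows "minor_sum k (\<chi> i j. if i = j then d $ i else 0) = (\<Sum>S | card S = k. \<Prod>i\<in>S. d $ i)"
  unfolding minor_sum_def
proof (intro sum.cong refl)
  fix S :: "'n set"
  have z: "of_int (sign \<pi>) * (\<Prod>i\<in>S. (\<chi> i j. if i = j then d $ i else 0) $ i $ \<pi> i) = 0"
    if p: "\<pi> permutes S" and ne: "\<pi> \<noteq> id" for \<pi>
  proof -
    obtain i where i: "\<pi> i \<noteq> i" using ne by (auto simp: fun_eq_iff)
    moreover have "i \<in> S" using i permutes_not_in[OF p] by blast
    ultimately have "i \<in> S" "\<pi> i \<noteq> i" by auto
    then show ?thesis by (subst prod_zero) (auto intro!: bexI[of _ i])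
  qed
  show "(\<Sum>\<pi> | \<pi> permutes S. of_int (sign \<pi>) * (\<Prod>i\<in>S. (\<chi> i j. if i = j then d $ i else 0) $ i $ \<pi> i)) = (\<Prod>i\<in>S. d $ i)"
    by (subst sum.mono_neutral_right[where S="{id}"]) (use z in \<open>auto simp: permutes_id\<close>)
qed

lemma minor_sum_scale: "minor_sum k (\<chi> i j. c * A $ i $ j) = c ^ k * minor_sum k A"
  unfolding minor_sum_def by (simp add: sum_distrib_left prod.distrib mult.left_commute)

text \<open>The characteristic polynomial of \<open>-A\<close>. With this sign the coefficients are
  the minor sums themselves, without alternating signs.\<close>

definition charpoly_neg :: "'a::comm_ring_1^'n^'n \<Rightarrow> 'a poly" where
  "charpoly_neg A = (\<Sum>k\<le>CARD('n). monom (minor_sum k A) (CARD('n) - k))"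

lemma poly_charpoly_neg: "poly (charpoly_neg A) x = det (A + mat x)"
  by (simp add: charpoly_neg_def poly_sum poly_monom det_add_scalar)

lemma coeff_charpoly_neg:
  assumes "k \<le> CARD('n)"
  shows "coeff (charpoly_neg (A :: 'a::comm_ring_1^'n^'n)) (CARD('n) - k) = minor_sum k A"
proof -
  have "coeff (charpoly_neg A) (CARD('n) - k) = (\<Sum>j\<le>CARD('n). if j = k then minor_sum j A else 0)"
    unfolding charpoly_neg_def coeff_sum using assms by (intro sum.cong) auto
  with assms show ?thesis by simp
qed

lemma minor_sum_0 [simp]: "minor_sum 0 A = 1"
  by (simp add: minor_sum_def)

lemma charpoly_neg_monic:
  fixes A :: "'a::comm_ring_1^'n^'n"
  shows "degree (charpoly_neg A) = CARD('n)" "coeff (charpoly_neg A) CARD('n) = 1"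
proof -
  show 1: "coeff (charpoly_neg A) CARD('n) = 1" using coeff_charpoly_neg[of 0 A] by simp
  have "degree (charpoly_neg A) \<le> CARD('n)"
    unfolding charpoly_neg_def by (rule degree_sum_le) (auto intro: order_trans[OF degree_monom_le])
  with 1 show "degree (charpoly_neg A) = CARD('n)" 
    by (metis le_degree le_antisym one_neq_zero)
qed

section \<open>The spectrum of a real symmetric matrix\<close>

definition complex_matrix :: "real^'n^'n \<Rightarrow> complex^'n^'n" where
  "complex_matrix A = (\<chi> i j. complex_of_real (A $ i $ j))"

lemma minor_sum_complex_matrix: "minor_sum k (complex_matrix A) = complex_of_real (minor_sum k A)"
  by (simp add: minor_sum_def complex_matrix_def)

lemma mat_vector_mult: "mat x *v v = (\<chi> i. x * v $ i)"
  by (simp add: matrix_vector_mult_def mat_def vec_eq_iff if_distrib if_distribR cong: if_cong)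

text \<open>The Hermitian form of \<open>A\<close> at a kernel vector \<open>v\<close> equals its
  own conjugate, and it also equals \<open>- z\<close> times the positive number |v|^2.\<close>

lemma symmetric_eigenvalue_real:
  fixes A :: "real^'n^'n"
  assumes sym: "transpose A = A" and z: "det (complex_matrix A + mat z) = 0"
  shows "Im z = 0"
proof -
  let ?B = "complex_matrix A + mat z"
  have "\<not> invertible ?B" using z by (simp add: invertible_det_nz)
  then obtain v where v: "v \<noteq> 0" "?B *v v = 0"
    by (metis invertible_left_inverse matrix_left_invertible_ker)
  have As: "A $ i $ j = A $ j $ i" for i j
    using arg_cong[OF sym, of "\<lambda>B. B $ j $ i"] by (simp add: transpose_def)
  have eq: "(\<Sum>j\<in>UNIV. of_real (A $ i $ j) * v $ j) = - z * v $ i" for i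
  proof -
    have "(?B *v v) $ i = (\<Sum>j\<in>UNIV. of_real (A $ i $ j) * v $ j) + z * v $ i"
      by (simp add: matrix_vector_mult_add_rdistrib mat_vector_mult)
        (simp add: matrix_vector_mult_def complex_matrix_def)
    then show ?thesis using v(2) by (simp add: eq_neg_iff_add_eq_0)
  qed
  let ?Q = "\<Sum>i\<in>UNIV. \<Sum>j\<in>UNIV. cnj (v $ i) * (of_real (A $ i $ j) * v $ j)"
  have "?Q = (\<Sum>i\<in>UNIV. cnj (v $ i) * (- z * v $ i))"
    by (simp add: sum_distrib_left[symmetric] eq)
  also have "\<dots> = - z * of_real (\<Sum>i\<in>UNIV. (cmod (v $ i))\<^sup>2)"
  proof -
    have "cnj x * (- z * x) = - z * of_real ((cmod x)\<^sup>2)" for x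
      by (simp only: complex_norm_square) (simp add: mult_ac)
    then show ?thesis by (simp only: sum_distrib_left of_real_sum)
  qed
  finally have Q: "?Q = - z * of_real (\<Sum>i\<in>UNIV. (cmod (v $ i))\<^sup>2)" .
  have "cnj ?Q = (\<Sum>i\<in>UNIV. \<Sum>j\<in>UNIV. v $ i * (of_real (A $ i $ j) * cnj (v $ j)))" by simp
  also have "\<dots> = (\<Sum>j\<in>UNIV. \<Sum>i\<in>UNIV. v $ i * (of_real (A $ i $ j) * cnj (v $ j)))" by (rule sum.swap)
  also have "\<dots> = ?Q" by (intro sum.cong refl, subst As) (simp add: mult_ac)
  finally have cQ: "cnj ?Q = ?Q" .
  have "Im q = 0" if "cnj q = q" for q using arg_cong[OF that, of Im] by simp
  from this[OF cQ] have "Im ?Q = 0" .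
  then have "Im z * (\<Sum>i\<in>UNIV. (cmod (v $ i))\<^sup>2) = 0" unfolding Q by (simp del: of_real_sum of_real_power)
  moreover have "(\<Sum>i\<in>UNIV. (cmod (v $ i))\<^sup>2) \<noteq> 0"
    using v(1) by (subst sum_nonneg_eq_0_iff) (auto simp: vec_eq_iff)
  ultimately show ?thesis by simp
qed

text \<open>Factoring over the complex numbers gives the roots with multiplicity; the preceding
  lemma makes them real, and the vanishing of a real determinant then yields a real eigenvector for
  each. The sign convention is that of \<open>charpoly_neg\<close>: its roots are the negatives of
  the \<open>l $ i\<close>.\<close>

lemma symmetric_spectrum:
  fixes A :: "real^'n^'n"
  assumes sym: "transpose A = A"
  obtains l :: "real^'n"
  where "\<And>i. \<exists>v. v \<noteq> 0 \<and> A *v v = l $ i *\<^sub>R v"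
    and "\<And>x. det (complex_matrix A + mat x) = (\<Prod>i\<in>UNIV. x + complex_of_real (l $ i))"
proof -
  let ?p = "charpoly_neg (complex_matrix A)"
  obtain r where r: "smult (lead_coeff ?p) (\<Prod>i<degree ?p. [:- r i, 1:]) = ?p"
    using complex_poly_decompose' by blast
  then have p: "?p = (\<Prod>i<CARD('n). [:- r i, 1:])"
    by (simp add: charpoly_neg_monic)
  obtain e where e: "bij_betw e (UNIV :: 'n set) {..<CARD('n)}"
    by (metis finite_class.finite_UNIV ex_bij_betw_finite_nat atLeast0LessThan)
  define l :: "real^'n" where "l = (\<chi> i. - Re (r (e i)))"
  have pr: "poly ?p x = (\<Prod>i\<in>UNIV. x - r (e i))" for x
    unfolding p poly_prod using prod.reindex_bij_betw[OF e, of "\<lambda>i. x - r i"] by simp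
  have root: "poly ?p (r (e i)) = 0" for i
    unfolding pr by (rule prod_zero) auto
  have re: "r (e i) = - complex_of_real (l $ i)" for i
    using symmetric_eigenvalue_real[OF sym, of "r (e i)"] root[of i]
    by (simp add: poly_charpoly_neg complex_eq_iff l_def)
  show thesis
  proof
    show det: "det (complex_matrix A + mat x) = (\<Prod>i\<in>UNIV. x + complex_of_real (l $ i))" for x
      using pr[of x] by (simp add: poly_charpoly_neg re)
    fix i
    have "complex_of_real (det (A + mat (- l $ i))) = det (complex_matrix A + mat (- of_real (l $ i)))"
      unfolding det_add_scalar by (simp add: minor_sum_complex_matrix)
    also have "\<dots> = 0" unfolding det by (rule prod_zero) auto
    finally have "\<not> invertible (A + mat (- l $ i))" by (simp add: invertible_det_nz)
    then obtain v where "v \<noteq> 0" "(A + mat (- l $ i)) *v v = 0"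
      by (metis invertible_left_inverse matrix_left_invertible_ker)
    moreover have "(A + mat (- l $ i)) *v v = A *v v - l $ i *\<^sub>R v"
      by (simp add: vec_eq_iff matrix_vector_mult_add_rdistrib mat_vector_mult)
    ultimately show "\<exists>v. v \<noteq> 0 \<and> A *v v = l $ i *\<^sub>R v" by auto
  qed
qed

section \<open>Principal minors along a line of matrices\<close>

text \<open>The minor sum is taken over the ring of polynomials in \<open>s\<close>, so that degree,
  roots and Taylor coefficients of the map from \<open>s\<close> to \<sigma>_k(A + s B) are those of
  an actual polynomial.\<close>

definition sig_poly :: "nat \<Rightarrow> 'a::comm_ring_1^'n^'n \<Rightarrow> 'a^'n^'n \<Rightarrow> 'a poly" where
  "sig_poly k A B = minor_sum k (\<chi> i j. [:A $ i $ j, B $ i $ j:])"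

lemma poly_sig_poly:
  "poly (sig_poly k A B) s = minor_sum k (\<chi> i j. A $ i $ j + s * B $ i $ j)"
  by (simp add: sig_poly_def minor_sum_def poly_sum poly_prod)

lemma coeff_pCons_linear_mult:
  fixes p :: "'a::comm_ring_1 poly"
  shows "coeff ([:a, b:] * p) m = a * coeff p m + (if m = 0 then 0 else b * coeff p (m - 1))"
  by (cases m) (simp_all add: mult_pCons_left)

lemma coeff_prod_linear:
  fixes a b :: "'i \<Rightarrow> 'a::comm_ring_1"
  assumes "finite S"
  shows "coeff (\<Prod>i\<in>S. [:a i, b i:]) (card S) = (\<Prod>i\<in>S. b i)" "m > card S \<Longrightarrow> coeff (\<Prod>i\<in>S. [:a i, b i:]) m = 0"
  using assms
proof (induction S arbitrary: m rule: finite_induct)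
  case (insert x S)
  { case 1 then show ?case using insert by (simp add: coeff_pCons_linear_mult del: mult_pCons_left) next
    case 2 then show ?case using insert by (simp add: coeff_pCons_linear_mult del: mult_pCons_left) }
qed simp_all

lemma coeff_sig_poly:
  "coeff (sig_poly k A B) m = (\<Sum>S | card S = k. \<Sum>\<pi> | \<pi> permutes S. of_int (sign \<pi>) * coeff (\<Prod>i\<in>S. [:A $ i $ \<pi> i, B $ i $ \<pi> i:]) m)"
  by (simp add: sig_poly_def minor_sum_def coeff_sum of_int_poly)

lemma coeff_sig_poly_top: "coeff (sig_poly k A B) k = minor_sum k B"
  unfolding coeff_sig_poly minor_sum_def
  by (intro sum.cong refl) (auto simp: coeff_prod_linear(1))

lemma coeff_sig_poly_above: "m > k \<Longrightarrow> coeff (sig_poly k A B) m = 0"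
  unfolding coeff_sig_poly by (intro sum.neutral ballI) (auto simp: coeff_prod_linear(2))

lemma degree_sig_poly: "minor_sum k B \<noteq> 0 \<Longrightarrow> degree (sig_poly k A B) = k"
  by (intro antisym degree_le le_degree) (auto simp: coeff_sig_poly_top coeff_sig_poly_above)

lemma degree_sig_poly_le: "degree (sig_poly k A B) \<le> k"
  by (intro degree_le) (auto simp: coeff_sig_poly_above)

lemma coeff_sig_poly_0: "coeff (sig_poly k A B) 0 = minor_sum k A"
  using poly_sig_poly[of k A B 0] by (simp add: poly_0_coeff_0)

text \<open>The gradient of \<sigma>_k with all matrix entries treated as independent variables: the
  factor in row \<open>i\<close> is struck from every monomial that uses the entry (i, j).\<close>

definition minor_sum_deriv :: "nat \<Rightarrow> 'a::comm_ring_1^'n^'n \<Rightarrow> 'n \<Rightarrow> 'n \<Rightarrow> 'a" where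
  "minor_sum_deriv k M i j =
     (\<Sum>S | card S = k. \<Sum>\<pi> | \<pi> permutes S.
        if i \<in> S \<and> \<pi> i = j then of_int (sign \<pi>) * (\<Prod>l\<in>S - {i}. M $ l $ \<pi> l) else 0)"

definition minor_sum_lin :: "nat \<Rightarrow> 'a::comm_ring_1^'n^'n \<Rightarrow> 'a^'n^'n \<Rightarrow> 'a" where
  "minor_sum_lin k M N = (\<Sum>i\<in>UNIV. \<Sum>j\<in>UNIV. minor_sum_deriv k M i j * N $ i $ j)"

lemma coeff_1_prod_linear:
  fixes a b :: "'i \<Rightarrow> 'a::{comm_ring_1,ring_no_zero_divisors}"
  shows "coeff (\<Prod>i\<in>S. [:a i, b i:]) 1 = (\<Sum>i\<in>S. b i * (\<Prod>l\<in>S - {i}. a l))"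
proof -
  have "coeff (\<Prod>i\<in>S. [:a i, b i:]) 1 = poly (pderiv (\<Prod>i\<in>S. [:a i, b i:])) 0"
    by (simp add: poly_0_coeff_0 coeff_pderiv)
  also have "\<dots> = (\<Sum>i\<in>S. b i * (\<Prod>l\<in>S - {i}. a l))"
    by (simp add: pderiv_prod poly_sum poly_prod pderiv_pCons mult.commute)
  finally show ?thesis .
qed

lemma minor_sum_lin_expand:
  "minor_sum_lin k M N = (\<Sum>S | card S = k. \<Sum>\<pi> | \<pi> permutes S. \<Sum>i\<in>S. of_int (sign \<pi>) * (N $ i $ \<pi> i * (\<Prod>l\<in>S - {i}. M $ l $ \<pi> l)))"
proof -
  let ?t = "\<lambda>S \<pi> i. of_int (sign \<pi>) * (\<Prod>l\<in>S - {i}. M $ l $ \<pi> l)"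
  have "minor_sum_lin k M N = (\<Sum>i\<in>UNIV. \<Sum>j\<in>UNIV. \<Sum>S | card S = k. \<Sum>\<pi> | \<pi> permutes S.
        if i \<in> S \<and> \<pi> i = j then ?t S \<pi> i * N $ i $ j else 0)"
    unfolding minor_sum_lin_def minor_sum_deriv_def sum_distrib_right
    by (intro sum.cong refl) auto
  also have "\<dots> = (\<Sum>S | card S = k. \<Sum>\<pi> | \<pi> permutes S. \<Sum>i\<in>UNIV. \<Sum>j\<in>UNIV.
        if i \<in> S \<and> \<pi> i = j then ?t S \<pi> i * N $ i $ j else 0)"
    by (simp only: sum.swap[where B="UNIV :: 'b set" and A="{S :: 'b set. card S = k}"]
        sum.swap[where B="UNIV :: 'b set" and A="{\<pi> :: 'b \<Rightarrow> 'b. \<pi> permutes _}"])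
  also have "\<dots> = (\<Sum>S | card S = k. \<Sum>\<pi> | \<pi> permutes S. \<Sum>i\<in>UNIV. if i \<in> S then ?t S \<pi> i * N $ i $ \<pi> i else 0)"
    by (intro sum.cong refl) (auto simp: if_distrib cong: if_cong)
  also have "\<dots> = (\<Sum>S | card S = k. \<Sum>\<pi> | \<pi> permutes S. \<Sum>i\<in>S. ?t S \<pi> i * N $ i $ \<pi> i)"
    by (intro sum.cong refl sum.mono_neutral_cong_right) auto
  finally show ?thesis by (simp add: mult_ac)
qed

text \<open>This turns statements about Taylor coefficients into statements about the linearisation:
  nonnegative coefficients will mean ellipticity.\<close>

lemma coeff_sig_poly_1:
  fixes A B :: "'a::{comm_ring_1,ring_no_zero_divisors}^'n^'n"
  shows "coeff (sig_poly k A B) 1 = minor_sum_lin k A B"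
  unfolding coeff_sig_poly minor_sum_lin_expand coeff_1_prod_linear sum_distrib_left ..

lemma continuous_on_coeff_prod_linear:
  fixes a b :: "'i \<Rightarrow> 'x::topological_space \<Rightarrow> 'a::{real_normed_field}"
  assumes "finite S" "\<And>i. i \<in> S \<Longrightarrow> continuous_on T (a i)" "\<And>i. i \<in> S \<Longrightarrow> continuous_on T (b i)"
  shows "continuous_on T (\<lambda>x. coeff (\<Prod>i\<in>S. [:a i x, b i x:]) m)"
  using assms
proof (induction S arbitrary: m rule: finite_induct)
  case (insert x S)
  then show ?case
    by (cases m) (auto simp: coeff_pCons_linear_mult simp del: mult_pCons_left intro!: continuous_intros)
qed simp

lemma continuous_on_coeff_sig_poly:
  fixes A B :: "'x::topological_space \<Rightarrow> 'a::{real_normed_field}^'n^'n"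
  assumes "\<And>i j. continuous_on T (\<lambda>x. A x $ i $ j)" "\<And>i j. continuous_on T (\<lambda>x. B x $ i $ j)"
  shows "continuous_on T (\<lambda>x. coeff (sig_poly k (A x) (B x)) m)"
  unfolding coeff_sig_poly
  by (intro continuous_on_sum continuous_on_mult_left continuous_on_coeff_prod_linear assms) simp

lemma continuous_on_minor_sum:
  fixes A :: "'x::topological_space \<Rightarrow> 'a::{real_normed_field}^'n^'n"
  assumes "\<And>i j. continuous_on T (\<lambda>x. A x $ i $ j)"
  shows "continuous_on T (\<lambda>x. minor_sum k (A x))"
  unfolding minor_sum_def by (intro continuous_intros assms)

text \<open>Gauss-Lucas for a line. Off the line, p'/p at \<open>z\<close> is the sum of the
  reciprocals of z - r_i, whose imaginary parts all have the same strict sign, so it cannot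
  vanish.\<close>

lemma pderiv_roots_on_line:
  fixes p :: "complex poly"
  assumes deg: "degree p > 0" and roots: "\<And>z. poly p z = 0 \<Longrightarrow> Im z = c"
    and z: "poly (pderiv p) z = 0"
  shows "Im z = c"
proof (rule ccontr)
  assume ne: "Im z \<noteq> c"
  obtain r where r: "smult (lead_coeff p) (\<Prod>i<degree p. [:- r i, 1:]) = p"
    using complex_poly_decompose' by blast
  let ?n = "degree p"
  have p0: "p \<noteq> 0" using deg by auto
  have pe: "poly p x = lead_coeff p * (\<Prod>i<?n. x - r i)" for x
    by (subst (1) r[symmetric]) (simp add: poly_prod)
  have ri: "Im (r i) = c" if "i < ?n" for i
  proof (rule roots)
    have "(\<Prod>j<?n. r i - r j) = 0" by (rule prod_zero) (use that in auto)
    then show "poly p (r i) = 0" unfolding pe by simp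
  qed
  have zi: "z - r i \<noteq> 0" if "i < ?n" for i using ri[OF that] ne by auto
  have "poly (pderiv p) z = lead_coeff p * (\<Sum>i<?n. \<Prod>j\<in>{..<?n} - {i}. z - r j)"
    by (subst (1) r[symmetric]) (simp add: pderiv_smult pderiv_prod poly_sum poly_prod pderiv_pCons)
  also have "(\<Sum>i<?n. \<Prod>j\<in>{..<?n} - {i}. z - r j) = (\<Sum>i<?n. (\<Prod>j<?n. z - r j) * inverse (z - r i))"
    by (intro sum.cong refl) (subst prod.remove[of "{..<?n}"], use zi in auto)
  finally have "(\<Prod>j<?n. z - r j) * (\<Sum>i<?n. inverse (z - r i)) = 0"
    using z p0 by (simp flip: sum_distrib_left)
  then have "(\<Sum>i<?n. inverse (z - r i)) = 0" using zi by (auto simp: prod_zero_iff)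
  then have "Im (\<Sum>i<?n. inverse (z - r i)) = 0" by simp
  also have "Im (\<Sum>i<?n. inverse (z - r i)) = (\<Sum>i<?n. - (Im z - c) * (1 / (cmod (z - r i))\<^sup>2))"
    unfolding Im_sum by (intro sum.cong refl) (simp add: ri cmod_power2)
  also have "\<dots> = - (Im z - c) * (\<Sum>i<?n. 1 / (cmod (z - r i))\<^sup>2)" by (simp add: sum_distrib_left)
  finally have "(\<Sum>i<?n. 1 / (cmod (z - r i))\<^sup>2) = 0" using ne by simp
  moreover have "(\<Sum>i<?n. 1 / (cmod (z - r i))\<^sup>2) > 0"
    by (rule sum_pos) (use zi deg in auto)
  ultimately show False by simp
qed

lemma higher_pderiv_roots_on_line:
  fixes p :: "complex poly"
  assumes "\<And>z. poly p z = 0 \<Longrightarrow> Im z = c" "m \<le> degree p" "p \<noteq> 0" "poly ((pderiv ^^ m) p) z = 0"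
  shows "Im z = c"
  using assms(2,4)
proof (induction m arbitrary: z)
  case 0 then show ?case using assms by simp
next
  case (Suc m)
  have "degree ((pderiv ^^ m) p) > 0" using Suc.prems by (simp add: degree_higher_pderiv)
  then show ?case using Suc by (auto intro: pderiv_roots_on_line[of "(pderiv ^^ m) p"])
qed

text \<open>Up to a factorial, the minor sum is the (n - k)-th derivative at 0 of det(A + c + x).
  The roots in \<open>x\<close> of that determinant lie on the line of imaginary part
  \<open>- Im c\<close>, and so do those of its derivatives; 0 is not on this line.\<close>

lemma minor_sum_shift_nonzero:
  fixes A :: "real^'n^'n"
  assumes sym: "transpose A = A" and k: "k \<le> CARD('n)" and c: "Im c \<noteq> 0"
  shows "minor_sum k (complex_matrix A + mat c) \<noteq> 0"
proof
  assume z: "minor_sum k (complex_matrix A + mat c) = 0"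
  let ?Q = "charpoly_neg (complex_matrix A + mat c)" and ?m = "CARD('n) - k"
  have mm: "mat c + mat x = (mat (c + x) :: complex^'n^'n)" for x by (simp add: mat_def vec_eq_iff)
  have roots: "Im x = - Im c" if "poly ?Q x = 0" for x
    using symmetric_eigenvalue_real[OF sym, of "c + x"] that
    by (simp add: poly_charpoly_neg add.assoc mm)
  have "poly ((pderiv ^^ ?m) ?Q) 0 = 0"
    using z k by (simp add: poly_0_coeff_0 coeff_higher_pderiv coeff_charpoly_neg)
  moreover have "?Q \<noteq> 0" using charpoly_neg_monic[of "complex_matrix A + mat c"] by auto
  ultimately have "Im 0 = - Im c"
    using higher_pderiv_roots_on_line[of ?Q "- Im c" ?m 0] roots by (simp add: charpoly_neg_monic)
  with c show False by simp
qed

section \<open>Hyperbolicity in the sense of Garding\<close>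

text \<open>Every root is at distance at least \<open>Im (w * z)\<close> from \<open>z\<close>. The
  bound depends only on degree and leading coefficient and therefore passes to limits. The unit
  factor \<open>w\<close> selects the half plane: 1 for the upper one, the imaginary unit for the
  right one.\<close>

lemma poly_half_plane_lower_bound:
  fixes p :: "complex poly"
  assumes lead: "degree p = k" and roots: "\<And>r. poly p r = 0 \<Longrightarrow> Im (w * r) \<le> 0"
    and w: "cmod w = 1" and z: "Im (w * z) > 0"
  shows "cmod (lead_coeff p) * Im (w * z) ^ k \<le> cmod (poly p z)"
proof -
  obtain r where r: "smult (lead_coeff p) (\<Prod>i<degree p. [:- r i, 1:]) = p"
    using complex_poly_decompose' by blast
  have pe: "poly p x = lead_coeff p * (\<Prod>i<k. x - r i)" for x
    by (subst (1) r[symmetric]) (simp add: poly_prod lead)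
  have "Im (w * z) \<le> cmod (z - r i)" if "i < k" for i
  proof -
    have "(\<Prod>j<k. r i - r j) = 0" by (rule prod_zero) (use that in auto)
    then have "Im (w * r i) \<le> 0" using roots[of "r i"] unfolding pe by simp
    then have "Im (w * z) \<le> Im (w * (z - r i))" by (simp add: algebra_simps)
    also have "\<dots> \<le> cmod (w * (z - r i))" by (rule order_trans[OF abs_ge_self abs_Im_le_cmod])
    finally show ?thesis by (simp add: norm_mult w)
  qed
  then have "(\<Prod>i<k. Im (w * z)) \<le> (\<Prod>i<k. cmod (z - r i))"
    using z by (intro prod_mono) auto
  then show ?thesis unfolding pe[of z] norm_mult prod_norm[symmetric]
    by (intro mult_left_mono) auto
qed

text \<open>Cauchy's bound. It supplies compactness of the roots along a family with fixed leading
  coefficient.\<close>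

lemma poly_root_bound:
  fixes p :: "complex poly"
  assumes deg: "degree p = k" and c: "lead_coeff p \<noteq> 0" and root: "poly p r = 0"
  shows "cmod r \<le> 1 + (\<Sum>i<k. cmod (coeff p i)) / cmod (lead_coeff p)"
proof (cases "cmod r \<le> 1")
  case True
  then show ?thesis by (intro add_increasing2 divide_nonneg_nonneg sum_nonneg) auto
next
  case False
  have k: "k > 0"
  proof (rule ccontr)
    assume "\<not> k > 0"
    then obtain a where "p = [:a:]" using deg by (auto elim: degree_eq_zeroE)
    then show False using root c by simp
  qed
  have "0 = lead_coeff p * r ^ k + (\<Sum>i<k. coeff p i * r ^ i)"
    using root unfolding poly_altdef deg
    by (simp add: lessThan_Suc_atMost[symmetric] add.commute)
  then have "lead_coeff p * r ^ k = - (\<Sum>i<k. coeff p i * r ^ i)" by (simp add: eq_neg_iff_add_eq_0)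
  then have "cmod (lead_coeff p) * cmod r ^ k = cmod (\<Sum>i<k. coeff p i * r ^ i)"
    by (simp only: norm_mult[symmetric] norm_power[symmetric] norm_minus_cancel)
  also have "\<dots> \<le> (\<Sum>i<k. cmod (coeff p i * r ^ i))" by (rule norm_sum)
  also have "\<dots> \<le> (\<Sum>i<k. cmod (coeff p i) * cmod r ^ (k - 1))"
    unfolding norm_mult norm_power
    by (intro sum_mono mult_left_mono power_increasing) (use False in auto)
  also have "\<dots> = (\<Sum>i<k. cmod (coeff p i)) * cmod r ^ (k - 1)" by (simp add: sum_distrib_right)
  finally have "(cmod (lead_coeff p) * cmod r) * cmod r ^ (k - 1) \<le> (\<Sum>i<k. cmod (coeff p i)) * cmod r ^ (k - 1)"
    using k by (cases k) (auto simp: mult_ac)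
  moreover have "cmod r ^ (k - 1) > 0" by (rule zero_less_power) (use False in linarith)
  ultimately have "cmod (lead_coeff p) * cmod r \<le> (\<Sum>i<k. cmod (coeff p i))" by simp
  then have "cmod r \<le> (\<Sum>i<k. cmod (coeff p i)) / cmod (lead_coeff p)"
    using c by (simp add: pos_le_divide_eq mult.commute)
  then show ?thesis by simp
qed

text \<open>A homotopy argument without following individual roots. The parameters with all roots in
  the open half plane form a closed set, by the lower bound above; those with some root in the
  opposite half plane form a closed set, by compactness of the roots. No root lies on the separating
  line, so the two sets split the connected parameter interval.\<close>

lemma roots_stay_in_half_plane:
  fixes P :: "real \<Rightarrow> complex poly"
  assumes cont: "\<And>m. continuous_on {0..1} (\<lambda>\<tau>. coeff (P \<tau>) m)"
    and deg: "\<And>\<tau>. \<tau> \<in> {0..1} \<Longrightarrow> degree (P \<tau>) = k"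
    and lead: "\<And>\<tau>. \<tau> \<in> {0..1} \<Longrightarrow> coeff (P \<tau>) k = c" and c: "c \<noteq> 0"
    and no: "\<And>\<tau> s. \<tau> \<in> {0..1} \<Longrightarrow> poly (P \<tau>) s = 0 \<Longrightarrow> Im (w * s) \<noteq> 0"
    and w: "cmod w = 1"
    and init: "\<And>s. poly (P 0) s = 0 \<Longrightarrow> Im (w * s) < 0"
    and s: "poly (P 1) s = 0"
  shows "Im (w * s) < 0"
proof -
  define G where "G = {\<tau> \<in> {0..1}. \<forall>s. poly (P \<tau>) s = 0 \<longrightarrow> Im (w * s) < 0}"
  define B where "B = {\<tau> \<in> {0..1}. \<exists>s. poly (P \<tau>) s = 0 \<and> Im (w * s) > 0}"
  have pP: "poly (P \<tau>) z = (\<Sum>i\<le>k. coeff (P \<tau>) i * z ^ i)" if "\<tau> \<in> {0..1}" for \<tau> z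
    using deg[OF that] by (simp add: poly_altdef)
  have lim: "(\<lambda>n. poly (P (t n)) (z n)) \<longlonglongrightarrow> poly (P t0) z0"
    if t: "\<And>n. t n \<in> {0..1}" "t \<longlonglongrightarrow> t0" and t0: "t0 \<in> {0..1}" and z: "z \<longlonglongrightarrow> z0" for t z t0 z0
  proof -
    have "(\<lambda>n. coeff (P (t n)) i) \<longlonglongrightarrow> coeff (P t0) i" for i
      by (rule continuous_on_tendsto_compose[OF cont t(2) t0]) (use t in auto)
    then show ?thesis unfolding pP[OF t(1)] pP[OF t0] by (intro tendsto_intros z)
  qed
  have "closed G" unfolding closed_sequential_limits
  proof (intro allI impI, elim conjE)
    fix t t0 assume tG: "\<forall>n. t n \<in> G" and t: "t \<longlonglongrightarrow> t0"
    have t01: "t n \<in> {0..1}" for n using tG by (auto simp: G_def)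
    have t0: "t0 \<in> {0..1}" using closed_sequentially[OF closed_atLeastAtMost t01 t] .
    have "Im (w * s) < 0" if s: "poly (P t0) s = 0" for s
    proof (rule ccontr)
      assume "\<not> Im (w * s) < 0"
      with no[OF t0 s] have pos: "Im (w * s) > 0" by auto
      have "cmod c * Im (w * s) ^ k \<le> cmod (poly (P (t n)) s)" for n
      proof -
        have "Im (w * r) \<le> 0" if "poly (P (t n)) r = 0" for r
          using tG that unfolding G_def by (blast intro: less_imp_le)
        from poly_half_plane_lower_bound[OF deg[OF t01] this w pos] show ?thesis
          using deg[OF t01] lead[OF t01] by simp
      qed
      moreover have "(\<lambda>n. cmod (poly (P (t n)) s)) \<longlonglongrightarrow> cmod (poly (P t0) s)"
        by (intro tendsto_norm lim t01 t t0 tendsto_const)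
      ultimately have "cmod c * Im (w * s) ^ k \<le> cmod (poly (P t0) s)"
        by (intro LIMSEQ_le_const) auto
      moreover have "cmod c * Im (w * s) ^ k > 0" using c pos by (intro mult_pos_pos zero_less_power) auto
      ultimately show False using s by (simp del: times_complex.sel)
    qed
    with t0 show "t0 \<in> G" by (auto simp: G_def)
  qed
  moreover have "closed B" unfolding closed_sequential_limits
  proof (intro allI impI, elim conjE)
    fix t t0 assume tB: "\<forall>n. t n \<in> B" and t: "t \<longlonglongrightarrow> t0"
    have t01: "t n \<in> {0..1}" for n using tB by (auto simp: B_def)
    have t0: "t0 \<in> {0..1}" using closed_sequentially[OF closed_atLeastAtMost t01 t] .
    have "\<forall>n. \<exists>s. poly (P (t n)) s = 0 \<and> Im (w * s) > 0" using tB by (auto simp: B_def)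
    then obtain r where r: "\<And>n. poly (P (t n)) (r n) = 0" "\<And>n. Im (w * r n) > 0" by metis
    \<comment> \<open>The leading coefficient is the constant \<open>c\<close>, so Cauchy's bound is
      continuous in the parameter and all the roots \<open>r n\<close> stay in one ball.\<close>
    let ?b = "\<lambda>\<tau>. 1 + (\<Sum>i<k. cmod (coeff (P \<tau>) i)) / cmod c"
    have "continuous_on {0..1} ?b" using c by (intro continuous_intros cont) auto
    then have "compact (?b ` {0..1})" by (rule compact_continuous_image) simp
    then obtain K where K: "\<And>\<tau>. \<tau> \<in> {0..1} \<Longrightarrow> ?b \<tau> \<le> K"
      using bounded_imp_bdd_above[OF compact_imp_bounded] unfolding bdd_above_def by fastforce
    have "r n \<in> cball 0 K" for n
      using poly_root_bound[of "P (t n)" k "r n"] deg[OF t01] lead[OF t01] c r(1) K[OF t01[of n]] by (simp add: )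
    then obtain l q where q: "strict_mono q" "(r \<circ> q) \<longlonglongrightarrow> l"
      using compact_cball[of "0::complex" K] unfolding compact_def by meson
    have "(\<lambda>n. poly (P (t (q n))) ((r \<circ> q) n)) \<longlonglongrightarrow> poly (P t0) l"
      using LIMSEQ_subseq_LIMSEQ[OF t q(1)] by (intro lim t01 t0 q(2)) (simp add: o_def)
    then have l: "poly (P t0) l = 0" using r(1) by (simp add: LIMSEQ_const_iff)
    have "(\<lambda>n. Im (w * (r \<circ> q) n)) \<longlonglongrightarrow> Im (w * l)" by (intro tendsto_intros q)
    then have "Im (w * l) \<ge> 0"
      by (rule LIMSEQ_le_const) (use r(2) in \<open>auto intro: less_imp_le simp del: times_complex.sel\<close>)
    with no[OF t0 l] l t0 show "t0 \<in> B" unfolding B_def by (intro CollectI conjI exI[of _ l]) (auto simp: order_le_less)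
  qed
  moreover have "{0..1} \<subseteq> G \<union> B" "G \<inter> B \<inter> {0..1} = {}"
    unfolding G_def B_def using no by (auto simp del: times_complex.sel) (metis linorder_neqE)
  moreover have "0 \<in> G" using init by (auto simp: G_def simp del: times_complex.sel)
  ultimately have "B \<inter> {0..1} = {}"
    using connected_Icc[of "0::real" 1] unfolding connected_closed by (metis IntI atLeastAtMost_iff empty_iff order_refl zero_le_one)
  then have "1 \<notin> B" by auto
  with no[of 1 s] s show ?thesis unfolding B_def by (auto simp del: times_complex.sel) 
qed

text \<open>The Garding cone of \<sigma>_k in the direction of the identity: along the ray from
  \<open>A\<close> towards the identity \<sigma>_k never vanishes. This form needs one function
  only, and openness or connected components never have to be discussed.\<close>

definition garding_cone :: "nat \<Rightarrow> (real^'n^'n) set" where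
  "garding_cone k = {A. transpose A = A \<and> (\<forall>s\<ge>0. minor_sum k (A + mat s) > 0)}"

lemma mat_add: "mat a + mat b = (mat (a + b) :: 'a::comm_ring_1^'n^'n)"
  by (simp add: mat_def vec_eq_iff)

lemma complex_matrix_simps:
  "complex_matrix (A + B) = complex_matrix A + complex_matrix B"
  "complex_matrix (mat s) = mat (complex_of_real s)"
  by (simp_all add: complex_matrix_def vec_eq_iff mat_def)

text \<open>Hyperbolicity passes from the identity direction to every direction \<open>a\<close> in
  the cone. Shift \<open>b\<close> by a small imaginary multiple of the identity: real roots become
  impossible, and at the start of the homotopy from 0 to \<open>b\<close> all roots lie in the lower
  half plane. Removing the shift excludes roots in the upper half plane, and conjugation those in
  the lower.\<close>

lemma garding_cone_hyperbolic:
  fixes a b :: "real^'n^'n"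
  assumes k: "k \<le> CARD('n)" and a: "a \<in> garding_cone k" and b: "transpose b = b"
    and z: "poly (sig_poly k (complex_matrix b) (complex_matrix a)) z = 0"
  shows "Im z = 0"
proof -
  have sa: "transpose a = a" and a0: "minor_sum k a > 0" and am: "\<And>s. s \<ge> 0 \<Longrightarrow> minor_sum k (a + mat s) > 0"
  proof -
    show am: "minor_sum k (a + mat s) > 0" if "s \<ge> 0" for s
      using a that by (auto simp: garding_cone_def)
    have "mat 0 = (0 :: real^'n^'n)" by (simp add: mat_def vec_eq_iff)
    with am[of 0] show "minor_sum k a > 0" by simp
    show "transpose a = a" using a by (auto simp: garding_cone_def)
  qed
  \<comment> \<open>\<open>\<tau>\<close> deforms 0 into \<open>b\<close>; \<open>\<alpha>\<close>
    is the size of the imaginary shift and is sent to 0 only after the homotopy.\<close>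
  define P where "P \<alpha> \<tau> = sig_poly k (\<chi> i j. mat (\<i> * of_real \<alpha>) $ i $ j + of_real \<tau> * of_real (b $ i $ j)) (complex_matrix a)" for \<alpha> \<tau>
  have ca: "minor_sum k (complex_matrix a) = of_real (minor_sum k a)" by (rule minor_sum_complex_matrix)
  have neg: "Im s < 0" if \<alpha>: "\<alpha> > 0" and s: "poly (P \<alpha> 1) s = 0" for \<alpha> s
  proof -
    have nr: "Im s \<noteq> 0" if "poly (P \<alpha> \<tau>) s = 0" for \<tau> s
    proof
      assume "Im s = 0"
      then obtain x where x: "s = of_real x" by (metis complex_is_Real_iff Reals_cases)
      have "transpose (\<tau> *\<^sub>R b + x *\<^sub>R a) = \<tau> *\<^sub>R b + x *\<^sub>R a"
        using sa b by (simp add: transpose_def vec_eq_iff)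
      from minor_sum_shift_nonzero[OF this k, of "\<i> * of_real \<alpha>"]
      have "minor_sum k (complex_matrix (\<tau> *\<^sub>R b + x *\<^sub>R a) + mat (\<i> * of_real \<alpha>)) \<noteq> 0" using \<alpha> by simp
      also have "complex_matrix (\<tau> *\<^sub>R b + x *\<^sub>R a) + mat (\<i> * of_real \<alpha>) =
        (\<chi> i j. (\<chi> i j. mat (\<i> * of_real \<alpha>) $ i $ j + of_real \<tau> * of_real (b $ i $ j)) $ i $ j + s * complex_matrix a $ i $ j)"
        by (simp add: complex_matrix_def vec_eq_iff x)
      finally show False using that by (simp add: P_def poly_sig_poly)
    qed
    \<comment> \<open>At \<open>\<tau> = 0\<close>, dividing by \<open>s\<close> turns the root into
      a zero of \<sigma>_k(a + r I) with r = \<i> \<alpha> / s. Such an \<open>r\<close> is real,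
      and the definition of the cone makes it negative.\<close>
    have init: "Im s < 0" if "poly (P \<alpha> 0) s = 0" for s
    proof -
      have s0: "s \<noteq> 0" using nr[OF that] by auto
      have "(\<chi> i j. (\<chi> i j. mat (\<i> * of_real \<alpha>) $ i $ j + of_real 0 * of_real (b $ i $ j)) $ i $ j + s * complex_matrix a $ i $ j)
          = (\<chi> i j. s * (complex_matrix a + mat (\<i> * of_real \<alpha> / s)) $ i $ j)"
        using s0 by (simp add: vec_eq_iff mat_def algebra_simps)
      with that s0 have z: "minor_sum k (complex_matrix a + mat (\<i> * of_real \<alpha> / s)) = 0"
        by (simp add: P_def poly_sig_poly minor_sum_scale del: vector_add_component)
      then have "Im (\<i> * of_real \<alpha> / s) = 0" using minor_sum_shift_nonzero[OF sa k] by blast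
      then obtain r where r: "\<i> * of_real \<alpha> / s = of_real r" by (metis complex_is_Real_iff Reals_cases)
      have "of_real (minor_sum k (a + mat r)) = (0::complex)"
        using z unfolding r by (simp flip: minor_sum_complex_matrix add: complex_matrix_simps)
      then have "r < 0" using am[of r] by (cases "r < 0") auto
      moreover have "of_real r * s = \<i> * of_real \<alpha>" using r s0 by (simp add: field_simps)
      then have "r * Im s = \<alpha>" by (simp add: complex_eq_iff)
      ultimately show "Im s < 0" using \<alpha> by (metis mult_neg_pos mult_nonpos_nonneg not_less less_imp_le)
    qed
    have "Im (1 * s) < 0"
    proof (rule roots_stay_in_half_plane[where P="P \<alpha>" and k=k and c="of_real (minor_sum k a)"])
      show "continuous_on {0..1} (\<lambda>\<tau>. coeff (P \<alpha> \<tau>) m)" for m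
        unfolding P_def by (rule continuous_on_coeff_sig_poly) (auto intro!: continuous_intros)
    qed (use nr init s a0 in \<open>auto simp: P_def degree_sig_poly coeff_sig_poly_top ca\<close>)
    then show ?thesis by simp
  qed
  \<comment> \<open>The bound \<open>minor_sum k a * Im s ^ k\<close> is free of
    \<open>\<alpha>\<close>, so it survives the limit and contradicts a root in the upper half
    plane.\<close>
  have upper: "poly (sig_poly k (complex_matrix b) (complex_matrix a)) s \<noteq> 0" if s: "Im s > 0" for s
  proof
    assume s0: "poly (sig_poly k (complex_matrix b) (complex_matrix a)) s = 0"
    let ?f = "\<lambda>\<alpha>. cmod (minor_sum k (\<chi> i j. mat (\<i> * of_real \<alpha>) $ i $ j + of_real (b $ i $ j) + s * of_real (a $ i $ j)))"
    have f: "cmod (poly (P \<alpha> 1) s) = ?f \<alpha>" for \<alpha>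
      by (simp add: P_def poly_sig_poly complex_matrix_def)
    have "continuous_on UNIV (\<lambda>\<alpha>. minor_sum k (\<chi> i j. mat (\<i> * of_real \<alpha>) $ i $ j + of_real (b $ i $ j) + s * of_real (a $ i $ j)))"
    proof (rule continuous_on_minor_sum)
      fix i j :: 'n
      show "continuous_on UNIV (\<lambda>\<alpha>. (\<chi> i j. mat (\<i> * of_real \<alpha>) $ i $ j + of_real (b $ i $ j) + s * of_real (a $ i $ j)) $ i $ j)"
        by (cases "i = j") (auto simp: mat_def intro!: continuous_intros)
    qed
    then have "continuous_on UNIV ?f" by (rule continuous_on_norm)
    then have "(?f \<longlongrightarrow> ?f 0) (at_right 0)"
      by (meson UNIV_I at_le continuous_on_def subset_UNIV tendsto_mono)
    moreover have "\<forall>\<^sub>F \<alpha> in at_right 0. minor_sum k a * Im s ^ k \<le> ?f \<alpha>"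
    proof (rule eventually_at_right_less[THEN eventually_mono])
      fix \<alpha> :: real assume \<alpha>: "\<alpha> > 0"
      have "cmod (lead_coeff (P \<alpha> 1)) * Im (1 * s) ^ k \<le> cmod (poly (P \<alpha> 1) s)"
        by (rule poly_half_plane_lower_bound)
          (use neg[OF \<alpha>] s a0 in \<open>auto simp: P_def degree_sig_poly ca intro: less_imp_le\<close>)
      moreover have "lead_coeff (P \<alpha> 1) = of_real (minor_sum k a)"
        using a0 by (simp add: P_def degree_sig_poly ca coeff_sig_poly_top)
      ultimately show "minor_sum k a * Im s ^ k \<le> ?f \<alpha>" unfolding f using a0 by simp
    qed
    ultimately have "minor_sum k a * Im s ^ k \<le> ?f 0" by (intro tendsto_lowerbound) auto
    also have "?f 0 = 0" using s0 by (simp add: poly_sig_poly complex_matrix_def mat_def)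
    finally show False using mult_pos_pos[OF a0 zero_less_power[OF s, of k]] by simp
  qed
  have "poly (sig_poly k (complex_matrix b) (complex_matrix a)) (cnj z) = cnj (poly (sig_poly k (complex_matrix b) (complex_matrix a)) z)"
    by (simp add: poly_sig_poly complex_matrix_def minor_sum_def)
  with upper[of z] upper[of "cnj z"] z show ?thesis by (cases "Im z" "0::real" rule: linorder_cases) auto
qed

lemma transpose_add_mat: "transpose (N + mat s) = transpose N + mat s"
  by (auto simp: transpose_def vec_eq_iff mat_def)

lemma garding_coneD:
  fixes a :: "real^'n^'n"
  assumes "a \<in> garding_cone k"
  shows "transpose a = a" "minor_sum k a > 0" "\<And>s. s \<ge> 0 \<Longrightarrow> minor_sum k (a + mat s) > 0"
    "\<And>s. s \<ge> 0 \<Longrightarrow> a + mat s \<in> garding_cone k"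
proof -
  have "mat 0 = (0 :: real^'n^'n)" by (simp add: mat_def vec_eq_iff)
  moreover have "transpose (a + mat s) = a + mat s" for s
    using assms by (simp add: garding_cone_def transpose_add_mat)
  ultimately show "transpose a = a" "minor_sum k a > 0" "\<And>s. s \<ge> 0 \<Longrightarrow> minor_sum k (a + mat s) > 0"
    "\<And>s. s \<ge> 0 \<Longrightarrow> a + mat s \<in> garding_cone k"
    using assms by (auto simp: garding_cone_def add.assoc mat_add dest: spec[of _ 0])
qed

lemma minor_sum_scaleR: "minor_sum k (c *\<^sub>R A) = c ^ k * minor_sum k (A :: real^'n^'n)"
  using minor_sum_scale[of k c A] by (simp add: scaleR_vec_def)

lemma mat_scaleR: "c *\<^sub>R mat s = (mat (c * s) :: real^'n^'n)"
  by (simp add: mat_def vec_eq_iff)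

lemma garding_cone_scale:
  assumes "a \<in> garding_cone k" "c > 0"
  shows "c *\<^sub>R a \<in> garding_cone k"
proof -
  have "minor_sum k (c *\<^sub>R a + mat s) > 0" if "s \<ge> 0" for s
  proof -
    have "c *\<^sub>R a + mat s = c *\<^sub>R (a + mat (s / c))"
      using assms(2) by (simp add: scaleR_add_right mat_scaleR)
    then show ?thesis using garding_coneD(3)[OF assms(1), of "s / c"] assms(2) that
      by (simp add: minor_sum_scaleR)
  qed
  moreover have "transpose (c *\<^sub>R a) = c *\<^sub>R a"
    using garding_coneD(1)[OF assms(1)] by (simp add: transpose_def vec_eq_iff)
  ultimately show ?thesis by (auto simp: garding_cone_def)
qed

lemma poly_sig_poly_real: "poly (sig_poly k A B) s = minor_sum k (A + s *\<^sub>R (B :: real^'n^'n))"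
  unfolding poly_sig_poly by (rule arg_cong[where f="minor_sum k"]) (simp add: vec_eq_iff)

lemma poly_sig_poly_complex:
  "poly (sig_poly k (complex_matrix A) (complex_matrix B)) (of_real s) = of_real (minor_sum k (A + s *\<^sub>R B))"
  unfolding poly_sig_poly minor_sum_complex_matrix[symmetric]
  by (rule arg_cong[where f="minor_sum k"]) (simp add: vec_eq_iff complex_matrix_def)

lemma coeff_prod_linear_of_real:
  "coeff (\<Prod>i\<in>S. [:complex_of_real (a i), of_real (b i):]) m = of_real (coeff (\<Prod>i\<in>S. [:a i, b i:]) m)"
  by (induction S arbitrary: m rule: infinite_finite_induct)
    (auto simp: coeff_pCons_linear_mult simp del: mult_pCons_left)

lemma coeff_sig_poly_complex:
  "coeff (sig_poly k (complex_matrix A) (complex_matrix B)) m = of_real (coeff (sig_poly k A B) m)"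
  by (simp add: coeff_sig_poly complex_matrix_def coeff_prod_linear_of_real)

lemma continuous_on_mat_entry:
  "continuous_on T f \<Longrightarrow> continuous_on T (\<lambda>x. (mat (f x) :: real^'n^'n) $ i $ j)"
  by (cases "i = j") (auto simp: mat_def)

lemma minor_sum_mat_1:
  assumes "k \<le> CARD('n)"
  shows "minor_sum k (mat 1 :: real^'n^'n) \<ge> 1"
proof -
  obtain S :: "'n set" where "card S = k" using obtain_subset_with_card_n[OF assms] by auto
  then have "card {S :: 'n set. card S = k} \<noteq> 0" by (auto simp: card_eq_0_iff)
  moreover have "minor_sum k (mat 1 :: real^'n^'n) = card {S :: 'n set. card S = k}"
    using minor_sum_diag[of k "(\<chi> i. 1) :: real^'n"] by (simp add: mat_def cong: if_cong)
  ultimately show ?thesis by linarith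
qed

lemma mat_in_garding_cone:
  assumes "k \<le> CARD('n)" "s > 0"
  shows "(mat s :: real^'n^'n) \<in> garding_cone k"
proof -
  have "minor_sum k (mat c :: real^'n^'n) > 0" if "c > 0" for c
    using minor_sum_mat_1[OF assms(1)] minor_sum_scaleR[of k c "mat 1 :: real^'n^'n"] that
    by (simp add: mat_scaleR)
  then show ?thesis using assms(2) by (auto simp: garding_cone_def mat_add transpose_mat)
qed

text \<open>Deform \<open>b\<close> to the identity inside the cone. Zero is never a root on the way
  because \<sigma>_k is positive on the cone, so the real roots keep their sign, and at the identity
  they are negative by the definition of the cone. The half-plane lemma is used with
  \<open>w\<close> the imaginary unit, which turns it to the left half plane.\<close>

lemma garding_cone_roots:
  fixes a b :: "real^'n^'n"
  assumes k: "k \<le> CARD('n)" and a: "a \<in> garding_cone k" and b: "b \<in> garding_cone k"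
    and s: "poly (sig_poly k (complex_matrix b) (complex_matrix a)) s = 0"
  shows "Im s = 0" "Re s < 0"
proof -
  show "Im s = 0" using garding_cone_hyperbolic[OF k a garding_coneD(1)[OF b] s] .
  define x where "x \<tau> = \<tau> *\<^sub>R b + mat (1 - \<tau>)" for \<tau> :: real
  \<comment> \<open>Positive scaling and shifts by the identity suffice here; convexity of the cone
    is itself deduced from this lemma later.\<close>
  have x: "x \<tau> \<in> garding_cone k" if "\<tau> \<in> {0..1}" for \<tau>
  proof (cases "\<tau> = 0")
    case True then show ?thesis using mat_in_garding_cone[OF k, of 1] by (simp add: x_def)
  next
    case False
    then show ?thesis unfolding x_def
      using garding_coneD(4)[OF garding_cone_scale[OF b, of \<tau>]] that by auto
  qed
  define P where "P \<tau> = sig_poly k (complex_matrix (x \<tau>)) (complex_matrix a)" for \<tau>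
  have ca: "minor_sum k (complex_matrix a) = of_real (minor_sum k a)" by (rule minor_sum_complex_matrix)
  have a0: "minor_sum k a > 0" using garding_coneD(2)[OF a] .
  have root: "\<exists>r. r \<noteq> 0 \<and> s = of_real r" if "\<tau> \<in> {0..1}" "poly (P \<tau>) s = 0" for \<tau> s
  proof -
    have "Im s = 0" using garding_cone_hyperbolic[OF k a garding_coneD(1)[OF x[OF that(1)]]] that(2) by (simp add: P_def)
    then obtain r where r: "s = of_real r" by (metis complex_is_Real_iff Reals_cases)
    moreover have "r \<noteq> 0"
      using that(2) garding_coneD(2)[OF x[OF that(1)]] unfolding P_def r poly_sig_poly_complex by auto
    ultimately show ?thesis by blast
  qed
  have "Im (\<i> * s) < 0"
  proof (rule roots_stay_in_half_plane[where P=P and k=k and c="of_real (minor_sum k a)"])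
    show "continuous_on {0..1} (\<lambda>\<tau>. coeff (P \<tau>) m)" for m
      unfolding P_def coeff_sig_poly_complex
      by (intro continuous_on_of_real continuous_on_coeff_sig_poly) (auto simp: x_def intro!: continuous_intros continuous_on_mat_entry)
    fix s assume s: "poly (P 0) s = 0"
    obtain r where r: "r \<noteq> 0" "s = of_real r" using root[OF _ s] by auto
    have "minor_sum k (mat 1 + r *\<^sub>R a) = 0"
      using s unfolding P_def r poly_sig_poly_complex by (simp add: x_def)
    also have "mat 1 + r *\<^sub>R a = r *\<^sub>R (a + mat (1 / r))"
      using r(1) by (simp add: scaleR_add_right mat_scaleR)
    finally have "minor_sum k (a + mat (1 / r)) = 0" using r(1) by (simp add: minor_sum_scaleR del: scaleR_add_right)
    then have "1 / r < 0" using garding_coneD(3)[OF a, of "1 / r"] by (cases "1 / r < 0") auto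
    then show "Im (\<i> * s) < 0" by (simp add: r)
  next
    show "Im (\<i> * s) \<noteq> 0" if "\<tau> \<in> {0..1}" "poly (P \<tau>) s = 0" for \<tau> s
      using root[OF that] by auto
  qed (use s a0 in \<open>auto simp: P_def degree_sig_poly coeff_sig_poly_top ca x_def mat_def[of 0] zero_vec_def[symmetric]\<close>)
  then show "Re s < 0" by simp
qed

lemma coeff_prod_nonneg:
  fixes t :: "'i \<Rightarrow> real"
  assumes "finite S" "\<And>i. i \<in> S \<Longrightarrow> t i \<ge> 0"
  shows "\<exists>y\<ge>0. coeff (\<Prod>i\<in>S. [:complex_of_real (t i), 1:]) m = of_real y"
  using assms
proof (induction S arbitrary: m rule: finite_induct)
  case empty
  then show ?case by (cases "m = 0") (auto intro: exI[of _ 1] exI[of _ 0])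
next
  case (insert x S)
  obtain y where y: "y \<ge> 0" "coeff (\<Prod>i\<in>S. [:complex_of_real (t i), 1:]) m = of_real y" using insert by auto
  obtain z where z: "z \<ge> 0" "coeff (\<Prod>i\<in>S. [:complex_of_real (t i), 1:]) (m - 1) = of_real z" using insert by auto
  show ?case
    using insert y z
    by (intro exI[of _ "t x * y + (if m = 0 then 0 else z)"])
      (auto simp: coeff_pCons_linear_mult simp del: mult_pCons_left)
qed

text \<open>A polynomial with positive leading coefficient and negative real roots is a product of
  factors s + t with t positive. Nonnegativity of all coefficients contains ellipticity (the linear
  one), monotonicity (their sum) and convexity of the cone (the value at a positive
  argument).\<close>

lemma coeff_sig_poly_nonneg:
  fixes a b :: "real^'n^'n"
  assumes k: "k \<le> CARD('n)" and a: "a \<in> garding_cone k" and b: "b \<in> garding_cone k"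
  shows "coeff (sig_poly k b a) m \<ge> 0"
proof -
  let ?p = "sig_poly k (complex_matrix b) (complex_matrix a)"
  have a0: "minor_sum k a > 0" using garding_coneD(2)[OF a] .
  have lead: "lead_coeff ?p = of_real (minor_sum k a)"
    using a0 by (simp add: degree_sig_poly minor_sum_complex_matrix coeff_sig_poly_top)
  obtain r where r: "smult (lead_coeff ?p) (\<Prod>i<degree ?p. [:- r i, 1:]) = ?p"
    using complex_poly_decompose' by blast
  have rr: "r i = - of_real (- Re (r i)) \<and> - Re (r i) \<ge> 0" if "i < degree ?p" for i
  proof -
    have "(\<Prod>j<degree ?p. r i - r j) = 0" by (rule prod_zero) (use that in auto)
    then have "poly ?p (r i) = 0" by (subst r[symmetric]) (simp add: poly_prod)
    from garding_cone_roots[OF k a b this] show ?thesis by (simp add: complex_eq_iff)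
  qed
  have "(\<Prod>i<degree ?p. [:- r i, 1:]) = (\<Prod>i<degree ?p. [:of_real (- Re (r i)), 1:])"
    by (intro prod.cong refl) (use rr in \<open>simp add: complex_eq_iff\<close>)
  moreover obtain y where "y \<ge> 0" "coeff (\<Prod>i<degree ?p. [:complex_of_real (- Re (r i)), 1:]) m = of_real y"
    using coeff_prod_nonneg[of "{..<degree ?p}" "\<lambda>i. - Re (r i)" m] rr by auto
  ultimately have "coeff ?p m = of_real (minor_sum k a * y)" "y \<ge> 0"
    using r lead by (metis coeff_smult of_real_mult)+
  then show ?thesis using a0 unfolding coeff_sig_poly_complex of_real_eq_iff by simp
qed

text \<open>The minor sums are coefficients of det(A + x), so \<open>A\<close> may be replaced by
  the diagonal matrix with the same determinant polynomial.\<close>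

lemma minor_sum_spectrum:
  fixes A :: "'a::field_char_0^'n^'n" and l :: "'n \<Rightarrow> 'a"
  assumes k: "k \<le> CARD('n)"
    and det: "\<And>x. det (A + mat x) = (\<Prod>i\<in>UNIV. x + l i)"
  shows "minor_sum k A = (\<Sum>S | card S = k. \<Prod>i\<in>S. l i)"
proof -
  let ?D = "(\<chi> i j. if i = j then (\<chi> i. l i) $ i else 0) :: 'a^'n^'n"
  have "poly (charpoly_neg A) x = poly (charpoly_neg ?D) x" for x
  proof -
    have "det (?D + mat x) = (\<Prod>i\<in>UNIV. (?D + mat x) $ i $ i)" by (rule det_diagonal) (simp add: mat_def)
    also have "\<dots> = (\<Prod>i\<in>UNIV. x + l i)" by (simp add: mat_def add.commute)
    finally show ?thesis by (simp only: poly_charpoly_neg det)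
  qed
  then have "charpoly_neg A = charpoly_neg ?D" by (intro poly_ext)
  then have "coeff (charpoly_neg A) (CARD('n) - k) = coeff (charpoly_neg ?D) (CARD('n) - k)"
    by (rule arg_cong)
  then have "minor_sum k A = minor_sum k ?D" by (simp only: coeff_charpoly_neg[OF k])
  then show ?thesis using minor_sum_diag[of k "\<chi> i. l i"] by (simp cong: if_cong)
qed

lemma minor_sum_real_spectrum:
  fixes A :: "real^'n^'n" and l :: "real^'n"
  assumes k: "k \<le> CARD('n)"
    and det: "\<And>x. det (complex_matrix A + mat x) = (\<Prod>i\<in>UNIV. x + complex_of_real (l $ i))"
  shows "minor_sum k A = (\<Sum>S | card S = k. \<Prod>i\<in>S. l $ i)"
proof -
  have "complex_of_real (minor_sum k A) = of_real (\<Sum>S | card S = k. \<Prod>i\<in>S. l $ i)"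
    unfolding minor_sum_complex_matrix[symmetric] minor_sum_spectrum[OF k det] by simp
  then show ?thesis by (simp only: of_real_eq_iff)
qed

section \<open>Monotonicity in the positive semidefinite order\<close>

definition psd_matrix :: "real^'n^'n \<Rightarrow> bool" where
  "psd_matrix N \<longleftrightarrow> transpose N = N \<and> (\<forall>x. 0 \<le> x \<bullet> (N *v x))"

lemma psd_shift_in_garding_cone:
  fixes N :: "real^'n^'n"
  assumes k: "k \<le> CARD('n)" and N: "psd_matrix N" and e: "e > 0"
  shows "N + mat e \<in> garding_cone k"
proof -
  have "minor_sum k (N + mat s) > 0" if s: "s > 0" for s
  proof -
    have sym: "transpose (N + mat s) = N + mat s"
      using N by (simp add: psd_matrix_def transpose_add_mat)
    obtain l :: "real^'n" where ev: "\<And>i. \<exists>v. v \<noteq> 0 \<and> (N + mat s) *v v = l $ i *\<^sub>R v"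
      and det: "\<And>x. det (complex_matrix (N + mat s) + mat x) = (\<Prod>i\<in>UNIV. x + complex_of_real (l $ i))"
      by (rule symmetric_spectrum[OF sym]) (rule that)
    have pos: "l $ i > 0" for i
    proof -
      obtain v where v: "v \<noteq> 0" "(N + mat s) *v v = l $ i *\<^sub>R v" using ev[of i] by auto
      have "(N + mat s) *v v = N *v v + s *\<^sub>R v"
        by (simp add: matrix_vector_mult_add_rdistrib mat_vector_mult vec_eq_iff)
      then have "l $ i * (v \<bullet> v) = v \<bullet> (N *v v) + s * (v \<bullet> v)"
        using v(2) by (metis inner_add_right inner_scaleR_right)
      moreover have "v \<bullet> (N *v v) \<ge> 0" using N by (simp add: psd_matrix_def)
      moreover have "v \<bullet> v > 0" using v(1) by simp
      ultimately have "(l $ i - s) * (v \<bullet> v) \<ge> 0" by (simp add: algebra_simps)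
      then have "l $ i \<ge> s" using \<open>v \<bullet> v > 0\<close> by (simp add: zero_le_mult_iff)
      with s show ?thesis by simp
    qed
    obtain S :: "'n set" where "card S = k" using obtain_subset_with_card_n[OF k] by auto
    then have "{S :: 'n set. card S = k} \<noteq> {}" by auto
    then show ?thesis unfolding minor_sum_real_spectrum[OF k det]
      by (intro sum_pos prod_pos) (auto simp: pos)
  qed
  moreover have "transpose (N + mat e) = N + mat e"
    using N by (simp add: psd_matrix_def transpose_add_mat)
  ultimately show ?thesis using e by (auto simp: garding_cone_def add.assoc mat_add)
qed

text \<open>A semidefinite matrix may lie on the boundary of the cone. Adding a small multiple of
  the identity moves it inside, and the coefficients are continuous.\<close>

lemma coeff_sig_poly_psd_nonneg:
  fixes M N :: "real^'n^'n"
  assumes k: "k \<le> CARD('n)" and M: "M \<in> garding_cone k" and N: "psd_matrix N"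
  shows "coeff (sig_poly k M N) m \<ge> 0"
proof -
  let ?f = "\<lambda>e. coeff (sig_poly k M (N + mat e)) m"
  have "continuous_on UNIV ?f"
    by (rule continuous_on_coeff_sig_poly) (auto intro!: continuous_intros continuous_on_mat_entry)
  then have "(?f \<longlongrightarrow> ?f 0) (at_right 0)"
    by (meson UNIV_I at_le continuous_on_def subset_UNIV tendsto_mono)
  moreover have "\<forall>\<^sub>F e in at_right 0. 0 \<le> ?f e"
    by (rule eventually_at_right_less[THEN eventually_mono])
      (intro coeff_sig_poly_nonneg k M psd_shift_in_garding_cone N)
  ultimately have "0 \<le> ?f 0" by (intro tendsto_lowerbound) auto
  then show ?thesis by (simp add: mat_def zero_vec_def[symmetric])
qed

text \<open>Evaluate the polynomial at 1 and keep only its constant coefficient. Both comparison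
  arguments rest on this inequality.\<close>

lemma minor_sum_mono:
  fixes M N :: "real^'n^'n"
  assumes k: "k \<le> CARD('n)" and M: "M \<in> garding_cone k" and N: "psd_matrix N"
  shows "minor_sum k M \<le> minor_sum k (M + N)"
proof -
  have "minor_sum k (M + N) = poly (sig_poly k M N) 1" by (simp add: poly_sig_poly_real)
  also have "\<dots> = (\<Sum>m\<le>degree (sig_poly k M N). coeff (sig_poly k M N) m)" by (simp add: poly_altdef)
  also have "\<dots> \<ge> (\<Sum>m\<in>{0}. coeff (sig_poly k M N) m)"
    by (rule sum_mono2) (auto intro: coeff_sig_poly_psd_nonneg assms)
  finally show ?thesis by (simp add: coeff_sig_poly_0)
qed

lemma minor_sum_lin_nonneg:
  fixes M N :: "real^'n^'n"
  assumes "k \<le> CARD('n)" "M \<in> garding_cone k" "psd_matrix N"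
  shows "0 \<le> minor_sum_lin k M N"
  using coeff_sig_poly_psd_nonneg[OF assms, of 1] by (simp only: coeff_sig_poly_1)

lemma garding_cone_convex:
  fixes a b :: "real^'n^'n"
  assumes k: "k \<le> CARD('n)" and a: "a \<in> garding_cone k" and b: "b \<in> garding_cone k" and s: "0 \<le> s" "s \<le> 1"
  shows "(1 - s) *\<^sub>R a + s *\<^sub>R b \<in> garding_cone k"
proof (cases "s = 1")
  case True then show ?thesis using b by simp
next
  case False
  have "minor_sum k ((1 - s) *\<^sub>R a + s *\<^sub>R b + mat c) > 0" if c: "c \<ge> 0" for c
  proof -
    \<comment> \<open>For \<open>s < 1\<close> this base point lies in the cone, and adding
      \<open>s *\<^sub>R b\<close> only adds nonnegative Taylor terms. At \<open>s = 1\<close> and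
      \<open>c = 0\<close> it would be the zero matrix, hence the case distinction.\<close>
    let ?M = "(1 - s) *\<^sub>R a + mat c"
    have M: "?M \<in> garding_cone k"
      using garding_coneD(4)[OF garding_cone_scale[OF a]] False s c by auto
    have "minor_sum k (?M + s *\<^sub>R b) = poly (sig_poly k ?M b) s" by (simp add: poly_sig_poly_real)
    also have "\<dots> = (\<Sum>m\<le>degree (sig_poly k ?M b). coeff (sig_poly k ?M b) m * s ^ m)" by (simp add: poly_altdef)
    also have "\<dots> \<ge> (\<Sum>m\<in>{0}. coeff (sig_poly k ?M b) m * s ^ m)"
      by (rule sum_mono2) (auto intro!: mult_nonneg_nonneg zero_le_power coeff_sig_poly_nonneg k M b s)
    finally have "minor_sum k ?M \<le> minor_sum k (?M + s *\<^sub>R b)" by (simp add: coeff_sig_poly_0)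
    with garding_coneD(2)[OF M] show ?thesis by (simp add: add_ac)
  qed
  moreover have "transpose ((1 - s) *\<^sub>R a + s *\<^sub>R b) = (1 - s) *\<^sub>R a + s *\<^sub>R b"
    using garding_coneD(1)[OF a] garding_coneD(1)[OF b] by (simp add: transpose_def vec_eq_iff)
  ultimately show ?thesis by (auto simp: garding_cone_def)
qed

section \<open>The eigenvalue definition and the divergence-free linearisation\<close>

lemma det_complex_matrix: "det (complex_matrix A) = of_real (det A)"
  by (simp add: det_def complex_matrix_def)

lemma poly_char_polynomial: "poly (char_polynomial M) x = det (mat x - M)"
  by (auto simp: char_polynomial_def det_def poly_sum poly_prod mat_def intro!: sum.cong prod.cong)

text \<open>Gives the choice in \<open>eigenvalues\<close> a witness. Since
  \<open>char_polynomial\<close> uses x - M, the rows are negated to reach the form M + x.\<close>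

lemma char_polynomial_splits:
  fixes M :: "real^'n^'n"
  assumes sym: "transpose M = M"
  shows "\<exists>\<mu>::real^'n. char_polynomial M = (\<Prod>i\<in>UNIV. [:- (\<mu> $ i), 1:])"
proof -
  obtain l :: "real^'n" where ev: "\<And>i. \<exists>v. v \<noteq> 0 \<and> M *v v = l $ i *\<^sub>R v"
      and det: "\<And>x. det (complex_matrix M + mat x) = (\<Prod>i\<in>UNIV. x + complex_of_real (l $ i))"
    by (rule symmetric_spectrum[OF sym]) (rule that)
  have "poly (char_polynomial M) x = poly (\<Prod>i\<in>UNIV. [:- (l $ i), 1:]) x" for x
  proof -
    have "complex_of_real (det (M + mat (- x))) = of_real (\<Prod>i\<in>UNIV. - x + l $ i)"
      unfolding det_complex_matrix[symmetric] complex_matrix_simps det by simp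
    then have "det (M + mat (- x)) = (\<Prod>i\<in>UNIV. - x + l $ i)" by (simp only: of_real_eq_iff)
    moreover have "mat x - M = (\<chi> i. - 1 *s (M + mat (- x)) $ i)"
      by (simp add: vec_eq_iff mat_def)
    ultimately have "det (mat x - M) = (\<Prod>i\<in>(UNIV::'n set). - 1) * (\<Prod>i\<in>UNIV. - x + l $ i)"
      by (simp only: det_rows_mul vec_lambda_eta)
    also have "\<dots> = (\<Prod>i\<in>UNIV. x - l $ i)" by (simp add: prod.distrib[symmetric] del: prod_constant)
    finally show ?thesis by (simp add: poly_char_polynomial poly_prod)
  qed
  then show ?thesis by (intro exI[of _ l] poly_ext)
qed

text \<open>The passage from chosen eigenvalues to a polynomial in the entries. Whatever vector is
  chosen, it factors the same determinant.\<close>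

lemma sigma_mat_eq_minor_sum:
  fixes M :: "real^'n^'n"
  assumes sym: "transpose M = M" and k: "k \<le> CARD('n)"
  shows "sigma_mat k M = minor_sum k M"
proof -
  let ?\<mu> = "eigenvalues M"
  have c: "char_polynomial M = (\<Prod>i\<in>UNIV. [:- (?\<mu> $ i), 1:])"
    unfolding eigenvalues_def by (rule someI_ex) (rule char_polynomial_splits[OF sym])
  have "det (M + mat x) = (\<Prod>i\<in>UNIV. x + ?\<mu> $ i)" for x
  proof -
    have "M + mat x = (\<chi> i. - 1 *s (mat (- x) - M) $ i)" by (simp add: vec_eq_iff mat_def)
    then have "det (M + mat x) = (\<Prod>i\<in>(UNIV::'n set). - 1) * det (mat (- x) - M)" by (simp only: det_rows_mul vec_lambda_eta)
    also have "det (mat (- x) - M) = (\<Prod>i\<in>UNIV. - x - ?\<mu> $ i)"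
      by (simp add: poly_char_polynomial[symmetric] c poly_prod) (intro prod.cong refl, simp)
    finally show ?thesis by (simp add: prod.distrib[symmetric] add.commute del: prod_constant)
  qed
  from minor_sum_spectrum[OF k this] show ?thesis
    by (simp add: sigma_mat_def elem_sym_def)
qed

text \<open>Expanding det(M + s + x) in powers of s + x shows that \<sigma>_k(M + s I) is a
  combination of the \<sigma>_j(M) with j \<le> k, with nonnegative coefficients when s \<ge> 0 and
  coefficient 1 at j = k.\<close>

lemma Gamma_cone_subset_garding_cone:
  fixes M :: "real^'n^'n"
  assumes sym: "transpose M = M" and k: "1 \<le> k" "k \<le> CARD('n)" and M: "eigenvalues M \<in> Gamma_cone k"
  shows "M \<in> garding_cone k"
proof -
  let ?n = "CARD('n)"
  have pos: "minor_sum j M > 0" if "j \<le> k" for j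
  proof (cases "j = 0")
    case False
    then have "elem_sym j (eigenvalues M) > 0" using M that by (auto simp: Gamma_cone_def)
    then show ?thesis using that k sigma_mat_eq_minor_sum[OF sym, of j] by (simp add: sigma_mat_def)
  qed simp
  have "minor_sum k (M + mat s) > 0" if s: "s \<ge> 0" for s
  proof -
    have "charpoly_neg (M + mat s) = (\<Sum>j\<le>?n. smult (minor_sum j M) ([:s, 1:] ^ (?n - j)))"
    proof (rule poly_ext)
      fix x
      have "poly (charpoly_neg (M + mat s)) x = det (M + mat (s + x))"
        by (simp add: poly_charpoly_neg add.assoc mat_add)
      then show "poly (charpoly_neg (M + mat s)) x = poly (\<Sum>j\<le>?n. smult (minor_sum j M) ([:s, 1:] ^ (?n - j))) x"
        by (simp add: det_add_scalar poly_sum)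
    qed
    then have "minor_sum k (M + mat s) = (\<Sum>j\<le>?n. minor_sum j M * coeff ([:s, 1:] ^ (?n - j)) (?n - k))"
      using coeff_charpoly_neg[OF k(2), of "M + mat s"] by (simp add: coeff_sum)
    moreover have "(\<Sum>j\<le>?n. minor_sum j M * coeff ([:s, 1:] ^ (?n - j)) (?n - k)) \<ge>
       (\<Sum>j\<in>{k}. minor_sum j M * coeff ([:s, 1:] ^ (?n - j)) (?n - k))"
    proof (rule sum_mono2)
      fix j assume j: "j \<in> {..?n} - {k}"
      show "0 \<le> minor_sum j M * coeff ([:s, 1:] ^ (?n - j)) (?n - k)"
      proof (cases "j \<le> k")
        case True
        then show ?thesis using pos[OF True] s by (subst coeff_linear_poly_power) auto
      next
        case False
        then have "degree ([:s, 1:] ^ (?n - j)) < ?n - k"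
          using j k by (simp add: degree_power_eq)
        then show ?thesis by (simp add: coeff_eq_0)
      qed
    qed (use k in auto)
    ultimately show ?thesis using pos[of k] by (simp add: coeff_linear_power)
  qed
  then show ?thesis using sym by (auto simp: garding_cone_def)
qed

text \<open>Euler's identity: restoring the struck factor gives the monomial back, once for each of
  its \<open>k\<close> rows.\<close>

lemma minor_sum_lin_self: "minor_sum_lin k M M = of_nat k * minor_sum k M"
proof -
  have "minor_sum_lin k M M = (\<Sum>S | card S = k. \<Sum>\<pi> | \<pi> permutes S. \<Sum>i\<in>S. of_int (sign \<pi>) * (\<Prod>l\<in>S. M $ l $ \<pi> l))"
    unfolding minor_sum_lin_expand
  proof (intro sum.cong refl)
    fix S :: "'b set" and \<pi> i assume "i \<in> S"
    then show "of_int (sign \<pi>) * (M $ i $ \<pi> i * (\<Prod>l\<in>S - {i}. M $ l $ \<pi> l)) = of_int (sign \<pi>) * (\<Prod>l\<in>S. M $ l $ \<pi> l)"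
      using prod.remove[of S i "\<lambda>l. M $ l $ \<pi> l"] by simp
  qed
  also have "\<dots> = of_nat k * minor_sum k M"
    unfolding minor_sum_def sum_distrib_left by (intro sum.cong refl) auto
  finally show ?thesis .
qed

lemma minor_sum_lin_add: "minor_sum_lin k M (A + B) = minor_sum_lin k M A + minor_sum_lin k M B"
  by (simp add: minor_sum_lin_def algebra_simps sum.distrib)

lemma minor_sum_lin_scaleR: "minor_sum_lin k M (c *\<^sub>R A) = c * minor_sum_lin k M (A :: real^'n^'n)"
  by (simp add: minor_sum_lin_def sum_distrib_left mult_ac)

text \<open>Inverting the permutations exchanges the roles of row and column, and sign is
  preserved.\<close>

lemma minor_sum_deriv_sym:
  assumes sym: "transpose M = M"
  shows "minor_sum_deriv k M i j = minor_sum_deriv k M j i"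
proof -
  have Ms: "M $ a $ b = M $ b $ a" for a b
    using arg_cong[OF sym, of "\<lambda>B. B $ b $ a"] by (simp add: transpose_def)
  have "(\<Sum>\<pi> | \<pi> permutes S. if i \<in> S \<and> \<pi> i = j then of_int (sign \<pi>) * (\<Prod>l\<in>S - {i}. M $ l $ \<pi> l) else 0) =
        (\<Sum>\<pi> | \<pi> permutes S. if j \<in> S \<and> \<pi> j = i then of_int (sign \<pi>) * (\<Prod>l\<in>S - {j}. M $ l $ \<pi> l) else 0)"
    (is "sum ?f _ = sum ?g _") for S
  proof -
    have "sum ?f {\<pi>. \<pi> permutes S} = (\<Sum>\<pi> | \<pi> permutes S. ?f (inv \<pi>))"
      by (rule sum_permutations_inverse)
    also have "\<dots> = sum ?g {\<pi>. \<pi> permutes S}"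
    proof (intro sum.cong refl)
      fix \<pi> assume "\<pi> \<in> {\<pi>. \<pi> permutes S}"
      then have p: "\<pi> permutes S" by simp
      have iff: "i \<in> S \<and> inv \<pi> i = j \<longleftrightarrow> j \<in> S \<and> \<pi> j = i"
        using p permutes_inverses[OF p] permutes_in_image[OF p] by metis
      have "(\<Prod>l\<in>S - {i}. M $ l $ inv \<pi> l) = (\<Prod>l\<in>S - {j}. M $ l $ \<pi> l)" if "j \<in> S" "\<pi> j = i"
      proof (rule prod.reindex_bij_witness[where i="\<pi>" and j="inv \<pi>"])
        fix a assume a: "a \<in> S - {i}"
        show "inv \<pi> a \<in> S - {j}" using a that p permutes_inverses[OF p] permutes_in_image[OF permutes_inv[OF p]] by auto
      next
        fix a assume a: "a \<in> S - {j}"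
        show "\<pi> a \<in> S - {i}" using a that p permutes_inj[OF p] permutes_in_image[OF p] by (auto dest: injD)
      qed (use permutes_inverses[OF p] in \<open>auto simp: Ms\<close>)
      moreover have "sign (inv \<pi>) = sign \<pi>"
        by (rule sign_inverse) (use p permutes_imp_permutation[of S] in simp)
      ultimately show "?f (inv \<pi>) = ?g \<pi>" unfolding iff by auto
    qed
    finally show ?thesis .
  qed
  then show ?thesis by (simp add: minor_sum_deriv_def)
qed

lemma minor_sum_1: "minor_sum 1 (A :: 'a::comm_ring_1^'n^'n) = (\<Sum>i\<in>UNIV. A $ i $ i)"
proof -
  have "{S :: 'n set. card S = 1} = (\<lambda>i. {i}) ` UNIV" by (auto simp: card_1_singleton_iff)
  then show ?thesis unfolding minor_sum_def
    by (simp add: sum.reindex permutes_sing)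
qed

text \<open>The eigenvalues are 0 or 1 and the trace counts the ones. With fewer than
  \<open>k\<close> ones, every product of \<open>k\<close> eigenvalues contains a zero.\<close>

lemma minor_sum_projection:
  fixes P :: "real^'n^'n"
  assumes sym: "transpose P = P" and idem: "P ** P = P" and tr: "(\<Sum>i\<in>UNIV. P $ i $ i) < real k" and k: "k \<le> CARD('n)"
  shows "minor_sum k P = 0"
proof -
  obtain l :: "real^'n" where ev: "\<And>i. \<exists>v. v \<noteq> 0 \<and> P *v v = l $ i *\<^sub>R v"
      and det: "\<And>x. det (complex_matrix P + mat x) = (\<Prod>i\<in>UNIV. x + complex_of_real (l $ i))"
    by (rule symmetric_spectrum[OF sym]) (rule that)
  have l01: "l $ i = 0 \<or> l $ i = 1" for i
  proof -
    obtain v where v: "v \<noteq> 0" "P *v v = l $ i *\<^sub>R v" using ev[of i] by auto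
    have "l $ i *\<^sub>R v = P *v (P *v v)" by (simp only: matrix_vector_mul_assoc idem v(2)[symmetric])
    also have "\<dots> = (l $ i * l $ i) *\<^sub>R v" by (simp add: v(2) matrix_vector_mult_scaleR)
    finally have "(l $ i * l $ i - l $ i) *\<^sub>R v = 0" by (simp add: scaleR_left_diff_distrib)
    then show ?thesis using v(1) by (auto simp: algebra_simps)
  qed
  have n1: "1 \<le> CARD('n)" by (simp add: Suc_leI)
  have "{S :: 'n set. card S = 1} = (\<lambda>i. {i}) ` UNIV" by (auto simp: card_1_singleton_iff)
  then have "(\<Sum>i\<in>UNIV. l $ i) = minor_sum 1 P"
    unfolding minor_sum_real_spectrum[OF n1 det] by (simp add: sum.reindex)
  then have "(\<Sum>i\<in>UNIV. l $ i) < k" using tr by (simp only: minor_sum_1)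
  moreover have "(\<Sum>i\<in>UNIV. l $ i) = (\<Sum>i | l $ i = 1. 1)"
    using l01 by (intro sum.mono_neutral_cong_right) auto
  ultimately have c: "card {i. l $ i = 1} < k" by simp
  have "(\<Prod>i\<in>S. l $ i) = 0" if "card S = k" for S
  proof -
    have "\<not> S \<subseteq> {i. l $ i = 1}" using c that card_mono[of "{i. l $ i = 1}" S] by auto
    then obtain i where "i \<in> S" "l $ i = 0" using l01 by blast
    then show ?thesis by (intro prod_zero) auto
  qed
  then show ?thesis unfolding minor_sum_real_spectrum[OF k det] by (intro sum.neutral) auto
qed

lemma has_field_derivative_minor_sum_deriv:
  fixes A :: "real \<Rightarrow> real^'n^'n"
  assumes "\<And>a b. ((\<lambda>t. A t $ a $ b) has_field_derivative A' a b) (at t)"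
  shows "((\<lambda>t. minor_sum_deriv k (A t) i j) has_field_derivative
     (\<Sum>S | card S = k. \<Sum>\<pi> | \<pi> permutes S. if i \<in> S \<and> \<pi> i = j then
        of_int (sign \<pi>) * (\<Sum>l\<in>S - {i}. A' l (\<pi> l) * (\<Prod>m\<in>S - {i} - {l}. A t $ m $ \<pi> m)) else 0)) (at t)"
  unfolding minor_sum_deriv_def
proof (intro DERIV_sum)
  fix S :: "'n set" and \<pi>
  show "((\<lambda>t. if i \<in> S \<and> \<pi> i = j then of_int (sign \<pi>) * (\<Prod>l\<in>S - {i}. A t $ l $ \<pi> l) else 0) has_field_derivative
    (if i \<in> S \<and> \<pi> i = j then of_int (sign \<pi>) * (\<Sum>l\<in>S - {i}. A' l (\<pi> l) * (\<Prod>m\<in>S - {i} - {l}. A t $ m $ \<pi> m)) else 0)) (at t)"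
  proof (cases "i \<in> S \<and> \<pi> i = j")
    case True
    show ?thesis unfolding if_P[OF True] by (intro DERIV_cmult has_field_derivative_prod assms)
  next
    case False
    show ?thesis unfolding if_not_P[OF False] by (rule DERIV_const)
  qed
qed

text \<open>\<open>B i l m\<close> stands for the derivative in direction \<open>i\<close> of the
  entry (l, m), a third derivative when the matrix is a Hessian. The terms are antisymmetric in
  \<open>i\<close> and \<open>l\<close>: composing the permutation with the transposition of the two
  rows flips the sign and exchanges the first two indices of \<open>B\<close>.\<close>

lemma minor_sum_deriv_divergence_free:
  fixes A :: "real^'n^'n"
  assumes B: "\<And>i l m. B i l m = B l i m"
  shows "(\<Sum>i\<in>UNIV. \<Sum>S | card S = k. \<Sum>\<pi> | \<pi> permutes S. if i \<in> S \<and> \<pi> i = j then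
        of_int (sign \<pi>) * (\<Sum>l\<in>S - {i}. B i l (\<pi> l) * (\<Prod>m\<in>S - {i} - {l}. A $ m $ \<pi> m)) else 0) = (0::real)"
proof -
  have "(\<Sum>i\<in>UNIV. \<Sum>\<pi> | \<pi> permutes S. if i \<in> S \<and> \<pi> i = j then
        of_int (sign \<pi>) * (\<Sum>l\<in>S - {i}. B i l (\<pi> l) * (\<Prod>m\<in>S - {i} - {l}. A $ m $ \<pi> m)) else 0) = 0" for S
  proof -
    define g where "g i l = (\<Sum>\<pi> | \<pi> permutes S. if \<pi> i = j then of_int (sign \<pi>) * (B i l (\<pi> l) * (\<Prod>m\<in>S - {i} - {l}. A $ m $ \<pi> m)) else 0)" for i l
    have "(\<Sum>i\<in>UNIV. \<Sum>\<pi> | \<pi> permutes S. if i \<in> S \<and> \<pi> i = j then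
        of_int (sign \<pi>) * (\<Sum>l\<in>S - {i}. B i l (\<pi> l) * (\<Prod>m\<in>S - {i} - {l}. A $ m $ \<pi> m)) else 0)
      = (\<Sum>i\<in>UNIV. if i \<in> S then (\<Sum>l\<in>S - {i}. g i l) else 0)"
      unfolding g_def
      by (intro sum.cong refl) (subst sum.swap, auto simp: sum_distrib_left intro!: sum.cong)
    also have "\<dots> = (\<Sum>i\<in>S. \<Sum>l\<in>S - {i}. g i l)"
      by (intro sum.mono_neutral_cong_right) auto
    also have "\<dots> = (\<Sum>i\<in>S. \<Sum>l\<in>S. if i \<noteq> l then g i l else 0)"
      by (intro sum.cong refl sum.mono_neutral_cong_left) auto
    finally have T: "(\<Sum>i\<in>UNIV. \<Sum>\<pi> | \<pi> permutes S. if i \<in> S \<and> \<pi> i = j then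
        of_int (sign \<pi>) * (\<Sum>l\<in>S - {i}. B i l (\<pi> l) * (\<Prod>m\<in>S - {i} - {l}. A $ m $ \<pi> m)) else 0)
      = (\<Sum>i\<in>S. \<Sum>l\<in>S. if i \<noteq> l then g i l else 0)" (is "?L = ?T") .
    have anti: "g l i = - g i l" if il: "i \<in> S" "l \<in> S" "i \<noteq> l" for i l
    proof -
      let ?\<tau> = "Transposition.transpose i l"
      let ?h = "\<lambda>\<pi>. if \<pi> l = j then of_int (sign \<pi>) * (B l i (\<pi> i) * (\<Prod>m\<in>S - {l} - {i}. A $ m $ \<pi> m)) else 0"
      have t: "?\<tau> permutes S" using il by (simp add: permutes_swap_id)
      have "g l i = (\<Sum>\<pi> | \<pi> permutes S. ?h (\<pi> \<circ> ?\<tau>))"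
        unfolding g_def by (rule sum_permutations_compose_right[OF t]) 
      also have "\<dots> = (\<Sum>\<pi> | \<pi> permutes S. - (if \<pi> i = j then of_int (sign \<pi>) * (B i l (\<pi> l) * (\<Prod>m\<in>S - {i} - {l}. A $ m $ \<pi> m)) else 0))"
      proof (intro sum.cong refl)
        fix \<pi> assume "\<pi> \<in> {\<pi>. \<pi> permutes S}"
        then have p: "permutation \<pi>" using permutes_imp_permutation[of S] by simp
        have "sign (\<pi> \<circ> ?\<tau>) = - sign \<pi>"
          using sign_compose[OF p permutation_swap_id, of i l] il by (simp add: sign_swap_id)
        moreover have "(\<Prod>m\<in>S - {l} - {i}. A $ m $ (\<pi> \<circ> ?\<tau>) m) = (\<Prod>m\<in>S - {i} - {l}. A $ m $ \<pi> m)"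
          by (rule prod.cong) auto
        ultimately show "?h (\<pi> \<circ> ?\<tau>) = - (if \<pi> i = j then of_int (sign \<pi>) * (B i l (\<pi> l) * (\<Prod>m\<in>S - {i} - {l}. A $ m $ \<pi> m)) else 0)"
          by (simp add: B[of l i])
      qed
      finally show ?thesis unfolding g_def by (simp add: sum_negf)
    qed
    have "?T = (\<Sum>i\<in>S. \<Sum>l\<in>S. if l \<noteq> i then g l i else 0)" by (rule sum.swap)
    also have "\<dots> = (\<Sum>i\<in>S. \<Sum>l\<in>S. - (if i \<noteq> l then g i l else 0))"
    proof (intro sum.cong refl)
      fix i l assume "i \<in> S" "l \<in> S"
      then show "(if l \<noteq> i then g l i else 0) = - (if i \<noteq> l then g i l else 0)"
        using anti[of i l] by (cases "i = l") simp_all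
    qed
    also have "\<dots> = - ?T" by (simp add: sum_negf)
    finally show ?thesis unfolding T by simp
  qed
  then show ?thesis by (subst sum.swap) simp
qed

section \<open>Jets of functions smooth up to the boundary\<close>

text \<open>The derivatives are carried as functions on the closure, since
  \<open>partial_deriv\<close> speaks of full neighbourhoods and gives nothing usable on the
  frontier, where the Cauchy data live.\<close>

definition jet2 :: "(real^'n) set \<Rightarrow> (real^'n \<Rightarrow> real) \<Rightarrow> ('n \<Rightarrow> real^'n \<Rightarrow> real) \<Rightarrow> ('n \<Rightarrow> 'n \<Rightarrow> real^'n \<Rightarrow> real) \<Rightarrow> bool" where
  "jet2 \<Omega> f f1 f2 \<longleftrightarrow>
     continuous_on (closure \<Omega>) f \<and> (\<forall>i. continuous_on (closure \<Omega>) (f1 i)) \<and> (\<forall>i j. continuous_on (closure \<Omega>) (f2 i j)) \<and>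
     (\<forall>x\<in>\<Omega>. (f has_derivative (\<lambda>h. \<Sum>i\<in>UNIV. f1 i x * h $ i)) (at x)) \<and>
     (\<forall>i. \<forall>x\<in>\<Omega>. (f1 i has_derivative (\<lambda>h. \<Sum>j\<in>UNIV. f2 i j x * h $ j)) (at x)) \<and>
     (\<forall>i j. \<forall>x\<in>\<Omega>. f2 i j x = f2 j i x)"

definition jet3 :: "(real^'n) set \<Rightarrow> (real^'n \<Rightarrow> real) \<Rightarrow> ('n \<Rightarrow> real^'n \<Rightarrow> real) \<Rightarrow> ('n \<Rightarrow> 'n \<Rightarrow> real^'n \<Rightarrow> real) \<Rightarrow>
    ('n \<Rightarrow> 'n \<Rightarrow> 'n \<Rightarrow> real^'n \<Rightarrow> real) \<Rightarrow> bool" where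
  "jet3 \<Omega> f f1 f2 f3 \<longleftrightarrow> jet2 \<Omega> f f1 f2 \<and> (\<forall>i. jet2 \<Omega> (f1 i) (f2 i) (f3 i))"

lemma jet2D:
  assumes "jet2 \<Omega> f f1 f2"
  shows "continuous_on (closure \<Omega>) f" "continuous_on (closure \<Omega>) (f1 i)" "continuous_on (closure \<Omega>) (f2 i j)"
    "x \<in> \<Omega> \<Longrightarrow> (f has_derivative (\<lambda>h. \<Sum>i\<in>UNIV. f1 i x * h $ i)) (at x)"
    "x \<in> \<Omega> \<Longrightarrow> (f1 i has_derivative (\<lambda>h. \<Sum>j\<in>UNIV. f2 i j x * h $ j)) (at x)"
    "x \<in> \<Omega> \<Longrightarrow> f2 i j x = f2 j i x"
  using assms unfolding jet2_def by blast+

lemma line_derivative: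
  fixes f :: "real^'n \<Rightarrow> real"
  assumes "(f has_derivative (\<lambda>h. \<Sum>i\<in>UNIV. g i * h $ i)) (at (x + t *\<^sub>R v))"
  shows "((\<lambda>t. f (x + t *\<^sub>R v)) has_real_derivative (\<Sum>i\<in>UNIV. g i * v $ i)) (at t)"
proof -
  have "((\<lambda>t. x + t *\<^sub>R v) has_derivative (\<lambda>h. h *\<^sub>R v)) (at t)"
    by (auto intro!: derivative_eq_intros)
  from has_derivative_compose[OF this assms]
  have "((\<lambda>t. f (x + t *\<^sub>R v)) has_derivative (\<lambda>h. \<Sum>i\<in>UNIV. g i * (h *\<^sub>R v) $ i)) (at t)" .
  moreover have "(\<lambda>h. \<Sum>i\<in>UNIV. g i * (h *\<^sub>R v) $ i) = (*) (\<Sum>i\<in>UNIV. g i * v $ i)"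
    by (rule ext) (simp add: sum_distrib_left mult_ac)
  ultimately show ?thesis by (simp only: has_field_derivative_def)
qed

lemma line_derivative_axis:
  fixes f :: "real^'n \<Rightarrow> real"
  assumes "(f has_derivative (\<lambda>h. \<Sum>i\<in>UNIV. g i * h $ i)) (at (x + t *\<^sub>R axis j 1))"
  shows "((\<lambda>t. f (x + t *\<^sub>R axis j 1)) has_real_derivative g j) (at t)"
  using line_derivative[OF assms] by (simp add: axis_def if_distrib cong: if_cong)

text \<open>The second difference quotient is symmetric in the two directions, and two applications
  of the mean value theorem identify it with either mixed derivative at a nearby point.\<close>

lemma mixed_partials_eq:
  fixes f :: "real^'n \<Rightarrow> real"
  assumes "open \<Omega>" and x: "x \<in> \<Omega>"
    and f1: "\<And>x. x \<in> \<Omega> \<Longrightarrow> (f has_derivative (\<lambda>h. \<Sum>i\<in>UNIV. f1 i x * h $ i)) (at x)"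
    and f2: "\<And>x i. x \<in> \<Omega> \<Longrightarrow> (f1 i has_derivative (\<lambda>h. \<Sum>j\<in>UNIV. f2 i j x * h $ j)) (at x)"
    and cont: "\<And>i j. continuous_on \<Omega> (f2 i j)"
  shows "f2 i j x = f2 j i x"
proof (rule ccontr)
  assume ne: "f2 i j x \<noteq> f2 j i x"
  define e where "e = \<bar>f2 i j x - f2 j i x\<bar> / 2"
  have e: "e > 0" using ne by (simp add: e_def)
  have near: "\<exists>d>0. \<forall>y. dist y x < d \<longrightarrow> y \<in> \<Omega> \<and> \<bar>f2 a b y - f2 a b x\<bar> < e" for a b
  proof -
    have "isCont (f2 a b) x" using cont x \<open>open \<Omega>\<close> continuous_on_eq_continuous_at by blast
    then obtain d1 where d1: "d1 > 0" "\<And>y. dist y x < d1 \<Longrightarrow> \<bar>f2 a b y - f2 a b x\<bar> < e"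
      using e unfolding continuous_at_eps_delta dist_real_def by auto
    obtain d2 where d2: "d2 > 0" "ball x d2 \<subseteq> \<Omega>" using \<open>open \<Omega>\<close> x openE by blast
    then have "y \<in> \<Omega>" if "dist y x < d2" for y using that by (auto simp: dist_commute subset_eq)
    with d1 d2 show ?thesis by (intro exI[of _ "min d1 d2"]) auto
  qed
  have key: "\<exists>s0>0. \<forall>s. 0 < s \<and> s < s0 \<longrightarrow> \<bar>(f (x + s *\<^sub>R axis a 1 + s *\<^sub>R axis b 1) - f (x + s *\<^sub>R axis a 1) - f (x + s *\<^sub>R axis b 1) + f x) / s\<^sup>2 - f2 a b x\<bar> < e" for a b
  proof -
    obtain d where d: "d > 0" "\<And>y. dist y x < d \<Longrightarrow> y \<in> \<Omega> \<and> \<bar>f2 a b y - f2 a b x\<bar> < e" using near[of a b] by blast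
    have close: "dist (x + p *\<^sub>R axis a 1 + q *\<^sub>R axis b 1) x < d" if "0 \<le> p" "0 \<le> q" "p < d / 2" "q < d / 2" for p q
    proof -
      have "dist (x + p *\<^sub>R axis a 1 + q *\<^sub>R axis b 1) x = norm (p *\<^sub>R axis a (1::real) + q *\<^sub>R axis b 1)"
        by (simp add: dist_norm add.assoc)
      also have "\<dots> \<le> p + q" using that norm_triangle_ineq[of "p *\<^sub>R axis a (1::real)" "q *\<^sub>R axis b 1"] by (simp add: norm_axis_1)
      finally show ?thesis using that by simp
    qed
    show ?thesis
    proof (intro exI[of _ "d / 2"] conjI allI impI)
      show "d / 2 > 0" using d by simp
      fix s assume s: "0 < s \<and> s < d / 2"
      let ?p = "\<lambda>t. f (x + s *\<^sub>R axis b 1 + t *\<^sub>R axis a 1) - f (x + t *\<^sub>R axis a 1)"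
      have "\<exists>z>0. z < s \<and> ?p s - ?p 0 = (s - 0) * (f1 a (x + s *\<^sub>R axis b 1 + z *\<^sub>R axis a 1) - f1 a (x + z *\<^sub>R axis a 1))"
      proof (rule MVT2)
        fix t assume t: "0 \<le> t" "t \<le> s"
        have "x + s *\<^sub>R axis b 1 + t *\<^sub>R axis a 1 \<in> \<Omega>" "x + t *\<^sub>R axis a 1 \<in> \<Omega>"
          using d(2)[OF close[of t s]] d(2)[OF close[of t 0]] t s by (auto simp: add_ac)
        then show "(?p has_real_derivative f1 a (x + s *\<^sub>R axis b 1 + t *\<^sub>R axis a 1) - f1 a (x + t *\<^sub>R axis a 1)) (at t)"
          by (intro DERIV_diff line_derivative_axis f1)
      qed (use s in auto)
      then obtain z where z: "z > 0" "z < s" "?p s - ?p 0 = s * (f1 a (x + s *\<^sub>R axis b 1 + z *\<^sub>R axis a 1) - f1 a (x + z *\<^sub>R axis a 1))" by auto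
      let ?q = "\<lambda>t. f1 a (x + z *\<^sub>R axis a 1 + t *\<^sub>R axis b 1)"
      have "\<exists>w>0. w < s \<and> ?q s - ?q 0 = (s - 0) * f2 a b (x + z *\<^sub>R axis a 1 + w *\<^sub>R axis b 1)"
      proof (rule MVT2)
        fix t assume t: "0 \<le> t" "t \<le> s"
        have "x + z *\<^sub>R axis a 1 + t *\<^sub>R axis b 1 \<in> \<Omega>"
          using d(2)[OF close[of z t]] z t s by (auto simp: add_ac)
        then show "(?q has_real_derivative f2 a b (x + z *\<^sub>R axis a 1 + t *\<^sub>R axis b 1)) (at t)"
          by (intro line_derivative_axis f2)
      qed (use s in auto)
      then obtain w where w: "w > 0" "w < s" "?q s - ?q 0 = s * f2 a b (x + z *\<^sub>R axis a 1 + w *\<^sub>R axis b 1)" by auto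
      have "?p s - ?p 0 = s * (?q s - ?q 0)" using z(3) by (simp add: add_ac)
      also have "\<dots> = s\<^sup>2 * f2 a b (x + z *\<^sub>R axis a 1 + w *\<^sub>R axis b 1)" using w(3) by (simp add: power2_eq_square)
      finally have "(?p s - ?p 0) / s\<^sup>2 = f2 a b (x + z *\<^sub>R axis a 1 + w *\<^sub>R axis b 1)" using s by simp
      moreover have "?p s - ?p 0 = f (x + s *\<^sub>R axis a 1 + s *\<^sub>R axis b 1) - f (x + s *\<^sub>R axis a 1) - f (x + s *\<^sub>R axis b 1) + f x"
        by (simp add: add_ac)
      ultimately have eq: "(f (x + s *\<^sub>R axis a 1 + s *\<^sub>R axis b 1) - f (x + s *\<^sub>R axis a 1) - f (x + s *\<^sub>R axis b 1) + f x) / s\<^sup>2 = f2 a b (x + z *\<^sub>R axis a 1 + w *\<^sub>R axis b 1)"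
        by (simp only:)
      show "\<bar>(f (x + s *\<^sub>R axis a 1 + s *\<^sub>R axis b 1) - f (x + s *\<^sub>R axis a 1) - f (x + s *\<^sub>R axis b 1) + f x) / s\<^sup>2 - f2 a b x\<bar> < e"
        unfolding eq using d(2)[OF close[of z w]] z w s by auto
    qed
  qed
  obtain s1 where s1: "s1 > 0" "\<And>s. 0 < s \<and> s < s1 \<Longrightarrow> \<bar>(f (x + s *\<^sub>R axis i 1 + s *\<^sub>R axis j 1) - f (x + s *\<^sub>R axis i 1) - f (x + s *\<^sub>R axis j 1) + f x) / s\<^sup>2 - f2 i j x\<bar> < e"
    using key[of i j] by blast
  obtain s2 where s2: "s2 > 0" "\<And>s. 0 < s \<and> s < s2 \<Longrightarrow> \<bar>(f (x + s *\<^sub>R axis j 1 + s *\<^sub>R axis i 1) - f (x + s *\<^sub>R axis j 1) - f (x + s *\<^sub>R axis i 1) + f x) / s\<^sup>2 - f2 j i x\<bar> < e"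
    using key[of j i] by blast
  define s where "s = min s1 s2 / 2"
  have "0 < s \<and> s < s1" "0 < s \<and> s < s2" using s1(1) s2(1) by (auto simp: s_def)
  note b = s1(2)[OF this(1)] s2(2)[OF this(2)]
  have sw: "f (x + s *\<^sub>R axis j 1 + s *\<^sub>R axis i 1) - f (x + s *\<^sub>R axis j 1) - f (x + s *\<^sub>R axis i 1) + f x = f (x + s *\<^sub>R axis i 1 + s *\<^sub>R axis j 1) - f (x + s *\<^sub>R axis i 1) - f (x + s *\<^sub>R axis j 1) + f x"
    by (simp add: add_ac)
  define Q where "Q = (f (x + s *\<^sub>R axis i 1 + s *\<^sub>R axis j 1) - f (x + s *\<^sub>R axis i 1) - f (x + s *\<^sub>R axis j 1) + f x) / s\<^sup>2"
  have "\<bar>Q - f2 i j x\<bar> < e" "\<bar>Q - f2 j i x\<bar> < e" using b unfolding sw Q_def by simp_all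
  moreover have "\<bar>f2 i j x - f2 j i x\<bar> \<le> \<bar>Q - f2 j i x\<bar> + \<bar>Q - f2 i j x\<bar>"
    using abs_triangle_ineq4[of "Q - f2 j i x" "Q - f2 i j x"] by simp
  ultimately show False unfolding e_def by simp
qed

lemma differentiable_partials:
  fixes u :: "real^'n \<Rightarrow> real"
  assumes "u differentiable (at x)"
  shows "(u has_derivative (\<lambda>h. \<Sum>i\<in>UNIV. partial_deriv i u x * h $ i)) (at x)"
proof -
  let ?D = "frechet_derivative u (at x)"
  have D: "(u has_derivative ?D) (at x)" using assms frechet_derivative_works by blast
  then have lin: "linear ?D" by (rule has_derivative_linear)
  have "?D h = (\<Sum>i\<in>UNIV. partial_deriv i u x * h $ i)" for h
  proof -
    have "?D h = ?D (\<Sum>i\<in>UNIV. h $ i *\<^sub>R axis i 1)"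
      using basis_expansion[of h] by (simp add: scalar_mult_eq_scaleR)
    then show ?thesis by (simp add: linear_sum[OF lin] linear_cmul[OF lin] partial_deriv_def mult.commute)
  qed
  then have "?D = (\<lambda>h. \<Sum>i\<in>UNIV. partial_deriv i u x * h $ i)" by blast
  with D show ?thesis by (simp only:)
qed

lemma partial_deriv_eq:
  assumes "(u has_derivative (\<lambda>h. \<Sum>i\<in>UNIV. g i * h $ i)) (at x)"
  shows "partial_deriv j u x = g j"
  using frechet_derivative_at[OF assms, symmetric]
  by (simp add: partial_deriv_def axis_def if_distrib cong: if_cong)

lemma Ck_closure_continuous: "Ck_closure m \<Omega> u \<Longrightarrow> continuous_on (closure \<Omega>) u"
  by (cases m) auto

lemma Ck_closure_Suc_derivatives:
  assumes "Ck_closure (Suc m) \<Omega> u"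
  shows "\<exists>g. (\<forall>i. Ck_closure m \<Omega> (g i)) \<and> (\<forall>x\<in>\<Omega>. (u has_derivative (\<lambda>h. \<Sum>i\<in>UNIV. g i x * h $ i)) (at x))"
proof -
  have "\<forall>i. \<exists>g. Ck_closure m \<Omega> g \<and> (\<forall>x\<in>\<Omega>. g x = partial_deriv i u x)" using assms by auto
  then obtain g where g: "\<And>i. Ck_closure m \<Omega> (g i)" "\<And>i x. x \<in> \<Omega> \<Longrightarrow> g i x = partial_deriv i u x" by metis
  have "(u has_derivative (\<lambda>h. \<Sum>i\<in>UNIV. g i x * h $ i)) (at x)" if "x \<in> \<Omega>" for x
    using differentiable_partials[of u x] assms that by (simp add: g(2))
  with g(1) show ?thesis by blast
qed

lemma Ck_closure_jet2:
  assumes "open \<Omega>" "Ck_closure 2 \<Omega> u"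
  shows "\<exists>u1 u2. jet2 \<Omega> u u1 u2"
proof -
  obtain u1 where u1: "\<And>i. Ck_closure 1 \<Omega> (u1 i)" "\<And>x. x\<in>\<Omega> \<Longrightarrow> (u has_derivative (\<lambda>h. \<Sum>i\<in>UNIV. u1 i x * h $ i)) (at x)"
    using Ck_closure_Suc_derivatives[OF assms(2)[unfolded numeral_2_eq_2 One_nat_def[symmetric]]] by blast
  have "\<forall>i. \<exists>g. (\<forall>j. Ck_closure 0 \<Omega> (g j)) \<and> (\<forall>x\<in>\<Omega>. (u1 i has_derivative (\<lambda>h. \<Sum>j\<in>UNIV. g j x * h $ j)) (at x))"
    using Ck_closure_Suc_derivatives[of 0] u1(1)[unfolded One_nat_def] by blast
  from choice[OF this] obtain u2 where u2: "\<And>i j. Ck_closure 0 \<Omega> (u2 i j)"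
      "\<And>i x. x\<in>\<Omega> \<Longrightarrow> (u1 i has_derivative (\<lambda>h. \<Sum>j\<in>UNIV. u2 i j x * h $ j)) (at x)" by blast
  have c: "continuous_on \<Omega> (u2 i j)" for i j
    by (rule continuous_on_subset[OF Ck_closure_continuous[OF u2(1)] closure_subset])
  have J: "jet2 \<Omega> u u1 u2"
    unfolding jet2_def
    by (intro conjI allI ballI Ck_closure_continuous[OF assms(2)] Ck_closure_continuous[OF u1(1)] Ck_closure_continuous[OF u2(1)] u1(2) u2(2)
      mixed_partials_eq[OF assms(1) _ u1(2) u2(2) c]) assumption+
  then show ?thesis by (intro exI)
qed

lemma jet2_partial_deriv: "jet2 \<Omega> u u1 u2 \<Longrightarrow> x \<in> \<Omega> \<Longrightarrow> partial_deriv i u x = u1 i x"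
  by (rule partial_deriv_eq) (rule jet2D(4))

lemma Ck_closure_jet3:
  assumes "open \<Omega>" "Ck_closure 3 \<Omega> u"
  shows "\<exists>u1 u2 u3. jet3 \<Omega> u u1 u2 u3"
proof -
  obtain u1 where u1: "\<And>i. Ck_closure 2 \<Omega> (u1 i)" "\<And>x. x\<in>\<Omega> \<Longrightarrow> (u has_derivative (\<lambda>h. \<Sum>i\<in>UNIV. u1 i x * h $ i)) (at x)"
    using Ck_closure_Suc_derivatives[OF assms(2)[unfolded numeral_3_eq_3 numeral_2_eq_2[symmetric]]] by blast
  have "\<forall>i. \<exists>g h. jet2 \<Omega> (u1 i) g h" using Ck_closure_jet2[OF assms(1) u1(1)] by blast
  then obtain u2 u3 where j: "\<And>i. jet2 \<Omega> (u1 i) (u2 i) (u3 i)" by metis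
  have c: "continuous_on \<Omega> (u2 i j)" for i j
    by (rule continuous_on_subset[OF jet2D(2)[OF j] closure_subset])
  have J: "jet2 \<Omega> u u1 u2"
    unfolding jet2_def
    by (intro conjI allI ballI Ck_closure_continuous[OF assms(2)] Ck_closure_continuous[OF u1(1)] jet2D(2)[OF j] jet2D(4)[OF j] u1(2)
      mixed_partials_eq[OF assms(1) _ u1(2) jet2D(4)[OF j] c]) assumption+
  with j show ?thesis unfolding jet3_def by (intro exI conjI allI)
qed

lemma jet2_hessian:
  assumes "open \<Omega>" "jet2 \<Omega> u u1 u2" "x \<in> \<Omega>"
  shows "hessian u x = (\<chi> i j. u2 i j x)"
proof -
  have "partial_deriv i (partial_deriv j u) x = u2 i j x" for i j
  proof -
    have "(partial_deriv j u has_derivative (\<lambda>h. \<Sum>k\<in>UNIV. u2 j k x * h $ k)) (at x)"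
      by (rule has_derivative_transform_within_open[OF jet2D(5)[OF assms(2,3)] assms(1,3)])
        (simp add: jet2_partial_deriv[OF assms(2)])
    from partial_deriv_eq[OF this] show ?thesis using jet2D(6)[OF assms(2,3)] by simp
  qed
  then show ?thesis by (simp add: hessian_def vec_eq_iff)
qed

section \<open>Integration by parts on convex domains\<close>

text \<open>Connectedness provides a frontier point on the segment. Points strictly between an
  interior point and a point of the closure of a convex set are interior, so the segment stays
  inside up to it.\<close>

lemma exit_point:
  fixes \<Omega> :: "'a::euclidean_space set"
  assumes op: "open \<Omega>" and cv: "convex \<Omega>" and a: "a \<in> \<Omega>" and b: "a + h *\<^sub>R w \<notin> \<Omega>" and h: "h > 0"
  shows "\<exists>t. 0 < t \<and> t \<le> h \<and> a + t *\<^sub>R w \<in> frontier \<Omega> \<and> (\<forall>s. 0 \<le> s \<and> s < t \<longrightarrow> a + s *\<^sub>R w \<in> \<Omega>)"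
proof -
  let ?S = "(\<lambda>t. a + t *\<^sub>R w) ` {0..h}"
  have "connected ?S" by (intro connected_continuous_image continuous_intros) simp
  moreover have "a \<in> ?S" "a + h *\<^sub>R w \<in> ?S" using h by (auto intro: image_eqI[of _ _ 0])
  ultimately have "?S \<inter> frontier \<Omega> \<noteq> {}"
    using a b by (intro connected_Int_frontier) auto
  then obtain t where t: "0 \<le> t" "t \<le> h" "a + t *\<^sub>R w \<in> frontier \<Omega>" by auto
  have fr: "a + t *\<^sub>R w \<notin> \<Omega>" "a + t *\<^sub>R w \<in> closure \<Omega>" using t(3) op by (auto simp: frontier_def interior_open)
  have t0: "t \<noteq> 0" using fr a by auto
  have w0: "w \<noteq> 0" using fr a by auto
  have "a + s *\<^sub>R w \<in> \<Omega>" if s: "0 \<le> s" "s < t" for s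
  proof (cases "s = 0")
    case False
    have "a + s *\<^sub>R w = (1 - s / t) *\<^sub>R a + (s / t) *\<^sub>R (a + t *\<^sub>R w)"
      using t0 by (simp add: algebra_simps)
    moreover have "0 < s / t" "s / t < 1" using s False by auto
    ultimately have "a + s *\<^sub>R w \<in> open_segment a (a + t *\<^sub>R w)"
      using t0 w0 unfolding in_segment by (auto intro!: exI[of _ "s / t"])
    then show ?thesis
      using in_interior_closure_convex_segment[OF cv, of a "a + t *\<^sub>R w"] a fr op
      by (auto simp: interior_open)
  qed (use a in simp)
  with t t0 show ?thesis by (intro exI[of _ t]) auto
qed

text \<open>This replaces the divergence theorem. Extend \<open>X\<close> by zero; since it vanishes
  on the frontier the extension is Lipschitz along \<open>e\<close>. Its difference quotients have
  integral zero by translation invariance and converge off the frontier, which is null for a convex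
  set.\<close>

lemma integral_directional_derivative_zero:
  fixes \<Omega> :: "'a::euclidean_space set"
  assumes op: "open \<Omega>" and bd: "bounded \<Omega>" and cv: "convex \<Omega>"
    and Xc: "continuous_on (closure \<Omega>) X" and X0: "\<And>x. x \<in> frontier \<Omega> \<Longrightarrow> X x = 0"
    and D: "\<And>x. x \<in> \<Omega> \<Longrightarrow> ((\<lambda>t. X (x + t *\<^sub>R e)) has_real_derivative d x) (at 0)"
    and dc: "continuous_on \<Omega> d" and K: "\<And>x. x \<in> \<Omega> \<Longrightarrow> \<bar>d x\<bar> \<le> K"
  shows "(LINT x:\<Omega>|lborel. d x) = 0"
proof (cases "\<Omega> = {}")
  case True then show ?thesis by (simp add: set_lebesgue_integral_def)
next
  case False
  then obtain x0 where "x0 \<in> \<Omega>" by blast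
  then have K0: "K \<ge> 0" using K[of x0] by linarith
  define Y where "Y x = indicator (closure \<Omega>) x *\<^sub>R X x" for x
  have fr: "x \<in> closure \<Omega> \<Longrightarrow> x \<notin> \<Omega> \<Longrightarrow> x \<in> frontier \<Omega>" for x
    using op by (simp add: frontier_def interior_open)
  have Y0: "Y x = 0" if "x \<notin> \<Omega>" for x
    using X0[OF fr] that by (auto simp: Y_def indicator_def)
  have Y1: "Y x = X x" if "x \<in> closure \<Omega>" for x using that by (simp add: Y_def)
  have cl: "x \<in> closure \<Omega>" if "x \<in> \<Omega>" for x using that closure_subset by blast
  have line: "((\<lambda>t. X (p + t *\<^sub>R e)) has_real_derivative d (p + t *\<^sub>R e)) (at t)" if "p + t *\<^sub>R e \<in> \<Omega>" for p t
  proof -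
    have "((\<lambda>s. X (p + (s + t) *\<^sub>R e)) has_real_derivative d (p + t *\<^sub>R e)) (at 0)"
      using D[OF that] by (simp add: algebra_simps)
    then show ?thesis using DERIV_shift[of "\<lambda>t. X (p + t *\<^sub>R e)" "d (p + t *\<^sub>R e)" 0 t] by simp
  qed
  have chord: "\<bar>X (p + t *\<^sub>R e) - X p\<bar> \<le> K * t"
    if t: "t \<ge> 0" and cl: "\<And>s. 0 \<le> s \<Longrightarrow> s \<le> t \<Longrightarrow> p + s *\<^sub>R e \<in> closure \<Omega>"
      and inn: "\<And>s. 0 < s \<Longrightarrow> s < t \<Longrightarrow> p + s *\<^sub>R e \<in> \<Omega>" for p t
  proof (cases "t = 0")
    case False
    have "continuous_on {0..t} (\<lambda>s. X (p + s *\<^sub>R e))"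
      by (rule continuous_on_compose2[OF Xc]) (use cl in \<open>auto intro!: continuous_intros\<close>)
    moreover have "(\<lambda>s. X (p + s *\<^sub>R e)) differentiable (at s)" if "0 < s" "s < t" for s
      using line[OF inn[OF that]] real_differentiable_def by blast
    ultimately obtain l z where z: "0 < z" "z < t" "((\<lambda>s. X (p + s *\<^sub>R e)) has_real_derivative l) (at z)"
        "X (p + t *\<^sub>R e) - X (p + 0 *\<^sub>R e) = (t - 0) * l"
      using MVT[of 0 t "\<lambda>s. X (p + s *\<^sub>R e)"] t False by auto
    have "l = d (p + z *\<^sub>R e)" using DERIV_unique[OF z(3) line[OF inn[OF z(1,2)]]] .
    then have "\<bar>l\<bar> \<le> K" using K[OF inn[OF z(1,2)]] by simp
    then show ?thesis using z(4) t mult_right_mono[of "\<bar>l\<bar>" K t] by (simp add: abs_mult mult.commute)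
  qed simp
  \<comment> \<open>By convexity the chord meets the domain in one interval. Only that part
    contributes, and at an exit point \<open>X\<close> is zero.\<close>
  have Lip: "\<bar>Y (x + h *\<^sub>R e) - Y x\<bar> \<le> K * h" if h: "h > 0" for x h
  proof -
    consider "x \<in> \<Omega>" "x + h *\<^sub>R e \<in> \<Omega>" | "x \<in> \<Omega>" "x + h *\<^sub>R e \<notin> \<Omega>" | "x \<notin> \<Omega>" "x + h *\<^sub>R e \<in> \<Omega>" | "x \<notin> \<Omega>" "x + h *\<^sub>R e \<notin> \<Omega>" by blast
    then show ?thesis
    proof cases
      case 1
      have i: "x + s *\<^sub>R e \<in> \<Omega>" if "0 \<le> s" "s \<le> h" for s
      proof -
        have "x + s *\<^sub>R e = (1 - s / h) *\<^sub>R x + (s / h) *\<^sub>R (x + h *\<^sub>R e)"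
          using h by (simp add: algebra_simps)
        then show ?thesis using convexD_alt[OF cv 1, of "s / h"] that h by simp
      qed
      show ?thesis unfolding Y1[OF cl[OF 1(1)]] Y1[OF cl[OF 1(2)]]
        by (rule chord) (use h i cl in auto)
    next
      case 2
      obtain t where t: "0 < t" "t \<le> h" "x + t *\<^sub>R e \<in> frontier \<Omega>" and i: "\<forall>s. 0 \<le> s \<and> s < t \<longrightarrow> x + s *\<^sub>R e \<in> \<Omega>"
        using exit_point[OF op cv 2(1,2) h] by blast
      have "\<bar>X (x + t *\<^sub>R e) - X x\<bar> \<le> K * t"
      proof (rule chord)
        show "x + s *\<^sub>R e \<in> closure \<Omega>" if "0 \<le> s" "s \<le> t" for s
          using i that t cl[of "x + s *\<^sub>R e"] by (cases "s = t") (auto simp: frontier_def)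
      qed (use t i in auto)
      also have "\<dots> \<le> K * h" using t K0 by (intro mult_left_mono)
      finally show ?thesis using X0[OF t(3)] Y0[OF 2(2)] Y1[OF cl[OF 2(1)]] by simp
    next
      case 3
      let ?a = "x + h *\<^sub>R e"
      have "?a + h *\<^sub>R (- e) \<notin> \<Omega>" using 3 by simp
      from exit_point[OF op cv 3(2) this h] obtain t where t: "0 < t" "t \<le> h" "?a + t *\<^sub>R (- e) \<in> frontier \<Omega>"
        and i: "\<forall>s. 0 \<le> s \<and> s < t \<longrightarrow> ?a + s *\<^sub>R (- e) \<in> \<Omega>" by blast
      define p where "p = ?a + t *\<^sub>R (- e)"
      have ph: "p + s *\<^sub>R e = ?a + (t - s) *\<^sub>R (- e)" for s by (simp add: p_def algebra_simps)
      have ip: "p + s *\<^sub>R e \<in> \<Omega>" if "0 < s" "s \<le> t" for s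
        unfolding ph using i that by simp
      have "\<bar>X (p + t *\<^sub>R e) - X p\<bar> \<le> K * t"
      proof (rule chord)
        show "p + s *\<^sub>R e \<in> closure \<Omega>" if "0 \<le> s" "s \<le> t" for s
          using ip[of s] that t cl[of "p + s *\<^sub>R e"] by (cases "s = 0") (auto simp: frontier_def p_def)
      qed (use t ip in auto)
      also have "\<dots> \<le> K * h" using t K0 by (intro mult_left_mono)
      finally show ?thesis using X0[OF t(3)] Y0[OF 3(1)] Y1[OF cl[OF 3(2)]] by (simp add: p_def)
    next
      case 4 then show ?thesis using Y0 K0 h by simp
    qed
  qed
  have Yi: "integrable lborel Y"
    unfolding Y_def by (rule borel_integrable_compact) (use bd Xc in \<open>auto simp: compact_closure\<close>)
  then have Ym[measurable]: "Y \<in> borel_measurable borel" by auto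
  define h where "h n = 1 / real (Suc n)" for n
  have h0: "h n > 0" and h1: "h n \<le> 1" for n by (auto simp: h_def)
  have hlim: "h \<longlonglongrightarrow> 0" unfolding h_def by real_asymp
  define q where "q n x = (Y (x + h n *\<^sub>R e) - Y x) / h n" for n x
  have shift: "integrable lborel (\<lambda>x. Y (x + c))" "(LINT x|lborel. Y (x + c)) = (LINT x|lborel. Y x)" for c
  proof -
    have eq: "lborel = distr lborel borel ((+) c)" using lborel_distr_plus[of c] by simp
    show "integrable lborel (\<lambda>x. Y (x + c))"
      using Yi by (subst (asm) eq, subst (asm) integrable_distr_eq) (auto simp: add.commute)
    show "(LINT x|lborel. Y (x + c)) = (LINT x|lborel. Y x)"
      by (subst (2) eq, subst integral_distr) (auto simp: add.commute)
  qed
  have q0: "(LINT x|lborel. q n x) = 0" for n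
    unfolding q_def using shift[of "h n *\<^sub>R e"] Yi by simp
  obtain R where R: "\<And>x. x \<in> \<Omega> \<Longrightarrow> norm x \<le> R" using bd unfolding bounded_iff by blast
  have dm: "(\<lambda>x. indicator \<Omega> x *\<^sub>R d x) \<in> borel_measurable borel"
    by (rule borel_measurable_continuous_on_indicator) (use op dc in auto)
  have "(\<lambda>n. LINT x|lborel. q n x) \<longlonglongrightarrow> (LINT x|lborel. indicator \<Omega> x *\<^sub>R d x)"
  proof (rule integral_dominated_convergence[where w="\<lambda>x. indicator (cball 0 (R + norm e)) x *\<^sub>R K"])
    show "(\<lambda>x. indicator \<Omega> x *\<^sub>R d x) \<in> borel_measurable lborel" using dm by simp
    show "q n \<in> borel_measurable lborel" for n unfolding q_def by measurable
    show "integrable lborel (\<lambda>x. indicator (cball 0 (R + norm e)) x *\<^sub>R K)"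
      by (rule borel_integrable_compact) auto
    have "negligible (frontier \<Omega>)" using cv by (rule negligible_convex_frontier)
    then have "AE x in lebesgue. x \<notin> frontier \<Omega>" by (simp add: AE_iff_null_sets negligible_iff_null_sets AE_not_in)
    then have "AE x in lborel. x \<notin> frontier \<Omega>"
      by (simp add: AE_completion_iff)
    then show "AE x in lborel. (\<lambda>n. q n x) \<longlonglongrightarrow> indicator \<Omega> x *\<^sub>R d x"
    proof eventually_elim
      case (elim x)
      have lim: "(\<lambda>n. x + h n *\<^sub>R e) \<longlonglongrightarrow> x"
        using tendsto_add[OF tendsto_const tendsto_scaleR[OF hlim tendsto_const], of x e] by simp
      show ?case
      proof (cases "x \<in> \<Omega>")
        case True
        have "\<forall>\<^sub>F n in sequentially. x + h n *\<^sub>R e \<in> \<Omega>"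
          using topological_tendstoD[OF lim op True] .
        then have ev: "\<forall>\<^sub>F n in sequentially. (X (x + h n *\<^sub>R e) - X x) / h n = q n x"
          by eventually_elim (simp add: q_def Y1[OF cl] True)
        have "((\<lambda>t. (X (x + t *\<^sub>R e) - X x) / t) \<longlongrightarrow> d x) (at 0)"
          using D[OF True] by (simp add: DERIV_def)
        moreover have "filterlim h (at 0) sequentially"
          using hlim h0 by (auto simp: filterlim_at intro!: always_eventually less_imp_neq[symmetric])
        ultimately have "(\<lambda>n. (X (x + h n *\<^sub>R e) - X x) / h n) \<longlonglongrightarrow> d x"
          by (rule filterlim_compose)
        then show ?thesis using tendsto_cong[OF ev] True by simp
      next
        case False
        with elim have "x \<in> - closure \<Omega>" using fr by auto
        then have "\<forall>\<^sub>F n in sequentially. x + h n *\<^sub>R e \<in> - closure \<Omega>"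
          by (intro topological_tendstoD[OF lim]) auto
        then have "\<forall>\<^sub>F n in sequentially. q n x = 0"
          by eventually_elim (use \<open>x \<in> - closure \<Omega>\<close> in \<open>auto simp: q_def Y_def\<close>)
        then have "(\<lambda>n. q n x) \<longlonglongrightarrow> 0" by (simp add: tendsto_eventually)
        then show ?thesis using False by simp
      qed
    qed
    show "AE x in lborel. norm (q n x) \<le> indicator (cball 0 (R + norm e)) x *\<^sub>R K" for n
    proof (rule AE_I2)
      fix x :: 'a
      show "norm (q n x) \<le> indicator (cball 0 (R + norm e)) x *\<^sub>R K"
      proof (cases "x \<in> cball 0 (R + norm e)")
        case True
        then show ?thesis using Lip[OF h0[of n], of x] h0[of n] by (simp add: q_def divide_le_eq)
      next
        case False
        then have n: "norm x > R + norm e" by simp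
        then have "x \<notin> \<Omega>" using R[of x] norm_ge_zero[of e] by linarith
        moreover have "x + h n *\<^sub>R e \<notin> \<Omega>"
        proof
          assume "x + h n *\<^sub>R e \<in> \<Omega>"
          then have "norm (x + h n *\<^sub>R e) \<le> R" by (rule R)
          moreover have "norm x - norm (h n *\<^sub>R e) \<le> norm (x + h n *\<^sub>R e)" by (rule norm_diff_ineq)
          moreover have "norm (h n *\<^sub>R e) \<le> norm e"
            using h0[of n] h1[of n] by (simp add: mult_left_le_one_le)
          ultimately show False using n by linarith
        qed
        ultimately show ?thesis using Y0 False by (simp add: q_def)
      qed
    qed
  qed
  then show ?thesis unfolding q0 set_lebesgue_integral_def by (simp add: LIMSEQ_const_iff)
qed

lemma jet3_third_symmetric:
  assumes "open \<Omega>" and j: "jet3 \<Omega> u u1 u2 u3" and x: "x \<in> \<Omega>"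
  shows "u3 i j k x = u3 k j i x"
proof -
  have j2: "jet2 \<Omega> u u1 u2" and j3: "jet2 \<Omega> (u1 a) (u2 a) (u3 a)" for a using j by (auto simp: jet3_def)
  have first: "u3 a b c x = u3 b a c x" for a b c
  proof -
    have "(u2 a b has_derivative (\<lambda>h. \<Sum>k\<in>UNIV. u3 b a k x * h $ k)) (at x)"
      by (rule has_derivative_transform_within_open[OF jet2D(5)[OF j3 x] assms(1) x]) (rule jet2D(6)[OF j2])
    from partial_deriv_eq[OF this] partial_deriv_eq[OF jet2D(5)[OF j3 x]] show ?thesis by metis
  qed
  have last: "u3 a b c x = u3 a c b x" for a b c using jet2D(6)[OF j3 x] .
  show ?thesis by (metis first last)
qed

section \<open>The flux identity for the linearised operator\<close>

lemma continuous_on_minor_sum_deriv: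
  fixes A :: "'x::topological_space \<Rightarrow> real^'n^'n"
  assumes "\<And>i j. continuous_on T (\<lambda>x. A x $ i $ j)"
  shows "continuous_on T (\<lambda>x. minor_sum_deriv k (A x) i j)"
  unfolding minor_sum_deriv_def
proof (intro continuous_on_sum)
  fix S :: "'n set" and \<pi>
  show "continuous_on T (\<lambda>x. if i \<in> S \<and> \<pi> i = j then of_int (sign \<pi>) * (\<Prod>l\<in>S - {i}. A x $ l $ \<pi> l) else 0)"
    by (cases "i \<in> S \<and> \<pi> i = j") (auto intro!: continuous_intros assms)
qed

lemma continuous_on_minor_sum_lin:
  fixes A B :: "'x::topological_space \<Rightarrow> real^'n^'n"
  assumes "\<And>i j. continuous_on T (\<lambda>x. A x $ i $ j)" "\<And>i j. continuous_on T (\<lambda>x. B x $ i $ j)"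
  shows "continuous_on T (\<lambda>x. minor_sum_lin k (A x) (B x))"
  unfolding minor_sum_lin_def by (intro continuous_intros continuous_on_minor_sum_deriv assms)

lemma set_integrable_closure:
  fixes f :: "'a::euclidean_space \<Rightarrow> real"
  assumes "bounded \<Omega>" "open \<Omega>" "continuous_on (closure \<Omega>) f"
  shows "set_integrable lborel \<Omega> f"
proof -
  have "set_integrable lborel (closure \<Omega>) f"
    unfolding set_integrable_def by (rule borel_integrable_compact) (use assms in \<open>auto simp: compact_closure\<close>)
  then show ?thesis by (rule set_integrable_subset) (use assms closure_subset in auto)
qed

text \<open>The field with components c S_ij v_j has divergence c L(D^2 v) + c_i S_ij v_j, because S
  is divergence free. The boundary condition concerns only the product of weight and gradient, so it
  covers both a vanishing weight and a vanishing gradient.\<close>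

lemma flux_integral_zero:
  fixes \<Omega> :: "(real^'n) set"
  assumes op: "open \<Omega>" and bd: "bounded \<Omega>" and cv: "convex \<Omega>"
    and u: "jet3 \<Omega> u u1 u2 u3" and v: "jet2 \<Omega> v v1 v2"
    and c: "continuous_on (closure \<Omega>) c" "\<And>i. continuous_on (closure \<Omega>) (c1 i)"
      "\<And>x. x \<in> \<Omega> \<Longrightarrow> (c has_derivative (\<lambda>h. \<Sum>i\<in>UNIV. c1 i x * h $ i)) (at x)"
    and bnd: "\<And>x j. x \<in> frontier \<Omega> \<Longrightarrow> c x * v1 j x = 0"
  shows "(LINT x:\<Omega>|lborel. c x * minor_sum_lin k (\<chi> i j. u2 i j x) (\<chi> i j. v2 i j x) +
     (\<Sum>i\<in>UNIV. \<Sum>j\<in>UNIV. c1 i x * minor_sum_deriv k (\<chi> i j. u2 i j x) i j * v1 j x)) = 0"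
proof -
  define M where "M x = (\<chi> i j. u2 i j x)" for x
  define S where "S x = minor_sum_deriv k (M x)" for x
  \<comment> \<open>The derivative of \<open>S x i j\<close> in direction \<open>e\<close> by the
    product rule.\<close>
  define dS where "dS x e i j = (\<Sum>S | card S = k. \<Sum>\<pi> | \<pi> permutes S. if i \<in> S \<and> \<pi> i = j then
        of_int (sign \<pi>) * (\<Sum>l\<in>S - {i}. u3 l (\<pi> l) e x * (\<Prod>m\<in>S - {i} - {l}. M x $ m $ \<pi> m)) else 0)" for x e i j
  have j2: "jet2 \<Omega> u u1 u2" and j3: "jet2 \<Omega> (u1 a) (u2 a) (u3 a)" for a using u by (auto simp: jet3_def)
  have Mc: "continuous_on (closure \<Omega>) (\<lambda>x. M x $ i $ j)" for i j
    using jet2D(3)[OF j2] by (simp add: M_def)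
  have Sc: "continuous_on (closure \<Omega>) (\<lambda>x. S x i j)" for i j
    unfolding S_def by (rule continuous_on_minor_sum_deriv[OF Mc])
  have dSc: "continuous_on (closure \<Omega>) (\<lambda>x. dS x e i j)" for e i j
    unfolding dS_def
  proof (intro continuous_on_sum)
    fix S :: "'n set" and \<pi>
    show "continuous_on (closure \<Omega>) (\<lambda>x. if i \<in> S \<and> \<pi> i = j then
        of_int (sign \<pi>) * (\<Sum>l\<in>S - {i}. u3 l (\<pi> l) e x * (\<Prod>m\<in>S - {i} - {l}. M x $ m $ \<pi> m)) else 0)"
      by (cases "i \<in> S \<and> \<pi> i = j") (auto intro!: continuous_intros Mc jet2D(3)[OF j3])
  qed
  \<comment> \<open>The \<open>i\<close>-th partial derivative of the \<open>i\<close>-th component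
    of the field; the sum over \<open>i\<close> is its divergence.\<close>
  define d where "d i x = c1 i x * (\<Sum>j\<in>UNIV. S x i j * v1 j x) + (\<Sum>j\<in>UNIV. dS x i i j * v1 j x + v2 j i x * S x i j) * c x" for i x
  have dc: "continuous_on (closure \<Omega>) (d i)" for i
    unfolding d_def by (intro continuous_intros c Sc dSc jet2D(2,3)[OF v])
  have der: "((\<lambda>t. c (x + t *\<^sub>R axis i 1) * (\<Sum>j\<in>UNIV. S (x + t *\<^sub>R axis i 1) i j * v1 j (x + t *\<^sub>R axis i 1))) has_real_derivative d i x) (at 0)"
    if x: "x \<in> \<Omega>" for i x
  proof -
    have x0: "x + 0 *\<^sub>R axis i 1 = x" by simp
    have "((\<lambda>t. M (x + t *\<^sub>R axis i 1) $ a $ b) has_real_derivative u3 a b i x) (at 0)" for a b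
      unfolding M_def vec_lambda_beta by (rule line_derivative_axis) (simp add: jet2D(5)[OF j3 x])
    from has_field_derivative_minor_sum_deriv[OF this]
    have "((\<lambda>t. S (x + t *\<^sub>R axis i 1) i j) has_real_derivative dS x i i j) (at 0)" for j
      unfolding S_def dS_def x0 .
    moreover have "((\<lambda>t. v1 j (x + t *\<^sub>R axis i 1)) has_real_derivative v2 j i x) (at 0)" for j
      by (rule line_derivative_axis) (simp add: jet2D(5)[OF v x])
    moreover have "((\<lambda>t. c (x + t *\<^sub>R axis i 1)) has_real_derivative c1 i x) (at 0)"
      by (rule line_derivative_axis) (simp add: c(3)[OF x])
    ultimately have "((\<lambda>t. c (x + t *\<^sub>R axis i 1) * (\<Sum>j\<in>UNIV. S (x + t *\<^sub>R axis i 1) i j * v1 j (x + t *\<^sub>R axis i 1))) has_real_derivative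
       (c1 i x * (\<Sum>j\<in>UNIV. S (x + 0 *\<^sub>R axis i 1) i j * v1 j (x + 0 *\<^sub>R axis i 1)) +
        (\<Sum>j\<in>UNIV. dS x i i j * v1 j (x + 0 *\<^sub>R axis i 1) + v2 j i x * S (x + 0 *\<^sub>R axis i 1) i j) * c (x + 0 *\<^sub>R axis i 1))) (at 0)"
      by (intro DERIV_mult DERIV_sum)
    then show ?thesis unfolding x0 d_def .
  qed
  have zero: "(LINT x:\<Omega>|lborel. d i x) = 0" for i
  proof -
    have "compact (d i ` closure \<Omega>)"
      using dc bd by (intro compact_continuous_image) (auto simp: compact_closure)
    from compact_imp_bounded[OF this] obtain K where "\<forall>y\<in>d i ` closure \<Omega>. norm y \<le> K"
      unfolding bounded_iff by blast
    then have K: "\<And>x. x \<in> closure \<Omega> \<Longrightarrow> \<bar>d i x\<bar> \<le> K" by simp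
    show ?thesis
    proof (rule integral_directional_derivative_zero[OF op bd cv _ _ der])
      show "continuous_on (closure \<Omega>) (\<lambda>x. c x * (\<Sum>j\<in>UNIV. S x i j * v1 j x))"
        by (intro continuous_intros c Sc jet2D(2)[OF v])
      show "c x * (\<Sum>j\<in>UNIV. S x i j * v1 j x) = 0" if "x \<in> frontier \<Omega>" for x
        using bnd[OF that] by (auto simp: sum_distrib_left intro!: sum.neutral)
      show "continuous_on \<Omega> (d i)" by (rule continuous_on_subset[OF dc closure_subset])
      show "\<bar>d i x\<bar> \<le> K" if "x \<in> \<Omega>" for x using K that closure_subset by auto
    qed
  qed
  have point: "(\<Sum>i\<in>UNIV. d i x) = c x * minor_sum_lin k (M x) (\<chi> i j. v2 i j x) +
     (\<Sum>i\<in>UNIV. \<Sum>j\<in>UNIV. c1 i x * S x i j * v1 j x)" if x: "x \<in> \<Omega>" for x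
  proof -
    have div: "(\<Sum>i\<in>UNIV. dS x i i j) = 0" for j
      unfolding dS_def
      by (rule minor_sum_deriv_divergence_free[of "\<lambda>i l m. u3 l m i x"]) (rule jet3_third_symmetric[OF op u x])
    have "(\<Sum>i\<in>UNIV. \<Sum>j\<in>UNIV. dS x i i j * v1 j x) = (\<Sum>j\<in>UNIV. \<Sum>i\<in>UNIV. dS x i i j * v1 j x)"
      by (rule sum.swap)
    also have "\<dots> = 0" by (simp add: sum_distrib_right[symmetric] div)
    finally have z: "(\<Sum>i\<in>UNIV. \<Sum>j\<in>UNIV. dS x i i j * v1 j x) = 0" .
    have "(\<Sum>i\<in>UNIV. (\<Sum>j\<in>UNIV. dS x i i j * v1 j x + v2 j i x * S x i j) * c x) = c x * (\<Sum>i\<in>UNIV. \<Sum>j\<in>UNIV. v2 j i x * S x i j)"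
      by (simp only: sum_distrib_right[symmetric] sum.distrib z add_0) (rule mult.commute)
    also have "\<dots> = c x * minor_sum_lin k (M x) (\<chi> i j. v2 i j x)"
      unfolding minor_sum_lin_def S_def[symmetric] by (simp add: jet2D(6)[OF v x, of _ _] mult.commute)
    finally show ?thesis unfolding d_def sum.distrib
      by (simp add: sum_distrib_left mult.assoc)
  qed
  have "0 = (\<Sum>i\<in>UNIV. (LINT x:\<Omega>|lborel. d i x))" by (simp add: zero)
  also have "\<dots> = (LINT x:\<Omega>|lborel. (\<Sum>i\<in>UNIV. d i x))"
    unfolding set_lebesgue_integral_def scaleR_sum_right
    by (rule Bochner_Integration.integral_sum[symmetric])
      (use set_integrable_closure[OF bd op dc] in \<open>simp add: set_integrable_def\<close>)
  also have "\<dots> = (LINT x:\<Omega>|lborel. c x * minor_sum_lin k (M x) (\<chi> i j. v2 i j x) +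
     (\<Sum>i\<in>UNIV. \<Sum>j\<in>UNIV. c1 i x * S x i j * v1 j x))"
    by (rule set_lebesgue_integral_cong) (use op point in auto)
  finally show ?thesis unfolding M_def S_def by simp
qed

section \<open>Convexity of the domain and Cauchy data on the boundary\<close>

lemma local_defining_function_derivative:
  assumes "local_defining_function \<Omega> p U \<rho>"
  shows "\<And>x. x \<in> U \<Longrightarrow> (\<rho> has_derivative (\<lambda>h. grad \<rho> x \<bullet> h)) (at x)"
    and "\<And>x i. x \<in> U \<Longrightarrow> (partial_deriv i \<rho> has_derivative (\<lambda>h. \<Sum>j\<in>UNIV. partial_deriv j (partial_deriv i \<rho>) x * h $ j)) (at x)"
    and "\<And>i j. continuous_on U (partial_deriv j (partial_deriv i \<rho>))"
proof -
  have C: "Ck_on (Suc m) U \<rho>" for m using assms by (simp add: local_defining_function_def Cinf_on_def)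
  show "(\<rho> has_derivative (\<lambda>h. grad \<rho> x \<bullet> h)) (at x)" if "x \<in> U" for x
    using differentiable_partials[of \<rho> x] C[of 0] that by (simp add: grad_def inner_vec_def)
  show "(partial_deriv i \<rho> has_derivative (\<lambda>h. \<Sum>j\<in>UNIV. partial_deriv j (partial_deriv i \<rho>) x * h $ j)) (at x)" if "x \<in> U" for x i
    using differentiable_partials[of "partial_deriv i \<rho>" x] C[of 1] that by simp
  show "continuous_on U (partial_deriv j (partial_deriv i \<rho>))" for i j
    using C[of "Suc 0"] by simp
qed

lemma defining_function_gradient_has_derivative:
  assumes L: "local_defining_function \<Omega> p U \<rho>" and x: "x \<in> U"
  shows "(grad \<rho> has_derivative (\<lambda>h. hessian \<rho> x *v h)) (at x)"
    and "transpose (hessian \<rho> x) = hessian \<rho> x"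
proof -
  have op: "open U" using L by (simp add: local_defining_function_def)
  note d = local_defining_function_derivative[OF L]
  have d1: "(\<rho> has_derivative (\<lambda>h. \<Sum>i\<in>UNIV. partial_deriv i \<rho> x * h $ i)) (at x)" if "x \<in> U" for x
    using d(1)[OF that] by (simp add: grad_def inner_vec_def)
  have sym: "hessian \<rho> x $ i $ j = hessian \<rho> x $ j $ i" for i j
    using mixed_partials_eq[OF op x d1 d(2) d(3), of j i] by (simp add: hessian_def)
  then show "transpose (hessian \<rho> x) = hessian \<rho> x" by (simp add: transpose_def vec_eq_iff)
  have "((\<lambda>x. \<chi> i. partial_deriv i \<rho> x) has_derivative (\<lambda>h. \<chi> i. \<Sum>j\<in>UNIV. partial_deriv j (partial_deriv i \<rho>) x * h $ j)) (at x)"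
    unfolding has_derivative_componentwise_within[where f="\<lambda>x. \<chi> i. partial_deriv i \<rho> x"]
    by (auto simp: Basis_vec_def inner_axis intro!: d(2)[OF x])
  moreover have "(\<chi> i. \<Sum>j\<in>UNIV. partial_deriv j (partial_deriv i \<rho>) x * h $ j) = hessian \<rho> x *v h" for h
    using sym by (simp add: matrix_vector_mult_def vec_eq_iff hessian_def)
  moreover have "(\<lambda>x. \<chi> i. partial_deriv i \<rho> x) = grad \<rho>" by (auto simp: grad_def fun_eq_iff)
  ultimately show "(grad \<rho> has_derivative (\<lambda>h. hessian \<rho> x *v h)) (at x)" by simp
qed

text \<open>The curvature hypothesis speaks of eigenvectors, while a quadratic form has to be
  estimated. The minimiser of that form on the unit tangent sphere is an eigenvector of the
  derivative of the normal, so the minimum is a principal curvature times the length of the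
  gradient.\<close>

lemma hessian_tangential_positive:
  fixes \<Omega> :: "(real^'n) set"
  assumes uc: "uniformly_convex \<Omega>" and p: "p \<in> frontier \<Omega>" and L: "local_defining_function \<Omega> p U \<rho>"
    and tau: "\<tau> \<noteq> 0" "grad \<rho> p \<bullet> \<tau> = 0"
  shows "\<tau> \<bullet> (hessian \<rho> p *v \<tau>) > 0"
proof -
  let ?g = "grad \<rho> p" and ?H = "hessian \<rho> p"
  have pU: "p \<in> U" and g0: "?g \<noteq> 0" using L by (auto simp: local_defining_function_def)
  note dg = defining_function_gradient_has_derivative(1)[OF L pU]
  have sym: "transpose ?H = ?H" by (rule defining_function_gradient_has_derivative(2)[OF L pU])
  have symH: "x \<bullet> (?H *v y) = y \<bullet> (?H *v x)" for x y
    using dot_lmul_matrix[of x ?H y] sym by (metis inner_commute transpose_matrix_vector)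
  define T where "T = {\<tau>. ?g \<bullet> \<tau> = 0}"
  define S where "S = T \<inter> sphere 0 1"
  have sT: "subspace T" unfolding T_def by (rule subspace_hyperplane)
  define Q where "Q x = x \<bullet> (?H *v x)" for x
  have "compact S" unfolding S_def T_def by (intro closed_Int_compact closed_hyperplane compact_sphere)
  moreover have "\<tau> /\<^sub>R norm \<tau> \<in> S" using tau by (simp add: S_def T_def)
  then have Sne: "S \<noteq> {}" by blast
  moreover have "continuous_on S Q" unfolding Q_def by (intro continuous_intros linear_continuous_on) (simp add: linear_conv_bounded_linear[symmetric])
  ultimately obtain w where w: "w \<in> S" "\<And>y. y \<in> S \<Longrightarrow> Q w \<le> Q y"
    using continuous_attains_inf[of S Q] by blast
  have wT: "?g \<bullet> w = 0" "norm w = 1" using w(1) by (auto simp: S_def T_def)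
  have Qmin: "Q w * (norm y)\<^sup>2 \<le> Q y" if "?g \<bullet> y = 0" for y
  proof (cases "y = 0")
    case False
    then have "y /\<^sub>R norm y \<in> S" using that by (simp add: S_def T_def)
    then have "Q w \<le> Q (y /\<^sub>R norm y)" by (rule w(2))
    also have "\<dots> = Q y / (norm y)\<^sup>2"
      by (simp add: Q_def matrix_vector_mult_scaleR power2_eq_square divide_inverse)
    finally show ?thesis using False by (simp add: le_divide_eq)
  qed (simp add: Q_def)
  text \<open>First-order condition at the minimiser of the Rayleigh quotient.\<close>
  have crit: "y \<bullet> (?H *v w) = Q w * (y \<bullet> w)" if y: "?g \<bullet> y = 0" for y
  proof -
    define a where "a = y \<bullet> (?H *v w) - Q w * (y \<bullet> w)"
    define b where "b = Q y - Q w * (norm y)\<^sup>2"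
    have ineq: "0 \<le> 2 * e * a + e\<^sup>2 * b" for e
    proof -
      have "?g \<bullet> (w + e *\<^sub>R y) = 0" using wT y by (simp add: inner_add_right)
      from Qmin[OF this] have "Q w * (norm (w + e *\<^sub>R y))\<^sup>2 \<le> Q (w + e *\<^sub>R y)" .
      moreover have "(norm (w + e *\<^sub>R y))\<^sup>2 = 1 + 2 * e * (y \<bullet> w) + e\<^sup>2 * (norm y)\<^sup>2"
        using wT(2) unfolding power2_norm_eq_inner norm_eq_1
        by (simp add: inner_add_left inner_add_right inner_commute[of w y] power2_eq_square algebra_simps)
      moreover have "Q (w + e *\<^sub>R y) = Q w + 2 * e * (y \<bullet> (?H *v w)) + e\<^sup>2 * Q y"
        using symH[of w y] by (simp add: Q_def matrix_vector_right_distrib matrix_vector_mult_scaleR inner_add_left inner_add_right power2_eq_square algebra_simps)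
      ultimately show ?thesis by (simp add: a_def b_def algebra_simps)
    qed
    show ?thesis
    proof (rule ccontr)
      assume "\<not> ?thesis"
      then have a0: "a \<noteq> 0" by (simp add: a_def)
      \<comment> \<open>With \<open>c > b\<close>, the step \<open>e = - a / c\<close> makes the
        linear term outweigh the quadratic one.\<close>
      define c where "c = \<bar>b\<bar> + 1"
      have c: "c > 0" "b < c" by (auto simp: c_def)
      have "2 * (- a / c) * a + (- a / c)\<^sup>2 * b = (a\<^sup>2 / c) * (b / c - 2)"
        using c(1) by (simp add: power2_eq_square field_simps)
      moreover have "b / c - 2 < 0" using c by (simp add: divide_less_eq)
      moreover have "a\<^sup>2 / c > 0" using a0 c by simp
      ultimately have "2 * (- a / c) * a + (- a / c)\<^sup>2 * b < 0" by (metis mult_pos_neg)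
      with ineq[of "- a / c"] show False by simp
    qed
  qed
  text \<open>The minimiser is a principal direction.\<close>
  define r where "r x = inverse (norm (grad \<rho> x))" for x
  obtain r' where r': "(r has_derivative r') (at p)"
  proof -
    have "((\<lambda>x. inverse (norm (grad \<rho> x))) has_derivative (\<lambda>h. - (inverse (norm ?g) * (((?H *v h) \<bullet> sgn ?g)) * inverse (norm ?g)))) (at p)"
      by (rule Deriv.has_derivative_inverse[OF _ has_derivative_compose[OF dg has_derivative_norm[OF g0]]]) (use g0 in simp)
    then show ?thesis using that unfolding r_def by blast
  qed
  define N' where "N' h = r p *\<^sub>R (?H *v h) + r' h *\<^sub>R ?g" for h
  have N: "((\<lambda>x. sgn (grad \<rho> x)) has_derivative N') (at p)"
    using has_derivative_scaleR[OF r' dg] unfolding r_def[abs_def] N'_def sgn_div_norm .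
  have unit: "?g \<bullet> N' h = 0" for h
  proof -
    have "((\<lambda>x. sgn (grad \<rho> x) \<bullet> sgn (grad \<rho> x)) has_derivative (\<lambda>h. sgn ?g \<bullet> N' h + N' h \<bullet> sgn ?g)) (at p)"
      by (rule has_derivative_inner[OF N N])
    moreover have "((\<lambda>x. sgn (grad \<rho> x) \<bullet> sgn (grad \<rho> x)) has_derivative (\<lambda>h. 0)) (at p)"
    proof (rule has_derivative_transform_within_open[where f="\<lambda>x. 1"])
      show "open U" "p \<in> U" using L by (auto simp: local_defining_function_def)
      show "1 = sgn (grad \<rho> x) \<bullet> sgn (grad \<rho> x)" if "x \<in> U" for x
      proof -
        have "norm (sgn (grad \<rho> x)) = 1" using L that by (auto simp: local_defining_function_def norm_sgn)
        then show ?thesis by (simp add: dot_square_norm)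
      qed
    qed (rule has_derivative_const)
    ultimately have "(\<lambda>h. sgn ?g \<bullet> N' h + N' h \<bullet> sgn ?g) = (\<lambda>h. 0)" by (rule has_derivative_unique)
    from fun_cong[OF this, of h] have "sgn ?g \<bullet> N' h = 0" by (simp add: inner_commute)
    then show ?thesis using g0 by (simp add: sgn_div_norm)
  qed
  have eig: "N' w = (r p * Q w) *\<^sub>R w"
  proof -
    \<comment> \<open>\<open>z\<close> is tangential, since a unit field has derivative orthogonal
      to itself. Pairing with a tangential vector removes the gradient part of \<open>N'\<close>,
      and the first-order condition gives z \<bullet> z = 0.\<close>
    define z where "z = N' w - (r p * Q w) *\<^sub>R w"
    have gz: "?g \<bullet> z = 0" using unit wT by (simp add: z_def inner_diff_right)
    have "z \<bullet> N' w = r p * (z \<bullet> (?H *v w))" using gz by (simp add: N'_def inner_add_right inner_commute[of z ?g])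
    also have "\<dots> = r p * Q w * (z \<bullet> w)" using crit[OF gz] by simp
    finally have "z \<bullet> z = 0" by (simp add: z_def inner_diff_right)
    then show ?thesis by (simp add: z_def)
  qed
  have "principal_curvature \<Omega> p (r p * Q w)"
    unfolding principal_curvature_def
    by (intro exI[of _ U] exI[of _ \<rho>] exI[of _ N'] conjI L N exI[of _ w] eig)
      (use wT in \<open>auto simp: orthogonal_def inner_commute\<close>)
  then have "r p * Q w > 0" using uc p unfolding uniformly_convex_def by (meson less_le_trans)
  then have "Q w > 0" using g0 by (simp add: r_def zero_less_mult_iff)
  moreover have "Q w * (norm \<tau>)\<^sup>2 \<le> Q \<tau>" by (rule Qmin[OF tau(2)])
  moreover have "(norm \<tau>)\<^sup>2 > 0" using tau(1) by simp
  ultimately show ?thesis unfolding Q_def by (meson less_le_trans mult_pos_pos)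
qed

section \<open>From positive curvature to convexity\<close>

lemma smooth_domain_open: "smooth_domain \<Omega> \<Longrightarrow> open \<Omega>"
  by (simp add: smooth_domain_def)

text \<open>Along the segment the defining function has a maximum, equal to 0, at the contact point.
  The direction is therefore tangential there, and positive curvature makes the second derivative
  positive, which is incompatible with a maximum.\<close>

lemma no_interior_tangency:
  fixes \<Omega> :: "(real^'n) set"
  assumes sd: "smooth_domain \<Omega>" and uc: "uniformly_convex \<Omega>"
    and p: "p = x + s *\<^sub>R \<tau>" "p \<in> frontier \<Omega>" "\<tau> \<noteq> 0" "0 < s" "s < 1"
    and seg: "\<And>r. 0 \<le> r \<Longrightarrow> r \<le> 1 \<Longrightarrow> x + r *\<^sub>R \<tau> \<in> closure \<Omega>"
  shows False
proof -
  obtain U \<rho> where L: "local_defining_function \<Omega> p U \<rho>" using sd p(2) unfolding smooth_domain_def by blast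
  have op: "open U" and pU: "p \<in> U" and inU: "\<Omega> \<inter> U = {x \<in> U. \<rho> x < 0}" and frU: "frontier \<Omega> \<inter> U = {x \<in> U. \<rho> x = 0}"
    using L by (auto simp: local_defining_function_def)
  note d = local_defining_function_derivative(1)[OF L]
  have rp: "\<rho> p = 0" using frU p(2) pU by auto
  have le: "\<rho> y \<le> 0" if "y \<in> closure \<Omega>" "y \<in> U" for y
  proof (cases "y \<in> \<Omega>")
    case True
    then have "y \<in> {x \<in> U. \<rho> x < 0}" using inU that by blast
    then show ?thesis by simp
  next
    case False
    then have "y \<in> frontier \<Omega>" using that smooth_domain_open[OF sd] by (simp add: frontier_def interior_open)
    then have "y \<in> {x \<in> U. \<rho> x = 0}" using frU that by blast
    then show ?thesis by simp
  qed
  define \<phi> where "\<phi> r = \<rho> (p + r *\<^sub>R \<tau>)" for r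
  define \<phi>' where "\<phi>' r = grad \<rho> (p + r *\<^sub>R \<tau>) \<bullet> \<tau>" for r
  obtain e0 where e0: "e0 > 0" "ball p e0 \<subseteq> U" using op pU openE by blast
  define e where "e = min (e0 / norm \<tau>) (min s (1 - s))"
  have e: "e > 0" using e0 p by (simp add: e_def)
  have rU: "p + r *\<^sub>R \<tau> \<in> U" if "\<bar>r\<bar> < e" for r
  proof -
    have "\<bar>r\<bar> * norm \<tau> < e0" using that p(3) by (simp add: e_def less_divide_eq)
    then have "p + r *\<^sub>R \<tau> \<in> ball p e0" by (simp add: dist_norm)
    with e0 show ?thesis by blast
  qed
  have d1: "(\<phi> has_real_derivative \<phi>' r) (at r)" if "\<bar>r\<bar> < e" for r
  proof -
    have "((\<lambda>r. p + r *\<^sub>R \<tau>) has_derivative (\<lambda>h. h *\<^sub>R \<tau>)) (at r)" by (auto intro!: derivative_eq_intros)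
    from has_derivative_compose[OF this d[OF rU[OF that]]]
    show ?thesis unfolding \<phi>_def \<phi>'_def has_field_derivative_def by (simp add: mult.commute[of _ "grad \<rho> _ \<bullet> \<tau>"] mult_commute_abs)
  qed
  have max: "\<phi> r \<le> \<phi> 0" if "\<bar>r\<bar> < e" for r
  proof -
    have "p + r *\<^sub>R \<tau> = x + (s + r) *\<^sub>R \<tau>" by (simp add: p(1) algebra_simps)
    moreover have "0 \<le> s + r" "s + r \<le> 1" using that by (auto simp: e_def)
    ultimately have "p + r *\<^sub>R \<tau> \<in> closure \<Omega>" using seg by simp
    with le rU[OF that] show ?thesis by (simp add: \<phi>_def rp)
  qed
  have z: "\<phi>' 0 = 0"
    by (rule DERIV_local_max[OF d1[of 0] e]) (use max e in auto)
  have "\<tau> \<bullet> (hessian \<rho> p *v \<tau>) > 0"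
    by (rule hessian_tangential_positive[OF uc p(2) L p(3)]) (use z in \<open>simp add: \<phi>'_def\<close>)
  moreover have "(\<phi>' has_real_derivative \<tau> \<bullet> (hessian \<rho> p *v \<tau>)) (at 0)"
  proof -
    have "((\<lambda>r. p + r *\<^sub>R \<tau>) has_derivative (\<lambda>h. h *\<^sub>R \<tau>)) (at 0)" by (auto intro!: derivative_eq_intros)
    moreover have "(grad \<rho> has_derivative (\<lambda>h. hessian \<rho> p *v h)) (at (p + 0 *\<^sub>R \<tau>))"
      using defining_function_gradient_has_derivative(1)[OF L pU] by simp
    ultimately have "((\<lambda>r. grad \<rho> (p + r *\<^sub>R \<tau>)) has_derivative (\<lambda>h. hessian \<rho> p *v (h *\<^sub>R \<tau>))) (at 0)"
      by (rule has_derivative_compose)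
    then have "((\<lambda>r. grad \<rho> (p + r *\<^sub>R \<tau>) \<bullet> \<tau>) has_derivative (\<lambda>h. (hessian \<rho> p *v (h *\<^sub>R \<tau>)) \<bullet> \<tau>)) (at 0)"
      by (rule has_derivative_inner_left)
    then show ?thesis unfolding \<phi>'_def has_field_derivative_def
      by (simp add: matrix_vector_mult_scaleR inner_commute mult_commute_abs)
  qed
  ultimately obtain d where dd: "d > 0" "\<And>h. 0 < h \<Longrightarrow> h < d \<Longrightarrow> \<phi>' 0 < \<phi>' h"
    using DERIV_pos_inc_right[of \<phi>' _ 0] by (metis add_0)
  define h where "h = min d e / 2"
  have h: "0 < h" "h < d" "h < e" using dd(1) e by (auto simp: h_def)
  obtain y where y: "0 < y" "y < h" "\<phi> h - \<phi> 0 = (h - 0) * \<phi>' y"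
    using MVT2[of 0 h \<phi> \<phi>'] d1 h by auto
  then have "h * \<phi>' y > 0" using dd(2)[of y] z h by (intro mult_pos_pos) auto
  then have "\<phi> h > \<phi> 0" using y(3)[unfolded diff_zero] by linarith
  with max[of h] h show False by simp
qed

text \<open>The points visible from \<open>x\<close> form an open and closed part of the connected
  domain. For closedness, a limit of visible segments lies in the closure; a point of it outside the
  domain would be a frontier contact strictly inside the segment.\<close>

lemma uniformly_convex_imp_convex:
  fixes \<Omega> :: "(real^'n) set"
  assumes sd: "smooth_domain \<Omega>" and uc: "uniformly_convex \<Omega>"
  shows "convex \<Omega>"
proof -
  have op: "open \<Omega>" and con: "connected \<Omega>" using sd by (auto simp: smooth_domain_def)
  have "closed_segment x y \<subseteq> \<Omega>" if x: "x \<in> \<Omega>" and y: "y \<in> \<Omega>" for x y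
  proof -
    define A where "A = {y \<in> \<Omega>. closed_segment x y \<subseteq> \<Omega>}"
    have "openin (top_of_set \<Omega>) A"
      unfolding openin_open_eq[OF op]
    proof (intro conjI)
      show "open A" unfolding open_dist
      proof
        fix z assume z: "z \<in> A"
        then have seg: "closed_segment x z \<subseteq> \<Omega>" and zO: "z \<in> \<Omega>" by (auto simp: A_def)
        obtain e where e: "e > 0" "(\<Union>w\<in>closed_segment x z. ball w e) \<subseteq> \<Omega>"
          using compact_subset_open_imp_ball_epsilon_subset[OF compact_segment op seg] by blast
        show "\<exists>e>0. \<forall>w. dist w z < e \<longrightarrow> w \<in> A"
        proof (intro exI[of _ e] conjI allI impI e)
          fix w assume w: "dist w z < e"
          have "closed_segment x w \<subseteq> \<Omega>"
          proof
            fix v assume "v \<in> closed_segment x w"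
            then obtain t where t: "0 \<le> t" "t \<le> 1" "v = (1 - t) *\<^sub>R x + t *\<^sub>R w" by (auto simp: in_segment)
            let ?v = "(1 - t) *\<^sub>R x + t *\<^sub>R z"
            have "?v \<in> closed_segment x z" using t by (auto simp: in_segment)
            moreover have "dist ?v v = t * dist z w"
              using t by (simp add: dist_norm scaleR_diff_right[symmetric])
            then have "v \<in> ball ?v e" using w t mult_left_le_one_le[of "dist z w" t] by (simp add: dist_commute)
            ultimately show "v \<in> \<Omega>" using e(2) by blast
          qed
          then show "w \<in> A" by (auto simp: A_def)
        qed
      qed
    qed (auto simp: A_def)
    moreover have "closedin (top_of_set \<Omega>) A"
      unfolding closedin_limpt
    proof (intro conjI allI impI)
      fix z assume z: "z islimpt A \<and> z \<in> \<Omega>"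
      then obtain f where f: "\<And>n. f n \<in> A" "f \<longlonglongrightarrow> z" unfolding islimpt_sequential by auto
      show "z \<in> A"
      proof (rule ccontr)
        assume "z \<notin> A"
        then obtain v where v: "v \<in> closed_segment x z" "v \<notin> \<Omega>" using z by (auto simp: A_def)
        then obtain s where s: "0 \<le> s" "s \<le> 1" "v = x + s *\<^sub>R (z - x)" by (auto simp: in_segment algebra_simps)
        have cl: "x + r *\<^sub>R (z - x) \<in> closure \<Omega>" if r: "0 \<le> r" "r \<le> 1" for r
        proof -
          have "x + r *\<^sub>R (f n - x) \<in> closed_segment x (f n)" for n
            using r by (auto simp: in_segment algebra_simps)
          then have "x + r *\<^sub>R (f n - x) \<in> \<Omega>" for n using f(1)[of n] by (auto simp: A_def)
          moreover have "(\<lambda>n. x + r *\<^sub>R (f n - x)) \<longlonglongrightarrow> x + r *\<^sub>R (z - x)" by (intro tendsto_intros f)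
          ultimately show ?thesis unfolding closure_sequential
            by (intro exI[of _ "\<lambda>n. x + r *\<^sub>R (f n - x)"]) auto
        qed
        have "v \<in> frontier \<Omega>" using cl[OF s(1,2)] v(2) op by (simp add: s(3) frontier_def interior_open)
        moreover have "s \<noteq> 0" "s \<noteq> 1" "z - x \<noteq> 0" using s v x z by auto
        ultimately show False
          using no_interior_tangency[OF sd uc s(3)] s cl by auto
      qed
    qed (auto simp: A_def)
    moreover have "x \<in> A" using x by (auto simp: A_def)
    ultimately have "A = \<Omega>" using con unfolding connected_clopen by blast
    with y show ?thesis by (auto simp: A_def)
  qed
  then show ?thesis by (simp add: convex_contains_segment)
qed

text \<open>Directions that decrease the defining function enter the domain. Conversely, if some
  domain point lay in an increasing direction, the segment towards it would be inside by convexity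
  and outside by the sign of the defining function.\<close>

lemma supporting_normal:
  fixes \<Omega> :: "(real^'n) set"
  assumes op: "open \<Omega>" and cv: "convex \<Omega>" and p: "p \<in> frontier \<Omega>" and L: "local_defining_function \<Omega> p U \<rho>"
  shows "\<And>v. grad \<rho> p \<bullet> v < 0 \<Longrightarrow> \<exists>\<delta>>0. \<forall>s. 0 < s \<and> s < \<delta> \<longrightarrow> p + s *\<^sub>R v \<in> \<Omega>"
    and "\<And>x. x \<in> \<Omega> \<Longrightarrow> grad \<rho> p \<bullet> (x - p) < 0"
proof -
  have opU: "open U" and pU: "p \<in> U" and inU: "\<Omega> \<inter> U = {x \<in> U. \<rho> x < 0}" and frU: "frontier \<Omega> \<inter> U = {x \<in> U. \<rho> x = 0}"
    and g0: "grad \<rho> p \<noteq> 0"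
    using L by (auto simp: local_defining_function_def)
  have "p \<in> {x \<in> U. \<rho> x = 0}" using frU p pU by blast
  then have rp: "\<rho> p = 0" by simp
  have der: "((\<lambda>s. \<rho> (p + s *\<^sub>R v)) has_real_derivative grad \<rho> p \<bullet> v) (at 0)" for v
    using line_derivative[of \<rho> "\<lambda>i. grad \<rho> p $ i" p 0 v] local_defining_function_derivative(1)[OF L pU]
    by (simp add: inner_vec_def)
  have inside: "\<exists>\<delta>>0. \<forall>s. \<bar>s\<bar> < \<delta> \<longrightarrow> p + s *\<^sub>R v \<in> U" for v
  proof -
    obtain e where e: "e > 0" "ball p e \<subseteq> U" using opU pU openE by blast
    have "p + s *\<^sub>R v \<in> U" if "\<bar>s\<bar> < e / (norm v + 1)" for s
    proof -
      have "\<bar>s\<bar> * norm v \<le> \<bar>s\<bar> * (norm v + 1)" by (simp add: mult_left_mono)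
      also have "\<dots> < e" using that by (simp add: less_divide_eq add_nonneg_pos)
      finally have "p + s *\<^sub>R v \<in> ball p e" by (simp add: dist_norm)
      then show ?thesis using e by blast
    qed
    then show ?thesis using e by (intro exI[of _ "e / (norm v + 1)"]) (auto simp: add_nonneg_pos)
  qed
  show "\<exists>\<delta>>0. \<forall>s. 0 < s \<and> s < \<delta> \<longrightarrow> p + s *\<^sub>R v \<in> \<Omega>" if v: "grad \<rho> p \<bullet> v < 0" for v
  proof -
    obtain d where d: "d > 0" "\<forall>s. \<bar>s\<bar> < d \<longrightarrow> p + s *\<^sub>R v \<in> U" using inside by blast
    obtain d' where d': "d' > 0" "\<And>h. 0 < h \<Longrightarrow> h < d' \<Longrightarrow> \<rho> (p + h *\<^sub>R v) < 0"
      using DERIV_neg_dec_right[OF der v] rp by auto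
    have "p + s *\<^sub>R v \<in> \<Omega>" if "0 < s" "s < min d d'" for s
    proof -
      have "p + s *\<^sub>R v \<in> {x \<in> U. \<rho> x < 0}" using d d' that by auto
      then show ?thesis using inU by blast
    qed
    then show ?thesis using d(1) d'(1) by (intro exI[of _ "min d d'"]) auto
  qed
  have weak: "grad \<rho> p \<bullet> (x - p) \<le> 0" if x: "x \<in> \<Omega>" for x
  proof (rule ccontr)
    assume "\<not> ?thesis"
    then have "0 < grad \<rho> p \<bullet> (x - p)" by simp
    from DERIV_pos_inc_right[OF der this] rp obtain d' where d': "d' > 0" "\<And>h. 0 < h \<Longrightarrow> h < d' \<Longrightarrow> \<rho> (p + h *\<^sub>R (x - p)) > 0" by auto
    obtain d where d: "d > 0" "\<forall>s. \<bar>s\<bar> < d \<longrightarrow> p + s *\<^sub>R (x - p) \<in> U" using inside by blast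
    define s where "s = min (min d d') 1 / 2"
    have s: "0 < s" "s < d" "s < d'" "s < 1" using d(1) d'(1) by (auto simp: s_def)
    have "p \<noteq> x" using p x op by (auto simp: frontier_def interior_open)
    moreover have "p + s *\<^sub>R (x - p) = (1 - (1 - s)) *\<^sub>R x + (1 - s) *\<^sub>R p"
      by (simp add: algebra_simps)
    ultimately have "p + s *\<^sub>R (x - p) \<in> open_segment x p"
      using s unfolding in_segment by (auto intro!: exI[of _ "1 - s"])
    then have "p + s *\<^sub>R (x - p) \<in> \<Omega>"
      using in_interior_closure_convex_segment[OF cv, of x p] x p op by (auto simp: interior_open frontier_def)
    then have "p + s *\<^sub>R (x - p) \<in> {x \<in> U. \<rho> x < 0}" using inU d s by auto
    with d'(2)[of s] s show False by auto
  qed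
  show "grad \<rho> p \<bullet> (x - p) < 0" if x: "x \<in> \<Omega>" for x
  proof -
    \<comment> \<open>Openness makes the weak inequality strict: there is room for a small step
      along the gradient, and the weak inequality still holds after it.\<close>
    obtain e where e: "e > 0" "ball x e \<subseteq> \<Omega>" using op x openE by blast
    let ?y = "x + (e / 2) *\<^sub>R sgn (grad \<rho> p)"
    have "?y \<in> ball x e" using e g0 by (simp add: dist_norm norm_sgn)
    then have "grad \<rho> p \<bullet> (?y - p) \<le> 0" using weak e by blast
    moreover have "grad \<rho> p \<bullet> (?y - p) = grad \<rho> p \<bullet> (x - p) + (e / 2) * (grad \<rho> p \<bullet> sgn (grad \<rho> p))"
      by (simp add: inner_diff_right inner_add_right)
    moreover have "grad \<rho> p \<bullet> sgn (grad \<rho> p) > 0" using g0 by (simp add: sgn_div_norm)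
    ultimately show ?thesis using mult_pos_pos[of "e / 2" "grad \<rho> p \<bullet> sgn (grad \<rho> p)"] e by linarith
  qed
qed

text \<open>Inward directions for one defining function are inward for any other. Two different unit
  vectors cannot have this relation: their difference pairs negatively with one and positively with
  the other.\<close>

lemma outward_unit_normal_eq:
  fixes \<Omega> :: "(real^'n) set"
  assumes op: "open \<Omega>" and cv: "convex \<Omega>" and p: "p \<in> frontier \<Omega>" and L: "local_defining_function \<Omega> p U \<rho>"
  shows "outward_unit_normal \<Omega> p = sgn (grad \<rho> p)"
  unfolding outward_unit_normal_def
proof (rule the_equality)
  show "\<exists>U \<rho>'. local_defining_function \<Omega> p U \<rho>' \<and> sgn (grad \<rho> p) = sgn (grad \<rho>' p)" using L by blast
  fix \<nu> assume "\<exists>U \<rho>. local_defining_function \<Omega> p U \<rho> \<and> \<nu> = sgn (grad \<rho> p)"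
  then obtain U' \<rho>' where L': "local_defining_function \<Omega> p U' \<rho>'" and \<nu>: "\<nu> = sgn (grad \<rho>' p)" by blast
  let ?n = "sgn (grad \<rho> p)"
  have g0: "grad \<rho> p \<noteq> 0" "grad \<rho>' p \<noteq> 0" using L L' by (auto simp: local_defining_function_def)
  have imp: "\<nu> \<bullet> v < 0" if "?n \<bullet> v < 0" for v
  proof -
    have "grad \<rho> p \<bullet> v < 0" using that g0 by (simp add: sgn_div_norm divide_less_0_iff mult_less_0_iff)
    then obtain \<delta> where d: "\<delta> > 0" "\<forall>s. 0 < s \<and> s < \<delta> \<longrightarrow> p + s *\<^sub>R v \<in> \<Omega>" using supporting_normal(1)[OF op cv p L] by blast
    then have "p + (\<delta> / 2) *\<^sub>R v \<in> \<Omega>" by simp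
    from supporting_normal(2)[OF op cv p L' this] d(1) have "grad \<rho>' p \<bullet> v < 0" by (simp add: mult_less_0_iff)
    then show ?thesis using g0 by (simp add: \<nu> sgn_div_norm divide_less_0_iff mult_less_0_iff)
  qed
  show "\<nu> = ?n"
  proof (rule ccontr)
    assume ne: "\<nu> \<noteq> ?n"
    have n1: "?n \<bullet> ?n = 1" "\<nu> \<bullet> \<nu> = 1" using g0 by (auto simp: \<nu> norm_eq_1[symmetric] norm_sgn)
    have "(\<nu> - ?n) \<bullet> (\<nu> - ?n) > 0" using ne by simp
    then have "?n \<bullet> \<nu> < 1" using n1 by (simp add: inner_diff_left inner_diff_right inner_commute)
    then have "?n \<bullet> (\<nu> - ?n) < 0" using n1 by (simp add: inner_diff_right)
    from imp[OF this] have "\<nu> \<bullet> ?n > 1" using n1 by (simp add: inner_diff_right)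
    with \<open>?n \<bullet> \<nu> < 1\<close> show False by (simp add: inner_commute)
  qed
qed

section \<open>Cauchy data on the boundary\<close>

lemma segment_mvt:
  fixes z :: "real^'n \<Rightarrow> real"
  assumes zc: "continuous_on (closure \<Omega>) z"
    and der: "\<And>x. x \<in> \<Omega> \<Longrightarrow> (z has_derivative (\<lambda>h. \<Sum>i\<in>UNIV. G i x * h $ i)) (at x)"
    and t: "t > 0" and cl: "\<And>s. 0 \<le> s \<Longrightarrow> s \<le> t \<Longrightarrow> a + s *\<^sub>R w \<in> closure \<Omega>"
    and inn: "\<And>s. 0 < s \<Longrightarrow> s < t \<Longrightarrow> a + s *\<^sub>R w \<in> \<Omega>"
  shows "\<exists>r. 0 < r \<and> r < t \<and> z (a + t *\<^sub>R w) - z a = t * ((\<chi> i. G i (a + r *\<^sub>R w)) \<bullet> w)"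
proof -
  have D: "((\<lambda>s. z (a + s *\<^sub>R w)) has_real_derivative ((\<chi> i. G i (a + r *\<^sub>R w)) \<bullet> w)) (at r)" if "0 < r" "r < t" for r
    using line_derivative[OF der[OF inn[OF that]]] by (simp add: inner_vec_def)
  have "continuous_on {0..t} (\<lambda>s. z (a + s *\<^sub>R w))"
    by (rule continuous_on_compose2[OF zc]) (use cl in \<open>auto intro!: continuous_intros\<close>)
  moreover have "(\<lambda>s. z (a + s *\<^sub>R w)) differentiable (at s)" if "0 < s" "s < t" for s
    using D[OF that] real_differentiable_def by blast
  ultimately obtain l r where r: "0 < r" "r < t" "((\<lambda>s. z (a + s *\<^sub>R w)) has_real_derivative l) (at r)"
      "z (a + t *\<^sub>R w) - z (a + 0 *\<^sub>R w) = (t - 0) * l"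
    using MVT[of 0 t "\<lambda>s. z (a + s *\<^sub>R w)"] t by auto
  have "l = (\<chi> i. G i (a + r *\<^sub>R w)) \<bullet> w" using DERIV_unique[OF r(3) D[OF r(1,2)]] .
  with r show ?thesis by auto
qed

text \<open>The normal component vanishes by hypothesis. For the rest, start at \<open>p\<close> in
  the direction of the gradient itself, tilted inward by \<open>e\<close>. Such a point is within
  distance \<open>s * e\<close> of the frontier, where \<open>z\<close> vanishes, so |z| is at most
  \<open>K * e * s\<close>. The directional derivative is |H p|^2, hence at most
  \<open>K * e\<close> for every positive \<open>e\<close>.\<close>

lemma boundary_gradient_zero:
  fixes \<Omega> :: "(real^'n) set"
  assumes sd: "smooth_domain \<Omega>" and cv: "convex \<Omega>" and bd: "bounded \<Omega>"
    and zc: "continuous_on (closure \<Omega>) z" and Gc: "\<And>i. continuous_on (closure \<Omega>) (G i)"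
    and der: "\<And>x. x \<in> \<Omega> \<Longrightarrow> (z has_derivative (\<lambda>h. \<Sum>i\<in>UNIV. G i x * h $ i)) (at x)"
    and z0: "\<And>x. x \<in> frontier \<Omega> \<Longrightarrow> z x = 0"
    and p: "p \<in> frontier \<Omega>" and nd: "has_normal_derivative \<Omega> z p 0"
  shows "G i p = 0"
proof -
  have op: "open \<Omega>" using sd by (rule smooth_domain_open)
  obtain U \<rho> where L: "local_defining_function \<Omega> p U \<rho>" using sd p unfolding smooth_domain_def by blast
  define \<nu> where "\<nu> = sgn (grad \<rho> p)"
  have g0: "grad \<rho> p \<noteq> 0" using L by (auto simp: local_defining_function_def)
  have nu: "outward_unit_normal \<Omega> p = \<nu>" unfolding \<nu>_def by (rule outward_unit_normal_eq[OF op cv p L])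
  have nn: "\<nu> \<bullet> \<nu> = 1" using g0 by (simp add: \<nu>_def norm_eq_1[symmetric] norm_sgn)
  have gn: "grad \<rho> p = norm (grad \<rho> p) *\<^sub>R \<nu>" using g0 by (simp add: \<nu>_def sgn_div_norm)
  have gpos: "norm (grad \<rho> p) > 0" using g0 by simp
  have inward: "\<exists>\<delta>>0. \<forall>s. 0 < s \<and> s < \<delta> \<longrightarrow> p + s *\<^sub>R v \<in> \<Omega>" if "\<nu> \<bullet> v < 0" for v
  proof (rule supporting_normal(1)[OF op cv p L])
    show "grad \<rho> p \<bullet> v < 0" by (subst gn) (use that gpos in \<open>simp add: mult_less_0_iff\<close>)
  qed
  have halfspace: "\<nu> \<bullet> (x - p) < 0" if "x \<in> \<Omega>" for x
  proof -
    have "(norm (grad \<rho> p) *\<^sub>R \<nu>) \<bullet> (x - p) < 0" using supporting_normal(2)[OF op cv p L that] gn by simp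
    then show ?thesis using gpos by (simp add: mult_less_0_iff)
  qed
  have pc: "p \<in> closure \<Omega>" using p by (simp add: frontier_def)
  define H where "H x = (\<chi> i. G i x)" for x
  have Hc: "continuous_on (closure \<Omega>) H" unfolding H_def by (intro continuous_on_vec_lambda Gc)
  have "compact (H ` closure \<Omega>)" using Hc bd by (intro compact_continuous_image) (auto simp: compact_closure)
  from compact_imp_bounded[OF this] obtain K where "\<forall>y\<in>H ` closure \<Omega>. norm y \<le> K" unfolding bounded_iff by blast
  then have K: "\<And>x. x \<in> closure \<Omega> \<Longrightarrow> norm (H x) \<le> K" by simp
  then have K0: "K \<ge> 0" using pc norm_ge_zero order_trans by blast
  have quot: "((\<lambda>s. z (p + s *\<^sub>R v) / s) \<longlongrightarrow> H p \<bullet> v) (at_right 0)" if v: "\<nu> \<bullet> v < 0" for v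
  proof -
    obtain \<delta> where d: "\<delta> > 0" "\<forall>s. 0 < s \<and> s < \<delta> \<longrightarrow> p + s *\<^sub>R v \<in> \<Omega>" using inward[OF v] by blast
    have "\<exists>r. 0 < r \<and> r < s \<and> z (p + s *\<^sub>R v) / s = H (p + r *\<^sub>R v) \<bullet> v" if s: "0 < s" "s < \<delta>" for s
    proof -
      have "\<exists>r. 0 < r \<and> r < s \<and> z (p + s *\<^sub>R v) - z p = s * ((\<chi> i. G i (p + r *\<^sub>R v)) \<bullet> v)"
      proof (rule segment_mvt[OF zc der s(1)])
        show "p + r *\<^sub>R v \<in> \<Omega>" if "0 < r" "r < s" for r using d that s by auto
        show "p + r *\<^sub>R v \<in> closure \<Omega>" if "0 \<le> r" "r \<le> s" for r
        proof (cases "r = 0")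
          case False
          then have "p + r *\<^sub>R v \<in> \<Omega>" using d(2) that s by auto
          then show ?thesis using closure_subset by blast
        qed (use pc in simp)
      qed
      then obtain r where "0 < r" "r < s" "z (p + s *\<^sub>R v) = s * (H (p + r *\<^sub>R v) \<bullet> v)" using z0[OF p] by (auto simp: H_def)
      then show ?thesis using s by auto
    qed
    then obtain r where r: "\<And>s. 0 < s \<Longrightarrow> s < \<delta> \<Longrightarrow> 0 < r s \<and> r s < s \<and> z (p + s *\<^sub>R v) / s = H (p + r s *\<^sub>R v) \<bullet> v" by metis
    have ev: "\<forall>\<^sub>F s in at_right 0. 0 < s \<and> s < \<delta>" using d(1) by (auto simp: eventually_at_right_field)
    have rlim: "(r \<longlongrightarrow> 0) (at_right 0)"
    proof (rule tendsto_sandwich[of "\<lambda>_. 0" r "at_right 0" "\<lambda>s. s"])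
      show "\<forall>\<^sub>F s in at_right 0. 0 \<le> r s" using ev by eventually_elim (use r in \<open>auto intro: less_imp_le\<close>)
      show "\<forall>\<^sub>F s in at_right 0. r s \<le> s" using ev by eventually_elim (use r in \<open>auto intro: less_imp_le\<close>)
    qed (auto intro: tendsto_ident_at)
    have "((\<lambda>s. p + r s *\<^sub>R v) \<longlongrightarrow> p + 0 *\<^sub>R v) (at_right 0)" by (intro tendsto_intros rlim)
    then have "((\<lambda>s. H (p + r s *\<^sub>R v)) \<longlongrightarrow> H p) (at_right 0)"
    proof (intro continuous_on_tendsto_compose[OF Hc _ pc])
      show "\<forall>\<^sub>F s in at_right 0. p + r s *\<^sub>R v \<in> closure \<Omega>" using ev
      proof eventually_elim
        case (elim s)
        then have "0 < r s \<and> r s < \<delta>" using r[of s] by auto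
        then show ?case using d(2) closure_subset by blast
      qed
    qed simp
    then have "((\<lambda>s. H (p + r s *\<^sub>R v) \<bullet> v) \<longlongrightarrow> H p \<bullet> v) (at_right 0)" by (intro tendsto_intros)
    then show ?thesis
    proof (rule Lim_transform_eventually)
      show "\<forall>\<^sub>F s in at_right 0. H (p + r s *\<^sub>R v) \<bullet> v = z (p + s *\<^sub>R v) / s"
        using ev by eventually_elim (use r in auto)
    qed
  qed
  have Hn: "H p \<bullet> \<nu> = 0"
  proof -
    have "((\<lambda>s. (z (p + s *\<^sub>R \<nu>) - z (p + 0 *\<^sub>R \<nu>)) / (s - 0)) \<longlongrightarrow> 0) (at_left 0)"
      using nd unfolding has_normal_derivative_def nu has_field_derivative_iff .
    then have "((\<lambda>s. z (p + s *\<^sub>R \<nu>) / s) \<longlongrightarrow> 0) (at_left 0)" using z0[OF p] by simp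
    \<comment> \<open>The normal derivative is a left limit; substituting \<open>- s\<close> turns
      it into a quotient along the inward direction \<open>- \<nu>\<close>.\<close>
    then have "((\<lambda>s. z (p + (- s) *\<^sub>R \<nu>) / (- s)) \<longlongrightarrow> 0) (at_right 0)"
      by (simp only: filterlim_at_left_to_right minus_zero)
    then have "((\<lambda>s. - (z (p + s *\<^sub>R (- \<nu>)) / s)) \<longlongrightarrow> 0) (at_right 0)" by simp
    moreover have "((\<lambda>s. - (z (p + s *\<^sub>R (- \<nu>)) / s)) \<longlongrightarrow> - (H p \<bullet> (- \<nu>))) (at_right 0)"
      by (intro tendsto_intros quot) (simp add: nn)
    ultimately have "- (H p \<bullet> (- \<nu>)) = 0" using tendsto_unique trivial_limit_at_right_real by blast
    then show ?thesis by simp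
  qed
  have bound: "(norm (H p))\<^sup>2 \<le> K * e" if e: "e > 0" for e
  proof -
    define v where "v = H p - e *\<^sub>R \<nu>"
    have v: "\<nu> \<bullet> v < 0" using Hn nn e by (simp add: v_def inner_diff_right inner_commute)
    obtain \<delta> where d: "\<delta> > 0" "\<forall>s. 0 < s \<and> s < \<delta> \<longrightarrow> p + s *\<^sub>R v \<in> \<Omega>" using inward[OF v] by blast
    have small: "\<bar>z (p + s *\<^sub>R v)\<bar> \<le> K * e * s" if s: "0 < s" "s < \<delta>" for s
    proof -
      let ?a = "p + s *\<^sub>R v"
      have a: "?a \<in> \<Omega>" using d s by auto
      \<comment> \<open>Undoing the tilt leads to a point of the supporting hyperplane, which is
        outside the domain; hence the exit within \<open>s * e\<close>.\<close>
      have b: "?a + (s * e) *\<^sub>R \<nu> = p + s *\<^sub>R H p" by (simp add: v_def algebra_simps)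
      have out: "?a + (s * e) *\<^sub>R \<nu> \<notin> \<Omega>"
        using halfspace[of "p + s *\<^sub>R H p"] Hn unfolding b by (auto simp: inner_commute)
      have "s * e > 0" using s e by simp
      from exit_point[OF op cv a out this] obtain t where t: "0 < t" "t \<le> s * e" "?a + t *\<^sub>R \<nu> \<in> frontier \<Omega>" "\<forall>q. 0 \<le> q \<and> q < t \<longrightarrow> ?a + q *\<^sub>R \<nu> \<in> \<Omega>"
        by blast
      have "\<exists>r. 0 < r \<and> r < t \<and> z (?a + t *\<^sub>R \<nu>) - z ?a = t * ((\<chi> i. G i (?a + r *\<^sub>R \<nu>)) \<bullet> \<nu>)"
      proof (rule segment_mvt[OF zc der t(1)])
        show "?a + q *\<^sub>R \<nu> \<in> \<Omega>" if "0 < q" "q < t" for q using t that by auto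
        show "?a + q *\<^sub>R \<nu> \<in> closure \<Omega>" if "0 \<le> q" "q \<le> t" for q
        proof (cases "q = t")
          case True then show ?thesis using t(3) by (simp add: frontier_def)
        next
          case False then show ?thesis using t(4) that closure_subset by (meson order_le_less subsetD)
        qed
      qed
      then obtain r where r: "0 < r" "r < t" "- z ?a = t * (H (?a + r *\<^sub>R \<nu>) \<bullet> \<nu>)" using z0[OF t(3)] by (auto simp: H_def)
      have "?a + r *\<^sub>R \<nu> \<in> closure \<Omega>" using t(4) r closure_subset by (meson less_imp_le subsetD)
      then have "norm (H (?a + r *\<^sub>R \<nu>)) \<le> K" by (rule K)
      moreover have "\<bar>H (?a + r *\<^sub>R \<nu>) \<bullet> \<nu>\<bar> \<le> norm (H (?a + r *\<^sub>R \<nu>)) * norm \<nu>" by (rule Cauchy_Schwarz_ineq2)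
      moreover have "norm \<nu> = 1" using nn by (simp add: norm_eq_1)
      ultimately have "\<bar>H (?a + r *\<^sub>R \<nu>) \<bullet> \<nu>\<bar> \<le> K" by simp
      then have "t * \<bar>H (?a + r *\<^sub>R \<nu>) \<bullet> \<nu>\<bar> \<le> (s * e) * K" using t s e K0 by (intro mult_mono) auto
      moreover have "\<bar>z ?a\<bar> = t * \<bar>H (?a + r *\<^sub>R \<nu>) \<bullet> \<nu>\<bar>" using r(3) t(1) by (metis abs_minus_cancel abs_mult abs_of_pos)
      ultimately show ?thesis by (simp add: mult_ac)
    qed
    have "\<forall>\<^sub>F s in at_right 0. z (p + s *\<^sub>R v) / s \<le> K * e"
    proof -
      have "\<forall>\<^sub>F s in at_right 0. 0 < s \<and> s < \<delta>" using d(1) by (auto simp: eventually_at_right_field)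
      then show ?thesis
      proof eventually_elim
        case (elim s)
        then have "z (p + s *\<^sub>R v) \<le> K * e * s" using small[of s] by linarith
        then show ?case using elim by (simp add: divide_le_eq)
      qed
    qed
    then have "H p \<bullet> v \<le> K * e"
      by (intro tendsto_upperbound[OF quot[OF v]]) auto
    then show ?thesis using Hn by (simp add: v_def inner_diff_right power2_norm_eq_inner)
  qed
  have "(norm (H p))\<^sup>2 \<le> 0"
  proof (rule field_le_epsilon)
    fix e :: real assume e: "e > 0"
    have "(norm (H p))\<^sup>2 \<le> K * (e / (K + 1))" by (rule bound) (use e K0 in simp)
    also have "\<dots> \<le> e" using e K0 by (simp add: field_simps)
    finally show "(norm (H p))\<^sup>2 \<le> 0 + e" by simp
  qed
  then have "H p = 0" by simp
  then show ?thesis by (simp add: H_def vec_eq_iff)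
qed

section \<open>Hausdorff measure on slices\<close>

lemma diameter_image_le:
  fixes f :: "'a::euclidean_space \<Rightarrow> 'a"
  assumes "bounded C" "r \<ge> 0" and lip: "\<And>x y. x \<in> C \<Longrightarrow> y \<in> C \<Longrightarrow> dist (f x) (f y) \<le> r * dist x y"
  shows "diameter (f ` C) \<le> r * diameter C"
proof (cases "C = {}")
  case False
  show ?thesis
  proof (rule diameter_le)
    fix x y assume "x \<in> f ` C" "y \<in> f ` C"
    then obtain a b where ab: "a \<in> C" "b \<in> C" "x = f a" "y = f b" by auto
    have "dist x y \<le> r * dist a b" using lip ab by simp
    also have "\<dots> \<le> r * diameter C"
      using diameter_bounded_bound[OF assms(1) ab(1,2)] assms(2) by (intro mult_left_mono)
    finally show "norm (x - y) \<le> r * diameter C" by (simp add: dist_norm)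
  qed (use False in simp)
qed simp

lemma hausdorff_content_lipschitz:
  fixes f :: "'a::euclidean_space \<Rightarrow> 'a"
  assumes r: "r > 0" and lip: "\<And>x y. dist (f x) (f y) \<le> r * dist x y"
  shows "hausdorff_content q (r * \<delta>) (f ` A) \<le> ennreal (r ^ q) * hausdorff_content q \<delta> A"
proof -
  let ?s = "\<lambda>C::nat \<Rightarrow> 'a set. \<Sum>i. if C i = {} then 0 else ennreal (unit_ball_vol (real q) * (diameter (C i) / 2) ^ q)"
  \<comment> \<open>With the factor on the left the estimate concerns one cover at a time and passes
    directly to the infimum.\<close>
  have step: "ennreal (1 / r ^ q) * hausdorff_content q (r * \<delta>) (f ` A) \<le> ?s C"
    if C: "A \<subseteq> (\<Union>i. C i)" "\<And>i. bounded (C i)" "\<And>i. diameter (C i) \<le> \<delta>" for C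
  proof -
    have b: "bounded (f ` C i)" for i
    proof -
      obtain a e where "\<forall>y\<in>C i. dist a y \<le> e" using C(2)[of i] unfolding bounded_def by blast
      then have "\<forall>y\<in>f ` C i. dist (f a) y \<le> r * e"
        using lip r by (auto intro: order_trans[OF lip] mult_left_mono)
      then show ?thesis unfolding bounded_def by blast
    qed
    have d: "diameter (f ` C i) \<le> r * diameter (C i)" for i
      by (rule diameter_image_le) (use C r lip in auto)
    have "hausdorff_content q (r * \<delta>) (f ` A) \<le> ?s (\<lambda>i. f ` C i)"
      unfolding hausdorff_content_def
    proof (rule INF_lower, intro CollectI conjI allI)
      show "f ` A \<subseteq> (\<Union>i. f ` C i)" using C(1) by blast
      show "diameter (f ` C i) \<le> r * \<delta>" for i
        using order_trans[OF d[of i]] C(3)[of i] r by (simp add: mult_left_mono)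
    qed (rule b)
    also have "\<dots> \<le> (\<Sum>i. ennreal (r ^ q) * (if C i = {} then 0 else ennreal (unit_ball_vol (real q) * (diameter (C i) / 2) ^ q)))"
    proof (intro suminf_le summableI)
      fix i
      have d0: "0 \<le> diameter (f ` C i)" "0 \<le> diameter (C i)" using b C(2) by (auto intro: diameter_ge_0)
      have "(diameter (f ` C i) / 2) ^ q \<le> (r * (diameter (C i) / 2)) ^ q"
        using d[of i] d0 by (intro power_mono) auto
      then have "(diameter (f ` C i) / 2) ^ q \<le> r ^ q * (diameter (C i) / 2) ^ q"
        by (simp only: power_mult_distrib)
      then have "unit_ball_vol (real q) * (diameter (f ` C i) / 2) ^ q \<le> r ^ q * (unit_ball_vol (real q) * (diameter (C i) / 2) ^ q)"
        using mult_left_mono[of _ _ "unit_ball_vol (real q)"] by (simp add: mult.left_commute)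
      then show "(if f ` C i = {} then 0 else ennreal (unit_ball_vol (real q) * (diameter (f ` C i) / 2) ^ q))
         \<le> ennreal (r ^ q) * (if C i = {} then 0 else ennreal (unit_ball_vol (real q) * (diameter (C i) / 2) ^ q))"
        using r by (auto simp: ennreal_mult'[symmetric] intro: ennreal_leI)
    qed
    also have "\<dots> = ennreal (r ^ q) * ?s C" by (rule ennreal_suminf_cmult)
    finally have "ennreal (1 / r ^ q) * hausdorff_content q (r * \<delta>) (f ` A) \<le> ennreal (1 / r ^ q) * (ennreal (r ^ q) * ?s C)"
      by (rule mult_left_mono) simp
    also have "\<dots> = ?s C" using r by (simp add: mult.assoc[symmetric] ennreal_mult'[symmetric])
    finally show ?thesis .
  qed
  have "ennreal (1 / r ^ q) * hausdorff_content q (r * \<delta>) (f ` A) \<le> hausdorff_content q \<delta> A"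
    unfolding hausdorff_content_def[of q \<delta> A] by (rule INF_greatest) (use step in auto)
  then have "ennreal (r ^ q) * (ennreal (1 / r ^ q) * hausdorff_content q (r * \<delta>) (f ` A)) \<le> ennreal (r ^ q) * hausdorff_content q \<delta> A"
    by (rule mult_left_mono) simp
  then show ?thesis using r by (simp add: mult.assoc[symmetric] ennreal_mult'[symmetric])
qed

lemma hausdorff_outer_lipschitz:
  fixes f :: "'a::euclidean_space \<Rightarrow> 'a"
  assumes r: "r > 0" and lip: "\<And>x y. dist (f x) (f y) \<le> r * dist x y"
  shows "hausdorff_outer q (f ` A) \<le> ennreal (r ^ q) * hausdorff_outer q A"
  unfolding hausdorff_outer_def[of q "f ` A"]
proof (rule SUP_least)
  fix \<delta> :: real assume "\<delta> \<in> {0<..}"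
  then have \<delta>: "\<delta> > 0" by simp
  have "hausdorff_content q (r * (\<delta> / r)) (f ` A) \<le> ennreal (r ^ q) * hausdorff_content q (\<delta> / r) A"
    by (rule hausdorff_content_lipschitz[OF r lip])
  also have "\<dots> \<le> ennreal (r ^ q) * hausdorff_outer q A"
    unfolding hausdorff_outer_def using \<delta> r by (intro mult_left_mono SUP_upper) auto
  finally show "hausdorff_content q \<delta> (f ` A) \<le> ennreal (r ^ q) * hausdorff_outer q A" using r by simp
qed

lemma sets_hausdorff_measure [simp, measurable_cong]: "sets (hausdorff_measure q) = sets borel"
proof -
  have "sigma_sets UNIV (sets (borel :: 'a measure)) = sets borel"
    using sets.sigma_sets_eq[of "borel :: 'a measure"] by simp
  then show ?thesis unfolding hausdorff_measure_def by (simp add: sets_measure_of)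
qed

lemma space_hausdorff_measure [simp]: "space (hausdorff_measure q) = UNIV"
  using sets_eq_imp_space_eq[OF sets_hausdorff_measure] by simp

text \<open>
  A \<open>measure_of\<close> whose set function is not a measure is the zero measure, which satisfies the
  rules below as well. Hence countable additivity of the outer measure on Borel sets is not needed.
\<close>
lemma emeasure_hausdorff_measure:
  fixes A :: "'a::euclidean_space set"
  assumes "A \<in> sets borel"
  shows "emeasure (hausdorff_measure q) A =
    (if measure_space UNIV (sets (borel :: 'a measure)) (hausdorff_outer q) then hausdorff_outer q A else 0)"
proof -
  have s: "sigma_sets UNIV (sets (borel :: 'a measure)) = sets borel"
    using sets.sigma_sets_eq[of "borel :: 'a measure"] by simp
  show ?thesis unfolding hausdorff_measure_def using assms by (simp add: emeasure_measure_of_conv s)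
qed

lemma emeasure_hausdorff_le_outer:
  "A \<in> sets borel \<Longrightarrow> emeasure (hausdorff_measure q) A \<le> hausdorff_outer q A"
  by (simp add: emeasure_hausdorff_measure)

lemma emeasure_hausdorff_lipschitz:
  fixes f :: "'a::euclidean_space \<Rightarrow> 'a"
  assumes "r > 0" "\<And>x y. dist (f x) (f y) \<le> r * dist x y" "A \<in> sets borel" "f ` A \<in> sets borel"
  shows "emeasure (hausdorff_measure q) (f ` A) \<le> ennreal (r ^ q) * emeasure (hausdorff_measure q) A"
  using hausdorff_outer_lipschitz[OF assms(1,2)] by (simp add: emeasure_hausdorff_measure assms)

lemma translation_borel:
  fixes A :: "'a::euclidean_space set"
  assumes "A \<in> sets borel"
  shows "(+) c ` A \<in> sets borel"
proof -
  have "(+) c ` A = (\<lambda>x. x - c) -` A \<inter> space borel"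
    by (auto simp: image_iff intro!: bexI[of _ "_ - c"])
  also have "\<dots> \<in> sets borel" by (rule measurable_sets[OF _ assms]) measurable
  finally show ?thesis .
qed

lemma emeasure_hausdorff_translation:
  fixes A :: "'a::euclidean_space set"
  assumes "A \<in> sets borel"
  shows "emeasure (hausdorff_measure q) ((+) c ` A) = emeasure (hausdorff_measure q) A"
proof (rule antisym)
  have le: "emeasure (hausdorff_measure q) ((+) c ` A) \<le> emeasure (hausdorff_measure q) A"
    if "A \<in> sets borel" for A and c :: 'a
    using emeasure_hausdorff_lipschitz[of 1 "(+) c" A q] translation_borel[OF that] that by simp
  then show "emeasure (hausdorff_measure q) ((+) c ` A) \<le> emeasure (hausdorff_measure q) A" using assms .
  have "emeasure (hausdorff_measure q) ((+) (- c) ` (+) c ` A) \<le> emeasure (hausdorff_measure q) ((+) c ` A)"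
    by (intro le translation_borel assms)
  then show "emeasure (hausdorff_measure q) A \<le> emeasure (hausdorff_measure q) ((+) c ` A)"
    by (simp add: image_image)
qed

lemma hausdorff_measure_distr_translation:
  "distr (hausdorff_measure q) borel ((+) c) = (hausdorff_measure q :: 'a::euclidean_space measure)"
proof (rule measure_eqI)
  fix A :: "'a set" assume "A \<in> sets (distr (hausdorff_measure q) borel ((+) c))"
  then have A: "A \<in> sets borel" by simp
  have "(+) c -` A = (+) (- c) ` A" by (auto simp: image_iff intro!: bexI[of _ "c + _"])
  then have "emeasure (hausdorff_measure q) ((+) c -` A) = emeasure (hausdorff_measure q) A"
    using emeasure_hausdorff_translation[OF A, of q "- c"] by (simp only:)
  then show "emeasure (distr (hausdorff_measure q) borel ((+) c)) A = emeasure (hausdorff_measure q) A"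
    using A by (simp add: emeasure_distr)
qed simp

text \<open>Cut a cube containing the ball into N^q cells of diameter at most sqrt(q) * 2R / N. The
  factors of N cancel in the total, so the same constant \<open>K\<close> bounds the content at
  every scale.\<close>

lemma hausdorff_outer_bounded_subspace:
  fixes V :: "'a::euclidean_space set"
  assumes V: "subspace V" and R: "R > 0"
  shows "hausdorff_outer (dim V) (V \<inter> cball 0 R) < \<infinity>"
proof -
  let ?q = "dim V"
  obtain B where B: "B \<subseteq> V" "pairwise orthogonal B" "\<And>x. x \<in> B \<Longrightarrow> norm x = 1" "independent B" "card B = ?q" "span B = V"
    using orthonormal_basis_subspace[OF V] by metis
  have finB: "finite B" using B(4) by (rule independent_imp_finite)
  define K where "K = unit_ball_vol (real ?q) * (sqrt (real ?q) * R) ^ ?q"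
  have content: "hausdorff_content ?q \<delta> (V \<inter> cball 0 R) \<le> ennreal K" if \<delta>: "\<delta> > 0" for \<delta>
  proof -
    obtain N0 :: nat where N0: "real N0 > sqrt (real ?q) * (2 * R) / \<delta>" using reals_Archimedean2 by blast
    define N where "N = Suc N0"
    define \<eta> where "\<eta> = sqrt (real ?q) * (2 * R / real N)"
    have N: "N > 0" by (simp add: N_def)
    have "sqrt (real ?q) * (2 * R) < \<delta> * real N0" using N0 \<delta> by (simp add: pos_divide_less_eq mult.commute)
    also have "\<dots> \<le> \<delta> * real N" using \<delta> by (simp add: N_def)
    finally have \<eta>: "\<eta> \<le> \<delta>" using N by (simp add: \<eta>_def pos_divide_le_eq)
    define cell where "cell m = {v \<in> V. \<forall>b\<in>B. 2 * R * real (m b) / N - R \<le> v \<bullet> b \<and> v \<bullet> b \<le> 2 * R * (real (m b) + 1) / N - R}" for m :: "'a \<Rightarrow> nat"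
    have dist_cell: "norm (v - w) \<le> \<eta>" if "v \<in> cell m" "w \<in> cell m" for v w m
    proof -
      have vw: "v - w \<in> V" using that V by (auto simp: cell_def subspace_diff)
      have "\<bar>(v - w) \<bullet> b\<bar> \<le> 2 * R / N" if "b \<in> B" for b
      proof -
        have "2 * R * (real (m b) + 1) / N = 2 * R * real (m b) / N + 2 * R / N" by (simp add: distrib_left add_divide_distrib)
        moreover have "2 * R * real (m b) / N - R \<le> v \<bullet> b" "v \<bullet> b \<le> 2 * R * (real (m b) + 1) / N - R"
          "2 * R * real (m b) / N - R \<le> w \<bullet> b" "w \<bullet> b \<le> 2 * R * (real (m b) + 1) / N - R"
          using \<open>v \<in> cell m\<close> \<open>w \<in> cell m\<close> that by (auto simp: cell_def)
        ultimately show ?thesis unfolding inner_diff_left by linarith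
      qed
      then have "((v - w) \<bullet> b)\<^sup>2 \<le> (2 * R / N)\<^sup>2" if "b \<in> B" for b
        using that R N by (simp add: abs_le_square_iff[symmetric])
      then have "(\<Sum>b\<in>B. ((v - w) \<bullet> b)\<^sup>2) \<le> (\<Sum>b\<in>B. (2 * R / N)\<^sup>2)" by (rule sum_mono)
      moreover have "(norm (v - w))\<^sup>2 = (\<Sum>b\<in>B. ((v - w) \<bullet> b)\<^sup>2)"
      proof -
        have e: "v - w = (\<Sum>b\<in>B. ((v - w) \<bullet> b) *\<^sub>R b)"
        proof (rule orthonormal_basis_expand[symmetric])
          show "v - w \<in> span B" using vw B(6) by simp
        qed (use B finB in auto)
        have "(norm (\<Sum>b\<in>B. ((v - w) \<bullet> b) *\<^sub>R b))\<^sup>2 = (\<Sum>b\<in>B. (norm (((v - w) \<bullet> b) *\<^sub>R b))\<^sup>2)"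
          by (rule norm_sum_Pythagorean[OF finB]) (use B(2) in \<open>auto simp: pairwise_def orthogonal_def\<close>)
        with e show ?thesis by (simp add: power_mult_distrib B(3))
      qed
      ultimately have "(norm (v - w))\<^sup>2 \<le> real ?q * (2 * R / N)\<^sup>2" using B(5) by simp
      also have "\<dots> = \<eta>\<^sup>2" unfolding \<eta>_def by (subst power_mult_distrib) simp
      finally show ?thesis by (rule power2_le_imp_le) (use R in \<open>simp add: \<eta>_def\<close>)
    qed
    define I where "I = PiE B (\<lambda>_. {..<N})"
    have finI: "finite I" and cI: "card I = N ^ ?q" unfolding I_def using finB B(5) by (auto simp: card_PiE finite_PiE)
    obtain en where en: "bij_betw en {..<card I} I" using ex_bij_betw_nat_finite[OF finI] by (metis atLeast0LessThan)
    define C where "C i = (if i < card I then cell (en i) else {})" for i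
    have bC: "bounded (C i)" for i
    proof (cases "C i = {}")
      case False
      then obtain w where w: "w \<in> C i" by blast
      then have "\<forall>v\<in>C i. dist w v \<le> \<eta>" using dist_cell by (auto simp: C_def dist_norm split: if_splits)
      then show ?thesis unfolding bounded_def by blast
    qed simp
    have e0: "\<eta> \<ge> 0" using R by (simp add: \<eta>_def)
    have dC: "diameter (C i) \<le> \<eta>" for i
      by (rule diameter_le) (use e0 dist_cell in \<open>auto simp: C_def split: if_splits\<close>)
    have cover: "V \<inter> cball 0 R \<subseteq> (\<Union>i. C i)"
    proof
      fix v assume v: "v \<in> V \<inter> cball 0 R"
      have "\<exists>k<N. 2 * R * real k / N - R \<le> v \<bullet> b \<and> v \<bullet> b \<le> 2 * R * (real k + 1) / N - R" if b: "b \<in> B" for b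
      proof -
        have "\<bar>v \<bullet> b\<bar> \<le> norm v * norm b" by (rule Cauchy_Schwarz_ineq2)
        then have vb: "\<bar>v \<bullet> b\<bar> \<le> R" using v B(3)[OF b] by simp
        define x where "x = (v \<bullet> b + R) * N / (2 * R)"
        have vR: "0 \<le> v \<bullet> b + R" "v \<bullet> b + R \<le> 2 * R" using vb by linarith+
        have x: "0 \<le> x" "x \<le> N"
          using vR R mult_right_mono[OF vR(2), of "real N"] by (auto simp: x_def pos_divide_le_eq mult.commute)
        have vx: "v \<bullet> b = 2 * R * x / N - R" using R N by (simp add: x_def field_simps)
        \<comment> \<open>At the right endpoint \<open>x = N\<close> the floor would be out of
          range, so the last cell \<open>N - 1\<close> is taken.\<close>
        obtain k where k: "k < N" "real k \<le> x" "x \<le> real k + 1"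
        proof (cases "x = N")
          case True
          show ?thesis by (rule that[of "N - 1"]) (use N True in auto)
        next
          case False
          have "nat \<lfloor>x\<rfloor> < N" using x False by linarith
          moreover have "real (nat \<lfloor>x\<rfloor>) \<le> x" "x \<le> real (nat \<lfloor>x\<rfloor>) + 1" using x by linarith+
          ultimately show ?thesis by (rule that)
        qed
        have "2 * R * real k / N \<le> 2 * R * x / N" "2 * R * x / N \<le> 2 * R * (real k + 1) / N"
          using k R N by (intro divide_right_mono mult_left_mono; simp)+
        with k show ?thesis unfolding vx by auto
      qed
      then obtain m where m: "\<And>b. b \<in> B \<Longrightarrow> m b < N \<and> 2 * R * real (m b) / N - R \<le> v \<bullet> b \<and> v \<bullet> b \<le> 2 * R * (real (m b) + 1) / N - R" by metis
      have "restrict m B \<in> I" using m by (auto simp: I_def)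
      then obtain i where i: "i < card I" "en i = restrict m B" using en unfolding bij_betw_def by (metis imageE lessThan_iff)
      have "v \<in> cell (restrict m B)" using v m by (auto simp: cell_def)
      then show "v \<in> (\<Union>i. C i)" using i by (auto simp: C_def intro!: exI[of _ i])
    qed
    have "hausdorff_content ?q \<delta> (V \<inter> cball 0 R) \<le> (\<Sum>i. if C i = {} then 0 else ennreal (unit_ball_vol (real ?q) * (diameter (C i) / 2) ^ ?q))"
      unfolding hausdorff_content_def
      by (rule INF_lower) (use cover bC dC \<eta> in \<open>auto intro: order_trans\<close>)
    also have "\<dots> = (\<Sum>i<card I. if C i = {} then 0 else ennreal (unit_ball_vol (real ?q) * (diameter (C i) / 2) ^ ?q))"
      by (rule suminf_finite) (auto simp: C_def)
    also have "\<dots> \<le> (\<Sum>i<card I. ennreal (unit_ball_vol (real ?q) * (\<eta> / 2) ^ ?q))"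
    proof (rule sum_mono)
      fix i
      have "(diameter (C i) / 2) ^ ?q \<le> (\<eta> / 2) ^ ?q" using dC[of i] diameter_ge_0[OF bC[of i]] by (intro power_mono) auto
      then show "(if C i = {} then 0 else ennreal (unit_ball_vol (real ?q) * (diameter (C i) / 2) ^ ?q)) \<le> ennreal (unit_ball_vol (real ?q) * (\<eta> / 2) ^ ?q)"
        by (auto intro!: ennreal_leI mult_left_mono)
    qed
    also have "\<dots> = ennreal (real (card I) * (unit_ball_vol (real ?q) * (\<eta> / 2) ^ ?q))"
      using e0 by (simp add: ennreal_of_nat_eq_real_of_nat ennreal_mult')
    also have "real (card I) * (unit_ball_vol (real ?q) * (\<eta> / 2) ^ ?q) = unit_ball_vol (real ?q) * (real N * (\<eta> / 2)) ^ ?q"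
      by (subst power_mult_distrib) (simp add: cI)
    also have "real N * (\<eta> / 2) = sqrt (real ?q) * R" using N by (simp add: \<eta>_def)
    finally show ?thesis unfolding K_def .
  qed
  have "hausdorff_outer ?q (V \<inter> cball 0 R) \<le> ennreal K"
    unfolding hausdorff_outer_def by (rule SUP_least) (use content in auto)
  also have "\<dots> < \<infinity>" by simp
  finally show ?thesis .
qed

text \<open>Dilate the slice by c > 1 about one of its points: by convexity the image contains both
  the slice and its frontier part. Dilation multiplies the measure by at most c^q, and letting c
  tend to 1 leaves nothing for the frontier part.\<close>

lemma slice_boundary_null:
  fixes \<Omega> :: "'a::euclidean_space set"
  assumes op: "open \<Omega>" and cv: "convex \<Omega>" and sl: "S = \<Omega> \<inter> (+) y ` V" and V: "subspace V"
    and ne: "S \<noteq> {}" and fin: "emeasure (hausdorff_measure q) S < \<infinity>"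
  shows "emeasure (hausdorff_measure q) (frontier \<Omega> \<inter> (+) y ` V) = 0"
proof -
  let ?H = "hausdorff_measure q :: 'a measure"
  let ?F = "frontier \<Omega> \<inter> (+) y ` V"
  obtain a where a: "a \<in> S" using ne by blast
  have clV: "closed ((+) y ` V)" by (intro closed_translation closed_subspace V)
  have Sb: "S \<in> sets borel" unfolding sl using op clV by (intro sets.Int) auto
  have Fb: "?F \<in> sets borel" using clV by (intro sets.Int) auto
  define T where "T c x = a + c *\<^sub>R (x - a)" for c :: real and x
  have Tim: "T c ` S = (\<lambda>x. a + (1 / c) *\<^sub>R (x - a)) -` S \<inter> space borel" if "c > 0" for c
  proof -
    have "x \<in> T c ` S \<longleftrightarrow> a + (1 / c) *\<^sub>R (x - a) \<in> S" for x
    proof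
      assume "x \<in> T c ` S"
      then show "a + (1 / c) *\<^sub>R (x - a) \<in> S" using that by (auto simp: T_def)
    next
      assume "a + (1 / c) *\<^sub>R (x - a) \<in> S"
      moreover have "x = T c (a + (1 / c) *\<^sub>R (x - a))" using that by (simp add: T_def)
      ultimately show "x \<in> T c ` S" by blast
    qed
    then show ?thesis by auto
  qed
  have Tb: "T c ` S \<in> sets borel" if "c > 0" for c
    unfolding Tim[OF that] by (rule measurable_sets[OF _ Sb]) measurable
  have le: "emeasure ?H (T c ` S) \<le> ennreal (c ^ q) * emeasure ?H S" if "c > 0" for c
    by (rule emeasure_hausdorff_lipschitz[OF that _ Sb Tb[OF that]])
      (use that in \<open>simp add: T_def dist_norm scaleR_diff_right[symmetric]\<close>)
  have yV: "x \<in> (+) y ` V \<longleftrightarrow> x - y \<in> V" for x by (auto simp: image_iff intro!: bexI[of _ "x - y"])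
  have inV: "a + r *\<^sub>R (x - a) \<in> (+) y ` V" if "x \<in> (+) y ` V" for x r
  proof -
    have ay: "a - y \<in> V" using a sl yV by auto
    have "x - y \<in> V" using that yV by simp
    then have "(x - y) - (a - y) \<in> V" using ay by (rule subspace_diff[OF V])
    then have "(a - y) + r *\<^sub>R ((x - y) - (a - y)) \<in> V" using ay V by (intro subspace_add subspace_scale)
    then show ?thesis unfolding yV by (simp add: algebra_simps)
  qed
  have sub: "S \<union> ?F \<subseteq> T c ` S" if c: "c > 1" for c
  proof
    fix x assume x: "x \<in> S \<union> ?F"
    have aO: "a \<in> interior \<Omega>" using a sl op by (auto simp: interior_open)
    have xc: "x \<in> closure \<Omega>" using x sl closure_subset by (auto simp: frontier_def)
    have "a + (1 / c) *\<^sub>R (x - a) \<in> \<Omega>"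
    proof (cases "x = a")
      case True then show ?thesis using a sl by simp
    next
      case False
      have "a + (1 / c) *\<^sub>R (x - a) \<in> open_segment a x"
        using False c unfolding in_segment by (auto intro!: exI[of _ "1 / c"] simp: algebra_simps)
      then show ?thesis using in_interior_closure_convex_segment[OF cv aO xc] op by (auto simp: interior_open)
    qed
    moreover have "a + (1 / c) *\<^sub>R (x - a) \<in> (+) y ` V" using x sl by (intro inV) auto
    ultimately have "a + (1 / c) *\<^sub>R (x - a) \<in> S" by (simp add: sl)
    then show "x \<in> T c ` S" using c by (subst Tim) auto
  qed
  have disj: "S \<inter> ?F = {}" using sl op by (auto simp: frontier_def interior_open)
  have sum: "emeasure ?H S + emeasure ?H ?F \<le> ennreal (c ^ q) * emeasure ?H S" if c: "c > 1" for c
  proof -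
    have "emeasure ?H S + emeasure ?H ?F = emeasure ?H (S \<union> ?F)"
      using Sb Fb disj by (intro plus_emeasure) auto
    also have "\<dots> \<le> emeasure ?H (T c ` S)" using sub[OF c] Tb c by (intro emeasure_mono) auto
    also have "\<dots> \<le> ennreal (c ^ q) * emeasure ?H S" using le c by simp
    finally show ?thesis .
  qed
  obtain s where s: "emeasure ?H S = ennreal s" "s \<ge> 0" using fin by (cases "emeasure ?H S") auto
  have "emeasure ?H ?F \<le> emeasure ?H S + emeasure ?H ?F" by (rule add_increasing) simp_all
  also have "\<dots> \<le> ennreal (2 ^ q) * emeasure ?H S" by (rule sum) simp
  also have "\<dots> < \<infinity>" using s by (simp add: ennreal_mult'[symmetric])
  finally have "emeasure ?H ?F < \<infinity>" .
  then obtain f where f: "emeasure ?H ?F = ennreal f" "f \<ge> 0" by (cases "emeasure ?H ?F") auto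
  have "s + f \<le> c ^ q * s" if "c > 1" for c
    using sum[OF that] s f that by (simp add: ennreal_mult'[symmetric] ennreal_plus[symmetric] del: ennreal_plus)
  then have ev: "\<forall>\<^sub>F c in at_right 1. s + f \<le> c ^ q * s"
    by (intro eventually_at_right_less[THEN eventually_mono]) auto
  have "((\<lambda>c. c ^ q * s) \<longlongrightarrow> 1 ^ q * s) (at_right 1)" by (intro tendsto_intros)
  then have "s + f \<le> 1 ^ q * s" using ev by (intro tendsto_lowerbound) auto
  then have "f = 0" using f by simp
  then show ?thesis using f by simp
qed

section \<open>Slicing along the kernel of an orthogonal projection\<close>

lemma integral_positive_on_ball:
  fixes g :: "'a::euclidean_space \<Rightarrow> real"
  assumes g: "integrable lborel g" "\<And>x. g x \<ge> 0" and k: "k > 0" "r > 0" "\<And>x. x \<in> cball a r \<Longrightarrow> g x \<ge> k"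
  shows "(LINT x|lborel. g x) > 0"
proof -
  have "0 < measure lborel (cball a r) * k"
    using k by (simp add: content_cball_pos)
  also have "\<dots> = (LINT x|lborel. indicator (cball a r) x * k)" by simp
  also have "\<dots> \<le> (LINT x|lborel. g x)"
  proof (rule integral_mono)
    show "integrable lborel (\<lambda>x. indicator (cball a r) x * k)"
      using borel_integrable_compact[of "cball a r" "\<lambda>_. k"] by simp
  qed (use g k in \<open>auto simp: indicator_def\<close>)
  finally show ?thesis .
qed

locale orthogonal_splitting =
  fixes pr :: "'a::euclidean_space \<Rightarrow> 'a" and V :: "'a set" and q :: nat
  assumes lin: "linear pr" and idem: "\<And>x. pr (pr x) = pr x" and orth: "\<And>x. pr x \<bullet> (x - pr x) = 0"
    and V: "V = {x. pr x = 0}" and q: "q = dim V"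
begin

lemma subspace_V: "subspace V"
  unfolding V by (auto simp: subspace_def linear_add[OF lin] linear_cmul[OF lin] linear_0[OF lin])

lemma pr_diff_in_V: "x - pr x \<in> V"
  by (simp add: V linear_diff[OF lin] idem)

lemma pr_add_V: "v \<in> V \<Longrightarrow> pr (x + v) = pr x" "v \<in> V \<Longrightarrow> pr (x - v) = pr x"
  by (auto simp: V linear_diff[OF lin] linear_add[OF lin])

lemma norm_pr: "norm (pr x) \<le> norm x" "norm (x - pr x) \<le> norm x"
proof -
  have "x = pr x + (x - pr x)" by simp
  then have "(norm x)\<^sup>2 = (norm (pr x))\<^sup>2 + (norm (x - pr x))\<^sup>2"
    using norm_add_Pythagorean[of "pr x" "x - pr x"] orth[of x] by (simp add: orthogonal_def)
  then have "(norm (pr x))\<^sup>2 \<le> (norm x)\<^sup>2" "(norm (x - pr x))\<^sup>2 \<le> (norm x)\<^sup>2" by simp_all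
  then show "norm (pr x) \<le> norm x" "norm (x - pr x) \<le> norm x"
    by (auto intro: power2_le_imp_le)
qed

lemma continuous_pr [continuous_intros]: "continuous_on S f \<Longrightarrow> continuous_on S (\<lambda>x. pr (f x))"
  by (rule bounded_linear.continuous_on[OF lin[unfolded linear_conv_bounded_linear]])

lemma measurable_pr [measurable]: "pr \<in> borel_measurable borel"
  by (rule borel_measurable_continuous_onI) (intro continuous_intros)

lemma V_closed: "closed V" by (rule closed_subspace[OF subspace_V])

lemma V_borel [measurable]: "V \<in> sets borel" using V_closed by simp

text \<open>The restricted measure still lives on the whole space, so translations by elements of
  \<open>V\<close> and products with \<open>lborel\<close> can be formed without coordinates on
  \<open>V\<close>.\<close>

definition slice_measure :: "'a measure" where
  "slice_measure = density (hausdorff_measure q) (indicator V)"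

lemma sets_slice_measure [simp, measurable_cong]: "sets slice_measure = sets borel"
  by (simp add: slice_measure_def)

lemma space_slice_measure [simp]: "space slice_measure = UNIV"
  by (simp add: slice_measure_def)

lemma emeasure_slice_measure: "A \<in> sets borel \<Longrightarrow> emeasure slice_measure A = emeasure (hausdorff_measure q) (V \<inter> A)"
  unfolding slice_measure_def by (subst emeasure_density) (auto simp: indicator_inter_arith[symmetric])

lemma AE_slice_measure_in_V: "AE v in slice_measure. v \<in> V"
proof -
  have "emeasure slice_measure (- V) = 0" by (subst emeasure_slice_measure) auto
  then have "- V \<in> null_sets slice_measure" by (auto simp: null_sets_def)
  then show ?thesis by (rule AE_I') auto
qed

lemma distr_slice_measure:
  assumes c: "c \<in> V"
  shows "distr slice_measure borel ((+) c) = slice_measure"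
proof (rule measure_eqI)
  fix A assume "A \<in> sets (distr slice_measure borel ((+) c))"
  then have A: "A \<in> sets borel" by simp
  have VA: "V \<inter> (+) c -` A = (+) (- c) ` (V \<inter> A)"
  proof
    show "V \<inter> (+) c -` A \<subseteq> (+) (- c) ` (V \<inter> A)"
    proof
      fix x assume "x \<in> V \<inter> (+) c -` A"
      then have "c + x \<in> V \<inter> A" using c subspace_add[OF subspace_V] by auto
      moreover have "x = - c + (c + x)" by simp
      ultimately show "x \<in> (+) (- c) ` (V \<inter> A)" by (rule rev_image_eqI)
    qed
    show "(+) (- c) ` (V \<inter> A) \<subseteq> V \<inter> (+) c -` A"
      using c subspace_diff[OF subspace_V] by auto
  qed
  have "(+) c -` A \<in> sets borel" using measurable_sets[of "(+) c" borel borel A] A by simp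
  then show "emeasure (distr slice_measure borel ((+) c)) A = emeasure slice_measure A"
    using A emeasure_hausdorff_translation[of "V \<inter> A" q "- c"]
    by (simp add: emeasure_distr emeasure_slice_measure VA del: uminus_add_conv_diff)
qed simp

lemma slice_integral_translation:
  fixes g :: "'a \<Rightarrow> real"
  assumes "c \<in> V" "g \<in> borel_measurable borel"
  shows "(LINT v|slice_measure. g (c + v)) = (LINT v|slice_measure. g v)"
  by (subst (2) distr_slice_measure[OF assms(1), symmetric], subst integral_distr) (use assms in auto)

lemma emeasure_slice_bounded:
  assumes "bounded A" "A \<in> sets borel"
  shows "emeasure slice_measure A < \<infinity>"
proof -
  obtain R where "R > 0" "\<forall>x\<in>A. norm x \<le> R" using assms(1) unfolding bounded_pos by blast
  then have R: "R > 0" "A \<subseteq> cball 0 R" by auto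
  have "emeasure slice_measure A \<le> emeasure slice_measure (cball 0 R)" using R by (intro emeasure_mono) auto
  also have "\<dots> \<le> hausdorff_outer q (V \<inter> cball 0 R)"
    by (subst emeasure_slice_measure) (auto intro!: emeasure_hausdorff_le_outer)
  also have "\<dots> < \<infinity>" unfolding q by (rule hausdorff_outer_bounded_subspace[OF subspace_V R(1)])
  finally show ?thesis .
qed

lemma sigma_finite_slice_measure: "sigma_finite_measure slice_measure"
proof
  show "\<exists>A. countable A \<and> A \<subseteq> sets slice_measure \<and> \<Union> A = space slice_measure \<and> (\<forall>a\<in>A. emeasure slice_measure a \<noteq> \<infinity>)"
  proof (intro exI[of _ "range (\<lambda>n::nat. cball 0 (real n))"] conjI ballI)
    show "\<Union> (range (\<lambda>n::nat. cball (0::'a) (real n))) = space slice_measure"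
      using real_arch_simple[of "norm _"] by (fastforce simp: mem_cball_0)
    fix a :: "'a set" assume "a \<in> range (\<lambda>n::nat. cball 0 (real n))"
    then show "emeasure slice_measure a \<noteq> \<infinity>" using emeasure_slice_bounded[of a] by (auto simp: less_top)
  qed auto
qed

lemma slice_integral_hausdorff:
  fixes G :: "'a \<Rightarrow> real"
  assumes y: "pr y = y" and G: "G \<in> borel_measurable borel"
  shows "set_lebesgue_integral (hausdorff_measure q) ((+) y ` V) G = (LINT v|slice_measure. G (y + v))"
proof -
  have "set_lebesgue_integral (hausdorff_measure q) ((+) y ` V) G
      = (LINT x | distr (hausdorff_measure q) borel ((+) y). indicator ((+) y ` V) x *\<^sub>R G x)"
    by (simp only: set_lebesgue_integral_def hausdorff_measure_distr_translation)
  also have "\<dots> = (LINT x | hausdorff_measure q. indicator ((+) y ` V) (y + x) *\<^sub>R G (y + x))"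
    by (rule integral_distr) (use G in \<open>auto intro!: borel_measurable_times borel_measurable_indicator translation_borel\<close>)
  also have "\<dots> = (LINT x | hausdorff_measure q. indicator V x *\<^sub>R G (y + x))"
    by (intro Bochner_Integration.integral_cong) (auto simp: indicator_def)
  also have "\<dots> = (LINT x | density (hausdorff_measure q) (\<lambda>x. ennreal (indicator V x)). G (y + x))"
    by (rule integral_density[symmetric]) (use G in auto)
  also have "density (hausdorff_measure q) (\<lambda>x. ennreal (indicator V x)) = slice_measure"
    by (simp add: slice_measure_def ennreal_indicator)
  finally show ?thesis .
qed

end

context orthogonal_splitting
begin

text \<open>The zero extension of \<open>F\<close> is discontinuous only on the frontier, whose
  slice through \<open>y0\<close> is null by the dilation argument. Dominated convergence then
  applies to translates. A nonempty slice is required because the dilation needs a centre.\<close>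

lemma slice_integral_continuous:
  fixes F :: "'a \<Rightarrow> real"
  assumes op: "open \<Omega>" and cv: "convex \<Omega>" and bd: "bounded \<Omega>" and Fc: "continuous_on \<Omega> F"
    and C: "\<And>x. x \<in> \<Omega> \<Longrightarrow> \<bar>F x\<bar> \<le> C" and y0: "pr y0 = y0" and ne: "\<Omega> \<inter> (+) y0 ` V \<noteq> {}"
  shows "isCont (\<lambda>y. LINT v|slice_measure. indicator \<Omega> (y + v) * F (y + v)) y0"
proof -
  define G where "G x = indicator \<Omega> x * F x" for x
  have Gm [measurable]: "G \<in> borel_measurable borel"
    using borel_measurable_continuous_on_indicator[OF _ Fc] op by (simp add: G_def[abs_def])
  obtain x0 where "x0 \<in> \<Omega>" using ne by blast
  then have C0: "C \<ge> 0" using C[of x0] by linarith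
  have Gb: "\<bar>G x\<bar> \<le> C" for x using C C0 by (auto simp: G_def indicator_def)
  obtain R where R: "R > 0" "\<And>x. x \<in> \<Omega> \<Longrightarrow> norm x \<le> R" using bd unfolding bounded_pos by blast
  have Gc: "isCont G x" if "x \<notin> frontier \<Omega>" for x
  proof (cases "x \<in> \<Omega>")
    case True
    have "isCont F x" using Fc op True by (simp add: continuous_on_eq_continuous_at)
    moreover have "\<forall>\<^sub>F y in nhds x. G y = F y"
      using eventually_nhds_in_open[OF op True] by eventually_elim (simp add: G_def)
    ultimately show ?thesis using isCont_cong by blast
  next
    case False
    then have "x \<in> - closure \<Omega>" using that op by (auto simp: frontier_def interior_open)
    then have "\<forall>\<^sub>F y in nhds x. y \<in> - closure \<Omega>" by (intro eventually_nhds_in_open) auto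
    then have "\<forall>\<^sub>F y in nhds x. G y = 0"
      by eventually_elim (use closure_subset in \<open>auto simp: G_def indicator_def\<close>)
    then show ?thesis using isCont_cong[of G "\<lambda>_. 0" x] by simp
  qed
  have null: "AE v in slice_measure. y0 + v \<notin> frontier \<Omega>"
  proof -
    have clV: "closed ((+) y0 ` V)" by (intro closed_translation V_closed)
    let ?S = "\<Omega> \<inter> (+) y0 ` V"
    have "?S \<in> sets borel" using op clV by (intro sets.Int) auto
    moreover have b: "(+) (- y0) ` ?S \<in> sets borel" by (rule translation_borel) fact
    ultimately have "emeasure (hausdorff_measure q) ?S = emeasure (hausdorff_measure q) ((+) (- y0) ` ?S)"
      by (simp only: emeasure_hausdorff_translation)
    also have "\<dots> = emeasure slice_measure ((+) (- y0) ` ?S)"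
      by (subst emeasure_slice_measure[OF b]) (auto intro!: arg_cong[where f="emeasure _"])
    also have "\<dots> < \<infinity>" using bd b by (intro emeasure_slice_bounded bounded_translation bounded_subset[OF bd]) auto
    finally have fin: "emeasure (hausdorff_measure q) ?S < \<infinity>" .
    let ?F = "frontier \<Omega> \<inter> (+) y0 ` V"
    have z: "emeasure (hausdorff_measure q) ?F = 0"
      by (rule slice_boundary_null[OF op cv refl subspace_V ne fin])
    have Fb: "?F \<in> sets borel" using clV by (intro sets.Int) auto
    have b': "(+) (- y0) ` ?F \<in> sets borel" by (rule translation_borel[OF Fb])
    have "emeasure slice_measure ((+) (- y0) ` ?F) = emeasure (hausdorff_measure q) ((+) (- y0) ` ?F)"
      by (subst emeasure_slice_measure[OF b']) (auto intro!: arg_cong[where f="emeasure _"])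
    also have "\<dots> = 0" using z emeasure_hausdorff_translation[OF Fb, of q "- y0"] by (simp only:)
    finally have "(+) (- y0) ` ?F \<in> null_sets slice_measure" using b' by (auto simp: null_sets_def)
    then have "AE v in slice_measure. v \<notin> (+) (- y0) ` ?F" by (rule AE_not_in)
    then show ?thesis using AE_slice_measure_in_V
    proof eventually_elim
      case (elim v)
      show ?case
      proof
        assume "y0 + v \<in> frontier \<Omega>"
        then have "y0 + v \<in> ?F" using elim by auto
        then have "- y0 + (y0 + v) \<in> (+) (- y0) ` ?F" by (rule imageI)
        then show False using elim by simp
      qed
    qed
  qed
  have "((\<lambda>y. LINT v|slice_measure. G (y + v)) \<longlongrightarrow> (LINT v|slice_measure. G (y0 + v))) (at y0)"
    unfolding tendsto_at_iff_sequentially o_def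
  proof (intro allI impI)
    fix Y assume Y: "\<forall>i. Y i \<in> UNIV - {y0}" "Y \<longlonglongrightarrow> y0"
    from convergent_imp_bounded[OF Y(2)] obtain M where "\<forall>y\<in>range Y. norm y \<le> M" unfolding bounded_iff by blast
    then have M: "\<And>i. norm (Y i) \<le> M" by simp
    show "(\<lambda>i. LINT v|slice_measure. G (Y i + v)) \<longlonglongrightarrow> (LINT v|slice_measure. G (y0 + v))"
    proof (rule integral_dominated_convergence[where w="\<lambda>v. indicator (cball 0 (R + M)) v *\<^sub>R C"])
      show "integrable slice_measure (\<lambda>v. indicator (cball 0 (R + M)) v *\<^sub>R C)"
        by (rule integrableI_bounded_set_indicator[where B=C]) (use C0 emeasure_slice_bounded in auto)
      show "AE v in slice_measure. (\<lambda>i. G (Y i + v)) \<longlonglongrightarrow> G (y0 + v)"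
        using null
      proof eventually_elim
        case (elim v)
        have "(\<lambda>i. Y i + v) \<longlonglongrightarrow> y0 + v" by (intro tendsto_intros Y)
        with Gc[OF elim] show ?case by (rule isCont_tendsto_compose)
      qed
      show "AE v in slice_measure. norm (G (Y i + v)) \<le> indicator (cball 0 (R + M)) v *\<^sub>R C" for i
      proof (rule AE_I2)
        fix v
        show "norm (G (Y i + v)) \<le> indicator (cball 0 (R + M)) v *\<^sub>R C"
        proof (cases "Y i + v \<in> \<Omega>")
          case True
          have "norm v \<le> norm (Y i + v) + norm (Y i)" using norm_triangle_ineq4[of "Y i + v" "Y i"] by simp
          also have "\<dots> \<le> R + M" using R(2)[OF True] M[of i] by simp
          finally show ?thesis using Gb[of "Y i + v"] by simp
        qed (use C0 in \<open>simp add: G_def\<close>)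
      qed
    qed (use Gm in measurable)
  qed
  then show ?thesis by (simp add: isCont_def G_def)
qed

text \<open>A function of \<open>pr x\<close> alone, supported within \<open>\<delta>\<close> of
  \<open>y0\<close>. The third power of the positive part makes it twice continuously differentiable
  with an explicit Hessian.\<close>

definition bump :: "'a \<Rightarrow> real \<Rightarrow> 'a \<Rightarrow> real" where
  "bump y0 \<delta> x = (max 0 (\<delta>\<^sup>2 - (norm (pr x - y0))\<^sup>2)) ^ 3"

lemma bump_nonneg: "0 \<le> bump y0 \<delta> x"
  by (simp add: bump_def)

lemma bump_le: "bump y0 \<delta> x \<le> (\<delta>\<^sup>2) ^ 3"
  unfolding bump_def by (rule power_mono) auto

lemma bump_support: "\<delta> > 0 \<Longrightarrow> norm (pr x - y0) \<ge> \<delta> \<Longrightarrow> bump y0 \<delta> x = 0"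
  unfolding bump_def using power_mono[of \<delta> "norm (pr x - y0)" 2] by simp

lemma bump_measurable [measurable]: "bump y0 \<delta> \<in> borel_measurable borel"
  unfolding bump_def[abs_def] by measurable

text \<open>
  Both sides integrate \<open>\<Omega>\<close>-data against \<open>lborel\<close> times the slice measure.  Translation invariance
  of the two factors moves the shift from one argument to the other, so no disintegration of
  \<open>lborel\<close> along the slices is needed.
\<close>
lemma slice_integral_exchange:
  fixes G \<psi> \<gamma> :: "'a \<Rightarrow> real"
  assumes G [measurable]: "G \<in> borel_measurable borel" and \<psi> [measurable]: "\<psi> \<in> borel_measurable borel" and \<gamma> [measurable]: "\<gamma> \<in> borel_measurable borel"
    and bounds: "\<And>x. \<bar>G x\<bar> \<le> A" "\<And>x. \<bar>\<psi> x\<bar> \<le> B" "\<And>x. \<bar>\<gamma> x\<bar> \<le> 1"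
    and supp: "\<And>x. norm x > R \<Longrightarrow> G x = 0" "\<And>x. norm (pr x) > R \<Longrightarrow> \<psi> x = 0" "\<And>x. norm x > R \<Longrightarrow> \<gamma> x = 0" and R: "R > 0"
    and \<psi>V: "\<And>x v. v \<in> V \<Longrightarrow> \<psi> (x + v) = \<psi> x"
  shows "(LINT x|lborel. \<psi> x * \<gamma> (x - pr x) * (LINT v|slice_measure. G (pr x + v))) =
    (LINT v|slice_measure. \<gamma> (- v)) * (LINT x|lborel. \<psi> x * G x)"
    and "integrable lborel (\<lambda>x. \<psi> x * \<gamma> (x - pr x) * (LINT v|slice_measure. G (pr x + v)))"
proof -
  interpret sl: sigma_finite_measure slice_measure by (rule sigma_finite_slice_measure)
  interpret both: pair_sigma_finite lborel slice_measure by standard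
  have A0: "A \<ge> 0" "B \<ge> 0" using bounds(1,2)[of 0] by linarith+
  have fin: "emeasure (lborel \<Otimes>\<^sub>M slice_measure) (cball 0 c \<times> cball 0 d) < \<infinity>" for c d
    by (subst sl.emeasure_pair_measure_Times)
      (use emeasure_slice_bounded[of "cball 0 d"] emeasure_lborel_cball_finite[of 0 c] in \<open>auto simp: ennreal_mult_less_top\<close>)
  have bnd3: "\<bar>a * b * c\<bar> \<le> A * B" if "\<bar>a\<bar> \<le> A" "\<bar>b\<bar> \<le> B" "\<bar>c\<bar> \<le> 1" for a b c :: real
  proof -
    have "\<bar>a\<bar> * \<bar>b\<bar> * \<bar>c\<bar> \<le> A * B * 1" using that A0 by (intro mult_mono) auto
    then show ?thesis by (simp add: abs_mult)
  qed
  \<comment> \<open>For \<open>v\<close> in \<open>V\<close>, replacing \<open>x\<close> by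
    \<open>v + x\<close> turns \<open>?h2\<close> into \<open>?h1\<close>. Integrating
    \<open>?h1\<close> over \<open>v\<close> produces the slice integral, while \<open>?h2\<close>
    separates into a product. The cut-off \<open>\<gamma>\<close> confines the first integrand along
    \<open>V\<close>.\<close>
  let ?h1 = "\<lambda>x v. G (x + v) * \<psi> x * \<gamma> (x - pr x)"
  let ?h2 = "\<lambda>x v. G x * \<psi> x * \<gamma> (x - pr x - v)"
  have i1: "integrable (lborel \<Otimes>\<^sub>M slice_measure) (case_prod ?h1)"
  \<comment> \<open>On the support |x| \<le> |pr x| + |x - pr x| \<le> 2 R, and then |v| \<le> |x +
    v| + |x| \<le> 3 R.\<close>
  proof (rule integrableI_bounded_set[where A="cball 0 (2 * R) \<times> cball 0 (3 * R)" and B="A * B"])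
    show "AE z in lborel \<Otimes>\<^sub>M slice_measure. z \<in> cball 0 (2 * R) \<times> cball 0 (3 * R) \<longrightarrow> norm (case_prod ?h1 z) \<le> A * B"
      by (intro AE_I2) (auto intro!: bnd3 bounds)
    show "AE z in lborel \<Otimes>\<^sub>M slice_measure. z \<notin> cball 0 (2 * R) \<times> cball 0 (3 * R) \<longrightarrow> case_prod ?h1 z = 0"
    proof (intro AE_I2 impI)
      fix z :: "'a \<times> 'a" assume z: "z \<notin> cball 0 (2 * R) \<times> cball 0 (3 * R)"
      obtain x v where xv: "z = (x, v)" by (cases z)
      show "case_prod ?h1 z = 0"
      proof (rule ccontr)
        assume "case_prod ?h1 z \<noteq> 0"
        then have "norm (x + v) \<le> R" "norm (pr x) \<le> R" "norm (x - pr x) \<le> R" using supp unfolding xv by (force simp: not_less[symmetric])+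
        moreover have "norm x \<le> norm (pr x) + norm (x - pr x)" using norm_triangle_ineq[of "pr x" "x - pr x"] by simp
        moreover have "norm v \<le> norm (x + v) + norm x" using norm_triangle_ineq4[of "x + v" x] by simp
        ultimately show False using z unfolding xv by auto
      qed
    qed
  qed (use fin in auto)
  have i2: "integrable (lborel \<Otimes>\<^sub>M slice_measure) (case_prod ?h2)"
  proof (rule integrableI_bounded_set[where A="cball 0 R \<times> cball 0 (2 * R)" and B="A * B"])
    show "AE z in lborel \<Otimes>\<^sub>M slice_measure. z \<in> cball 0 R \<times> cball 0 (2 * R) \<longrightarrow> norm (case_prod ?h2 z) \<le> A * B"
      by (intro AE_I2) (auto intro!: bnd3 bounds)
    show "AE z in lborel \<Otimes>\<^sub>M slice_measure. z \<notin> cball 0 R \<times> cball 0 (2 * R) \<longrightarrow> case_prod ?h2 z = 0"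
    proof (intro AE_I2 impI)
      fix z :: "'a \<times> 'a" assume z: "z \<notin> cball 0 R \<times> cball 0 (2 * R)"
      obtain x v where xv: "z = (x, v)" by (cases z)
      show "case_prod ?h2 z = 0"
      proof (rule ccontr)
        assume "case_prod ?h2 z \<noteq> 0"
        then have "norm x \<le> R" "norm (x - pr x - v) \<le> R" using supp unfolding xv by (force simp: not_less[symmetric])+
        moreover have "norm v \<le> norm (x - pr x - v) + norm (x - pr x)" using norm_triangle_ineq4[of "x - pr x" "x - pr x - v"] by simp
        ultimately show False using z norm_pr(2)[of x] unfolding xv by auto
      qed
    qed
  qed (use fin in auto)
  have L: "(LINT v|slice_measure. ?h1 x v) = \<psi> x * \<gamma> (x - pr x) * (LINT v|slice_measure. G (pr x + v))" for x
  proof -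
    have "(LINT v|slice_measure. G (x + v)) = (LINT v|slice_measure. G (pr x + ((x - pr x) + v)))" by simp
    also have "\<dots> = (LINT v|slice_measure. G (pr x + v))"
      by (rule slice_integral_translation[OF pr_diff_in_V, of "\<lambda>v. G (pr x + v)"]) measurable
    finally show ?thesis by (simp add: mult_ac)
  qed
  have Rr: "(LINT v|slice_measure. ?h2 x v) = (LINT v|slice_measure. \<gamma> (- v)) * (\<psi> x * G x)" for x
  proof -
    have "(LINT v|slice_measure. \<gamma> (x - pr x - ((x - pr x) + v))) = (LINT v|slice_measure. \<gamma> (x - pr x - v))"
      by (rule slice_integral_translation[OF pr_diff_in_V, of "\<lambda>v. \<gamma> (x - pr x - v)"]) measurable
    then show ?thesis by (simp add: mult_ac)
  qed
  have "(LINT x|lborel. \<psi> x * \<gamma> (x - pr x) * (LINT v|slice_measure. G (pr x + v))) = (LINT x|lborel. LINT v|slice_measure. ?h1 x v)"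
    by (simp only: L)
  also have "\<dots> = (LINT v|slice_measure. LINT x|lborel. ?h1 x v)" by (rule both.Fubini_integral[OF i1, symmetric])
  also have "\<dots> = (LINT v|slice_measure. LINT x|lborel. ?h2 x v)"
  proof (rule integral_cong_AE)
    show "(\<lambda>v. LINT x|lborel. ?h1 x v) \<in> borel_measurable slice_measure"
      "(\<lambda>v. LINT x|lborel. ?h2 x v) \<in> borel_measurable slice_measure" by measurable
    show "AE v in slice_measure. (LINT x|lborel. ?h1 x v) = (LINT x|lborel. ?h2 x v)"
      using AE_slice_measure_in_V
    proof eventually_elim
      case (elim v)
      have e: "?h2 (v + x) v = ?h1 x v" for x
        using pr_add_V(1)[OF elim, of x] \<psi>V[OF elim, of x] by (simp add: add.commute algebra_simps)
      have "(LINT x|lborel. ?h2 x v) = (LINT x|distr lborel borel ((+) v). ?h2 x v)" by (simp only: lborel_distr_plus)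
      also have "\<dots> = (LINT x|lborel. ?h2 (v + x) v)" by (rule integral_distr) measurable
      finally show ?case by (simp only: e)
    qed
  qed
  also have "\<dots> = (LINT x|lborel. LINT v|slice_measure. ?h2 x v)" by (rule both.Fubini_integral[OF i2])
  also have "\<dots> = (LINT v|slice_measure. \<gamma> (- v)) * (LINT x|lborel. \<psi> x * G x)" by (simp only: Rr) (rule integral_mult_right_zero)
  finally show "(LINT x|lborel. \<psi> x * \<gamma> (x - pr x) * (LINT v|slice_measure. G (pr x + v))) =
    (LINT v|slice_measure. \<gamma> (- v)) * (LINT x|lborel. \<psi> x * G x)" .
  show "integrable lborel (\<lambda>x. \<psi> x * \<gamma> (x - pr x) * (LINT v|slice_measure. G (pr x + v)))"
    using both.integrable_fst[OF i1] by (simp only: L)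
qed

text \<open>A nonzero slice integral at \<open>y0\<close> keeps its sign near \<open>y0\<close> by
  continuity. With a bump supported there, the exchange formula equates a multiple of the
  hypothesised zero integral with an integral of constant sign that is nonzero on a ball.\<close>

theorem slice_integral_zero:
  fixes F :: "'a \<Rightarrow> real"
  assumes op: "open \<Omega>" and cv: "convex \<Omega>" and bd: "bounded \<Omega>" and Fc: "continuous_on \<Omega> F"
    and C: "\<And>x. x \<in> \<Omega> \<Longrightarrow> \<bar>F x\<bar> \<le> C" and y0: "pr y0 = y0"
    and hyp: "\<And>\<delta>. \<delta> > 0 \<Longrightarrow> set_lebesgue_integral lborel \<Omega> (\<lambda>x. bump y0 \<delta> x * F x) = 0"
  shows "set_lebesgue_integral (hausdorff_measure q) (\<Omega> \<inter> (+) y0 ` V) F = 0"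
proof (cases "\<Omega> \<inter> (+) y0 ` V = {}")
  case True
  then show ?thesis by (simp add: set_lebesgue_integral_def)
next
  case ne: False
  define G where "G x = indicator \<Omega> x * F x" for x
  have Gm [measurable]: "G \<in> borel_measurable borel"
    using borel_measurable_continuous_on_indicator[OF _ Fc] op by (simp add: G_def[abs_def])
  define J where "J y = (LINT v|slice_measure. G (y + v))" for y
  have J: "set_lebesgue_integral (hausdorff_measure q) (\<Omega> \<inter> (+) y0 ` V) F = J y0"
  proof -
    have "set_lebesgue_integral (hausdorff_measure q) (\<Omega> \<inter> (+) y0 ` V) F = set_lebesgue_integral (hausdorff_measure q) ((+) y0 ` V) G"
      unfolding set_lebesgue_integral_def G_def by (intro Bochner_Integration.integral_cong) (auto simp: indicator_def)
    then show ?thesis using slice_integral_hausdorff[OF y0 Gm] by (simp only: J_def)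
  qed
  have Jc: "isCont J y0"
    using slice_integral_continuous[OF op cv bd Fc C y0 ne] by (simp add: J_def[abs_def] G_def)
  obtain x0 where "x0 \<in> \<Omega>" using ne by blast
  then have C0: "C \<ge> 0" using C[of x0] by linarith
  obtain R1 where R1: "R1 > 0" "\<And>x. x \<in> \<Omega> \<Longrightarrow> norm x \<le> R1" using bd unfolding bounded_pos by blast
  have "J y0 = 0"
  proof (rule ccontr)
    assume J0: "J y0 \<noteq> 0"
    define s where "s = sgn (J y0)"
    define c where "c = \<bar>J y0\<bar> / 2"
    have c: "c > 0" using J0 by (simp add: c_def)
    obtain \<delta> where \<delta>: "\<delta> > 0" "\<And>y. dist y y0 < \<delta> \<Longrightarrow> dist (J y) (J y0) < c"
      using Jc c unfolding continuous_at_eps_delta by metis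
    have Js: "s * J y \<ge> c" if "dist y y0 < \<delta>" for y
    proof -
      have "\<bar>J y - J y0\<bar> < c" using \<delta>(2)[OF that] by (simp add: dist_real_def)
      then show ?thesis using J0 unfolding s_def c_def by (auto simp: sgn_if abs_if split: if_splits)
    qed
    define \<gamma> where "\<gamma> = (indicator (cball 0 1) :: 'a \<Rightarrow> real)"
    \<comment> \<open>One radius for the domain, the unit ball of \<open>\<gamma>\<close> and the
      projected support of the bump.\<close>
    define R where "R = max (max R1 1) (norm y0 + \<delta>)"
    have supp: "bump y0 \<delta> x = 0" if "norm (pr x) > R" for x
    proof (rule bump_support[OF \<delta>(1)])
      have "norm (pr x) \<le> norm (pr x - y0) + norm y0" using norm_triangle_ineq[of "pr x - y0" y0] by simp
      then show "\<delta> \<le> norm (pr x - y0)" using that by (simp add: R_def)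
    qed
    have \<gamma>m: "\<gamma> \<in> borel_measurable borel" unfolding \<gamma>_def by (rule borel_measurable_indicator) simp
    have b: "\<bar>G x\<bar> \<le> C" "\<bar>bump y0 \<delta> x\<bar> \<le> (\<delta>\<^sup>2) ^ 3" "\<bar>\<gamma> x\<bar> \<le> 1" for x
      using C C0 bump_le bump_nonneg by (auto simp: G_def \<gamma>_def indicator_def)
    have u: "norm x > R \<Longrightarrow> G x = 0" "norm x > R \<Longrightarrow> \<gamma> x = 0" for x
      using R1(2)[of x] by (auto simp: G_def \<gamma>_def indicator_def R_def)
    have R0: "R > 0" using R1 by (simp add: R_def)
    have bV: "bump y0 \<delta> (x + v) = bump y0 \<delta> x" if "v \<in> V" for x v
      using that by (simp add: bump_def pr_add_V)
    note ex = slice_integral_exchange(1)[OF Gm bump_measurable \<gamma>m b u(1) supp u(2) R0 bV]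
    note int = slice_integral_exchange(2)[OF Gm bump_measurable \<gamma>m b u(1) supp u(2) R0 bV]
    have "(LINT x|lborel. bump y0 \<delta> x * G x) = 0"
      using hyp[OF \<delta>(1)] by (simp add: set_lebesgue_integral_def G_def mult.left_commute)
    then have zero: "(LINT x|lborel. s * (bump y0 \<delta> x * \<gamma> (x - pr x) * J (pr x))) = 0"
      using ex by (simp add: J_def)
    have int': "integrable lborel (\<lambda>x. s * (bump y0 \<delta> x * \<gamma> (x - pr x) * J (pr x)))"
      using int by (simp add: J_def)
    have g0: "0 \<le> \<gamma> x" for x by (simp add: \<gamma>_def)
    have low: "s * (bump y0 \<delta> x * \<gamma> (x - pr x) * J (pr x)) \<ge> bump y0 \<delta> x * \<gamma> (x - pr x) * c" for x
    proof (cases "dist (pr x) y0 < \<delta>")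
      case True
      have "bump y0 \<delta> x * \<gamma> (x - pr x) * c \<le> bump y0 \<delta> x * \<gamma> (x - pr x) * (s * J (pr x))"
        using Js[OF True] g0 bump_nonneg by (intro mult_left_mono) auto
      then show ?thesis by (simp add: mult_ac)
    next
      case False
      then have "bump y0 \<delta> x = 0" by (intro bump_support \<delta>) (simp add: dist_norm)
      then show ?thesis by simp
    qed
    have "(LINT x|lborel. s * (bump y0 \<delta> x * \<gamma> (x - pr x) * J (pr x))) > 0"
    \<comment> \<open>On this ball |pr x - y0| \<le> \<delta>/2, so the bump is at least the cube of
      (3/4) \<delta>^2; the cut-off equals 1 because the radius is at most 1; and the signed slice
      integral is at least \<open>c\<close>.\<close>
    proof (rule integral_positive_on_ball[OF int', where a=y0 and r="min (\<delta> / 2) 1" and k="(\<delta>\<^sup>2 * (3 / 4)) ^ 3 * c"])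
      show "0 \<le> s * (bump y0 \<delta> x * \<gamma> (x - pr x) * J (pr x))" for x
        using c g0 bump_nonneg by (intro order_trans[OF _ low]) auto
      let ?r = "min (\<delta> / 2) 1"
      show "?r > 0" using \<delta> by simp
      show "(\<delta>\<^sup>2 * (3 / 4)) ^ 3 * c > 0" using \<delta> c by simp
      fix x assume x: "x \<in> cball y0 ?r"
      then have n: "norm (x - y0) \<le> \<delta> / 2" "norm (x - y0) \<le> 1" by (auto simp: dist_norm norm_minus_commute)
      have p: "pr (x - y0) = pr x - y0" using y0 by (simp add: linear_diff[OF lin])
      have 1: "norm (pr x - y0) \<le> \<delta> / 2" using norm_pr(1)[of "x - y0"] n p by simp
      have 2: "norm (x - pr x) \<le> 1" using norm_pr(2)[of "x - y0"] n p by simp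
      have "(norm (pr x - y0))\<^sup>2 \<le> (\<delta> / 2)\<^sup>2" by (rule power_mono[OF 1]) simp
      then have "\<delta>\<^sup>2 * (3 / 4) \<le> \<delta>\<^sup>2 - (norm (pr x - y0))\<^sup>2" by (simp add: power_divide)
      then have "\<delta>\<^sup>2 * (3 / 4) \<le> max 0 (\<delta>\<^sup>2 - (norm (pr x - y0))\<^sup>2)"
        by (rule order_trans) (rule max.cobounded2)
      then have "(\<delta>\<^sup>2 * (3 / 4)) ^ 3 \<le> bump y0 \<delta> x" unfolding bump_def by (rule power_mono) simp
      moreover have "\<gamma> (x - pr x) = 1" using 2 by (simp add: \<gamma>_def)
      ultimately have "(\<delta>\<^sup>2 * (3 / 4)) ^ 3 * c \<le> bump y0 \<delta> x * \<gamma> (x - pr x) * c" using c by (simp add: mult_right_mono)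
      then show "(\<delta>\<^sup>2 * (3 / 4)) ^ 3 * c \<le> s * (bump y0 \<delta> x * \<gamma> (x - pr x) * J (pr x))" using low order_trans by blast
    qed
    then show False unfolding zero by simp
  qed
  with J show ?thesis by simp
qed

end

section \<open>Comparison with the quadratic boundary data\<close>

lemma projection_matrix:
  fixes E :: "(real^'n) set"
  assumes E: "subspace E"
  obtains P :: "real^'n^'n" where "transpose P = P" "P ** P = P" "(\<Sum>i\<in>UNIV. P $ i $ i) = real (dim E)"
    "\<And>x. orth_proj E x = P *v x" "\<And>x. x \<in> E \<Longrightarrow> P *v x = x" "orthogonal_comp E = {x. P *v x = 0}"
proof -
  obtain B where B: "B \<subseteq> E" "pairwise orthogonal B" "\<And>x. x \<in> B \<Longrightarrow> norm x = 1" "independent B" "card B = dim E" "span B = E"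
    using orthonormal_basis_subspace[OF E] by metis
  have finB: "finite B" using B(4) by (rule independent_imp_finite)
  define P :: "real^'n^'n" where "P = (\<chi> i j. \<Sum>b\<in>B. b $ i * b $ j)"
  have Pv: "P *v x = (\<Sum>b\<in>B. (b \<bullet> x) *\<^sub>R b)" for x
  proof -
    have "(P *v x) $ i = (\<Sum>b\<in>B. (b \<bullet> x) *\<^sub>R b) $ i" for i
    proof -
      have "(P *v x) $ i = (\<Sum>j\<in>UNIV. \<Sum>b\<in>B. b $ i * b $ j * x $ j)"
        by (simp add: P_def matrix_vector_mult_def sum_distrib_right)
      also have "\<dots> = (\<Sum>b\<in>B. \<Sum>j\<in>UNIV. b $ i * b $ j * x $ j)" by (rule sum.swap)
      also have "\<dots> = (\<Sum>b\<in>B. (b \<bullet> x) * b $ i)"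
        by (simp add: inner_vec_def sum_distrib_left sum_distrib_right mult_ac)
      finally show ?thesis by simp
    qed
    then show ?thesis by (simp add: vec_eq_iff)
  qed
  have inE: "P *v x \<in> E" for x
    unfolding Pv using B(1) E by (auto intro!: subspace_sum subspace_scale)
  have fix_E: "P *v x = x" if "x \<in> E" for x
  proof -
    have "(\<Sum>b\<in>B. (x \<bullet> b) *\<^sub>R b) = x"
      by (rule orthonormal_basis_expand) (use that B finB in auto)
    then show ?thesis by (simp add: Pv inner_commute)
  qed
  have sym: "transpose P = P" by (simp add: P_def transpose_def vec_eq_iff mult.commute)
  have symP: "(P *v x) \<bullet> y = x \<bullet> (P *v y)" for x y
    using dot_lmul_matrix[of x P y] sym by (metis transpose_matrix_vector)
  show thesis
  proof (rule that)
    show "transpose P = P" by (rule sym)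
    show "P ** P = P"
      by (simp add: matrix_eq matrix_vector_mul_assoc[symmetric] fix_E[OF inE])
    have "(\<Sum>i\<in>UNIV. P $ i $ i) = (\<Sum>b\<in>B. \<Sum>i\<in>UNIV. b $ i * b $ i)"
      unfolding P_def by (simp add: sum.swap[of _ UNIV B])
    also have "\<dots> = (\<Sum>b\<in>B. 1)"
    proof (intro sum.cong refl)
      fix b assume "b \<in> B"
      then have "b \<bullet> b = 1" using B(3) by (simp add: norm_eq_1)
      then show "(\<Sum>i\<in>UNIV. b $ i * b $ i) = 1" by (simp add: inner_vec_def)
    qed
    finally show "(\<Sum>i\<in>UNIV. P $ i $ i) = real (dim E)" using B(5) by simp
    show "P *v x = x" if "x \<in> E" for x using fix_E[OF that] .
    have orth: "(x - P *v x) \<bullet> z = 0" if "z \<in> E" for x z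
      using symP[of x z] fix_E[OF that] by (simp add: inner_diff_left)
    show "orth_proj E x = P *v x" for x
      unfolding orth_proj_def
    proof (rule the_equality)
      show "P *v x \<in> E \<and> (\<forall>z\<in>E. orthogonal (x - P *v x) z)" using inE orth by (simp add: orthogonal_def)
      fix y assume y: "y \<in> E \<and> (\<forall>z\<in>E. orthogonal (x - y) z)"
      have d: "y - P *v x \<in> E" using y inE E by (simp add: subspace_diff)
      have "(x - y) \<bullet> (y - P *v x) = 0" "(x - P *v x) \<bullet> (y - P *v x) = 0"
        using y d orth by (auto simp: orthogonal_def)
      then have "(y - P *v x) \<bullet> (y - P *v x) = 0" by (simp add: inner_diff_left)
      then show "y = P *v x" by simp
    qed
    show "orthogonal_comp E = {x. P *v x = 0}"
    proof
      show "orthogonal_comp E \<subseteq> {x. P *v x = 0}"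
        using B(1) by (auto simp: orthogonal_comp_def orthogonal_def Pv intro!: sum.neutral)
      show "{x. P *v x = 0} \<subseteq> orthogonal_comp E"
      proof
        fix x assume "x \<in> {x. P *v x = 0}"
        then have "x \<bullet> z = 0" if "z \<in> E" for z using orth[OF that, of x] by simp
        then show "x \<in> orthogonal_comp E" by (auto simp: orthogonal_comp_def orthogonal_def inner_commute)
      qed
    qed
  qed
qed

lemma dim_orthogonal_comp:
  fixes E :: "(real^'n) set"
  assumes "subspace E"
  shows "dim (orthogonal_comp E) + dim E = CARD('n)"
  using dim_subspace_orthogonal_to_vectors[OF assms subspace_UNIV subset_UNIV]
  by (simp add: orthogonal_comp_def orthogonal_commute)

lemma jet2_lincomb:
  assumes "jet2 \<Omega> f f1 f2" "jet2 \<Omega> g g1 g2"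
  shows "jet2 \<Omega> (\<lambda>x. a * f x + b * g x) (\<lambda>i x. a * f1 i x + b * g1 i x) (\<lambda>i j x. a * f2 i j x + b * g2 i j x)"
proof -
  have der: "((\<lambda>x. a * F x + b * G x) has_derivative (\<lambda>h. \<Sum>i\<in>UNIV. (a * F' i + b * G' i) * h $ i)) (at x)"
    if "(F has_derivative (\<lambda>h. \<Sum>i\<in>UNIV. F' i * h $ i)) (at x)" "(G has_derivative (\<lambda>h. \<Sum>i\<in>UNIV. G' i * h $ i)) (at x)"
    for F G F' G' and x :: "real^'a"
  proof -
    have "((\<lambda>x. a * F x + b * G x) has_derivative (\<lambda>h. a * (\<Sum>i\<in>UNIV. F' i * h $ i) + b * (\<Sum>i\<in>UNIV. G' i * h $ i))) (at x)"
      by (intro has_derivative_add has_derivative_mult_right that)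
    then show ?thesis by (simp add: sum_distrib_left sum.distrib algebra_simps)
  qed
  show ?thesis unfolding jet2_def
    using jet2D[OF assms(1)] jet2D[OF assms(2)] by (auto intro!: continuous_intros der)
qed

lemma jet3_lincomb:
  assumes "jet3 \<Omega> f f1 f2 f3" "jet3 \<Omega> g g1 g2 g3"
  shows "jet3 \<Omega> (\<lambda>x. a * f x + b * g x) (\<lambda>i x. a * f1 i x + b * g1 i x) (\<lambda>i j x. a * f2 i j x + b * g2 i j x)
    (\<lambda>i j k x. a * f3 i j k x + b * g3 i j k x)"
  using assms jet2_lincomb unfolding jet3_def by blast

lemma jet2_const: "jet2 \<Omega> (\<lambda>x. c) (\<lambda>i x. 0) (\<lambda>i j x. 0)"
  by (simp add: jet2_def)

lemma matrix_vector_component_derivative: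
  fixes P :: "real^'n^'m"
  shows "((\<lambda>x. (P *v x) $ i) has_derivative (\<lambda>h. \<Sum>j\<in>UNIV. P $ i $ j * h $ j)) (at x)"
proof -
  have "((\<lambda>x. \<Sum>j\<in>UNIV. P $ i $ j * x $ j) has_derivative (\<lambda>h. \<Sum>j\<in>UNIV. P $ i $ j * h $ j)) (at x)"
    by (auto intro!: has_derivative_sum has_derivative_mult_right bounded_linear_imp_has_derivative[OF bounded_linear_vec_nth])
  then show ?thesis by (simp add: matrix_vector_mult_def)
qed

lemma symmetric_entry: "transpose P = P \<Longrightarrow> P $ i $ j = P $ j $ i"
  by (drule arg_cong[where f="\<lambda>B. B $ j $ i"]) (simp add: transpose_def)

lemma quadratic_form_derivative:
  fixes P :: "real^'n^'n"
  assumes sym: "transpose P = P"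
  shows "((\<lambda>x. x \<bullet> (P *v x)) has_derivative (\<lambda>h. \<Sum>i\<in>UNIV. 2 * (P *v x) $ i * h $ i)) (at x)"
proof -
  have "((\<lambda>x. P *v x) has_derivative (\<lambda>h. P *v h)) (at x)"
    by (rule bounded_linear_imp_has_derivative) (simp add: linear_conv_bounded_linear[symmetric])
  from has_derivative_inner[OF has_derivative_ident this]
  have "((\<lambda>x. x \<bullet> (P *v x)) has_derivative (\<lambda>h. x \<bullet> (P *v h) + h \<bullet> (P *v x))) (at x)" .
  moreover have "x \<bullet> (P *v h) = h \<bullet> (P *v x)" for h
    using dot_lmul_matrix[of x P h] sym by (metis inner_commute transpose_matrix_vector)
  ultimately show ?thesis by (simp add: inner_vec_def sum_distrib_left mult_ac flip: mult_2)
qed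

text \<open>The constant \<open>c\<close> lets one lemma serve \<open>phi\<close>, with
  \<open>c = 0\<close>, and the barrier (|x|^2 - R^2)/2 of the lower comparison.\<close>

lemma jet3_quadratic_form:
  fixes P :: "real^'n^'n"
  assumes sym: "transpose P = P"
  shows "jet3 \<Omega> (\<lambda>x. (x \<bullet> (P *v x) + c) / 2) (\<lambda>i x. (P *v x) $ i) (\<lambda>i j x. P $ i $ j) (\<lambda>i j k x. 0)"
proof -
  have c: "continuous_on A (\<lambda>x. (P *v x) $ i)" for A i
    using has_derivative_continuous[OF matrix_vector_component_derivative] continuous_at_imp_continuous_on by blast
  have c': "continuous_on A (\<lambda>x. x \<bullet> (P *v x))" for A
    using has_derivative_continuous[OF quadratic_form_derivative[OF sym]] continuous_at_imp_continuous_on by blast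
  have "((\<lambda>x. (x \<bullet> (P *v x) + c) / 2) has_derivative (\<lambda>h. \<Sum>i\<in>UNIV. (P *v x) $ i * h $ i)) (at x)" for x
  proof -
    have "((\<lambda>x. (1/2) * (x \<bullet> (P *v x) + c)) has_derivative (\<lambda>h. (1/2) * ((\<Sum>i\<in>UNIV. 2 * (P *v x) $ i * h $ i) + 0))) (at x)"
      by (intro has_derivative_mult_right has_derivative_add quadratic_form_derivative sym has_derivative_const)
    then show ?thesis by (simp add: sum_distrib_left)
  qed
  then show ?thesis unfolding jet3_def jet2_def
    using c c' matrix_vector_component_derivative symmetric_entry[OF sym]
    by (auto intro!: continuous_intros)
qed

section \<open>The maximum principle\<close>

lemma psd_matrix_add: "psd_matrix A \<Longrightarrow> psd_matrix B \<Longrightarrow> psd_matrix (A + B)"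
  by (simp add: psd_matrix_def transpose_def vec_eq_iff matrix_vector_mult_add_rdistrib inner_add_right)

lemma psd_matrix_scaleR:
  assumes "psd_matrix A" "c \<ge> 0"
  shows "psd_matrix (c *\<^sub>R A)"
proof -
  have "(c *\<^sub>R A) *v x = c *\<^sub>R (A *v x)" for x
    by (simp add: matrix_vector_mult_def vec_eq_iff sum_distrib_left mult_ac)
  moreover have "transpose (c *\<^sub>R A) = c *\<^sub>R transpose A" by (simp add: transpose_def vec_eq_iff)
  ultimately show ?thesis using assms by (simp add: psd_matrix_def)
qed

lemma interior_maximum_hessian:
  fixes w :: "real^'n \<Rightarrow> real"
  assumes op: "open \<Omega>" and j: "jet2 \<Omega> w w1 w2" and x: "x \<in> \<Omega>" and max: "\<And>y. y \<in> \<Omega> \<Longrightarrow> w y \<le> w x"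
  shows "psd_matrix (- (\<chi> i j. w2 i j x))"
proof -
  let ?W = "\<chi> i j. w2 i j x"
  have "\<xi> \<bullet> (?W *v \<xi>) \<le> 0" for \<xi>
  proof (rule ccontr)
    assume "\<not> ?thesis"
    then have pos: "\<xi> \<bullet> (?W *v \<xi>) > 0" by simp
    obtain e0 where e0: "e0 > 0" "ball x e0 \<subseteq> \<Omega>" using op x openE by blast
    define e where "e = e0 / (norm \<xi> + 1)"
    have e: "e > 0" using e0 by (simp add: e_def add_nonneg_pos)
    have inO: "x + s *\<^sub>R \<xi> \<in> \<Omega>" if "\<bar>s\<bar> < e" for s
    proof -
      have "\<bar>s\<bar> * norm \<xi> \<le> \<bar>s\<bar> * (norm \<xi> + 1)" by (simp add: mult_left_mono)
      also have "\<dots> < e0" using that by (simp add: e_def less_divide_eq add_nonneg_pos)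
      finally have "x + s *\<^sub>R \<xi> \<in> ball x e0" by (simp add: dist_norm)
      then show ?thesis using e0 by blast
    qed
    define g where "g s = w (x + s *\<^sub>R \<xi>)" for s
    define g' where "g' s = (\<Sum>i\<in>UNIV. w1 i (x + s *\<^sub>R \<xi>) * \<xi> $ i)" for s
    have d1: "(g has_real_derivative g' s) (at s)" if "\<bar>s\<bar> < e" for s
      unfolding g_def g'_def by (rule line_derivative[OF jet2D(4)[OF j inO[OF that]]])
    have "(g' has_real_derivative (\<Sum>i\<in>UNIV. (\<Sum>k\<in>UNIV. w2 i k x * \<xi> $ k) * \<xi> $ i)) (at 0)"
      unfolding g'_def using jet2D(5)[OF j x] by (intro DERIV_sum DERIV_cmult_right line_derivative) simp
    moreover have "(\<Sum>i\<in>UNIV. (\<Sum>k\<in>UNIV. w2 i k x * \<xi> $ k) * \<xi> $ i) = \<xi> \<bullet> (?W *v \<xi>)"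
      by (simp add: inner_vec_def matrix_vector_mult_def mult.commute)
    ultimately have d2: "(g' has_real_derivative (\<xi> \<bullet> (?W *v \<xi>))) (at 0)" by simp
    have mx: "g s \<le> g 0" if "\<bar>s\<bar> < e" for s using max inO[OF that] by (simp add: g_def)
    have z: "g' 0 = 0" by (rule DERIV_local_max[OF d1[of 0] e]) (use mx e in auto)
    obtain d where dd: "d > 0" "\<And>h. 0 < h \<Longrightarrow> h < d \<Longrightarrow> g' 0 < g' h"
      using DERIV_pos_inc_right[OF d2 pos] by auto
    define h where "h = min d e / 2"
    have h: "0 < h" "h < d" "h < e" using dd(1) e by (auto simp: h_def)
    obtain y where y: "0 < y" "y < h" "g h - g 0 = (h - 0) * g' y"
      using MVT2[of 0 h g g'] d1 h by auto
    then have "h * g' y > 0" using dd(2)[of y] z h by (intro mult_pos_pos) auto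
    then have "g h > g 0" using y(3)[unfolded diff_zero] by linarith
    with mx[of h] h show False by simp
  qed
  moreover have "transpose (- ?W) = - ?W" using jet2D(6)[OF j x] by (simp add: transpose_def vec_eq_iff)
  moreover have "(- ?W) *v \<xi> = - (?W *v \<xi>)" for \<xi>
    by (simp add: matrix_vector_mult_def vec_eq_iff sum_negf)
  ultimately show ?thesis by (simp add: psd_matrix_def)
qed

text \<open>At an interior maximum D^2 w is negative semidefinite, so monotonicity gives
  \<sigma>_k(P + D^2 w) \<le> \<sigma>_k(P) = 0, against positivity on the cone. It is applied with
  t P in place of \<open>P\<close>.\<close>

lemma comparison_upper:
  fixes P :: "real^'n^'n"
  assumes op: "open \<Omega>" and bd: "bounded \<Omega>" and k: "k \<le> CARD('n)" and j: "jet2 \<Omega> w w1 w2"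
    and w0: "\<And>x. x \<in> frontier \<Omega> \<Longrightarrow> w x = 0" and P: "minor_sum k P = 0"
    and M: "\<And>x. x \<in> \<Omega> \<Longrightarrow> P + (\<chi> i j. w2 i j x) \<in> garding_cone k" and x: "x \<in> \<Omega>"
  shows "w x < 0"
proof (rule ccontr)
  assume "\<not> ?thesis"
  then have wx: "w x \<ge> 0" by simp
  have "compact (closure \<Omega>)" "closure \<Omega> \<noteq> {}" using bd x by (auto simp: compact_closure)
  then obtain m where m: "m \<in> closure \<Omega>" "\<And>y. y \<in> closure \<Omega> \<Longrightarrow> w y \<le> w m"
    using continuous_attains_sup[OF _ _ jet2D(1)[OF j]] by blast
  have cl: "y \<in> closure \<Omega>" if "y \<in> \<Omega>" for y using that closure_subset by blast
  obtain p where p: "p \<in> \<Omega>" "\<And>y. y \<in> \<Omega> \<Longrightarrow> w y \<le> w p"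
  proof (cases "m \<in> \<Omega>")
    case True then show ?thesis using that[of m] m cl by blast
  next
    case False
    \<comment> \<open>A maximum on the frontier has value 0, so the assumption
      \<open>w x \<ge> 0\<close> makes \<open>x\<close> itself an interior maximum. This is how the
      strict inequality is obtained.\<close>
    then have "w m = 0" using m op w0 by (auto simp: frontier_def interior_open)
    then have "w y \<le> w x" if "y \<in> \<Omega>" for y using m(2)[OF cl[OF that]] wx by simp
    then show ?thesis using that[of x] x by blast
  qed
  have "minor_sum k (P + (\<chi> i j. w2 i j p)) \<le> minor_sum k (P + (\<chi> i j. w2 i j p) + - (\<chi> i j. w2 i j p))"
    by (rule minor_sum_mono[OF k M[OF p(1)] interior_maximum_hessian[OF op j p]])
  then show False using garding_coneD(2)[OF M[OF p(1)]] P by simp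
qed

text \<open>If the bound failed, s (|x|^2 - R^2)/2 - w would have a positive interior maximum. There
  D^2 w dominates s I, hence so does P + D^2 w, and monotonicity contradicts the assumed bound on
  \<sigma>_k. Since \<open>P\<close> enters only through being semidefinite, the constant will not
  depend on \<open>t\<close>.\<close>

lemma comparison_lower:
  fixes P :: "real^'n^'n"
  assumes op: "open \<Omega>" and bd: "\<And>x. x \<in> closure \<Omega> \<Longrightarrow> norm x \<le> R" and k: "k \<le> CARD('n)" and j: "jet2 \<Omega> w w1 w2"
    and w0: "\<And>x. x \<in> frontier \<Omega> \<Longrightarrow> w x = 0" and P: "psd_matrix P" and s: "s > 0"
    and M: "\<And>x. x \<in> \<Omega> \<Longrightarrow> minor_sum k (P + (\<chi> i j. w2 i j x)) < minor_sum k (mat s :: real^'n^'n)" and x: "x \<in> \<Omega>"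
  shows "- (s * R\<^sup>2 / 2) \<le> w x"
proof (rule ccontr)
  assume "\<not> ?thesis"
  then have wx: "w x < - (s * R\<^sup>2 / 2)" by simp
  have j1: "jet2 \<Omega> (\<lambda>x. (x \<bullet> (mat 1 *v x) + - R\<^sup>2) / 2) (\<lambda>i x. ((mat 1 :: real^'n^'n) *v x) $ i) (\<lambda>i j x. (mat 1 :: real^'n^'n) $ i $ j)"
    using jet3_quadratic_form[of "mat 1 :: real^'n^'n" \<Omega> "- R\<^sup>2"] by (simp add: jet3_def transpose_mat)
  define v where "v x = s * ((x \<bullet> (mat 1 *v x) + - R\<^sup>2) / 2) + (- 1) * w x" for x
  note jv = jet2_lincomb[OF j1 j, of s "- 1", folded v_def]
  have vx: "v x = s * (((norm x)\<^sup>2 - R\<^sup>2) / 2) - w x" for x by (simp add: v_def power2_norm_eq_inner)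
  have "compact (closure \<Omega>)"
    using bd by (auto simp: compact_eq_bounded_closed bounded_iff)
  moreover have cx: "y \<in> closure \<Omega>" if "y \<in> \<Omega>" for y using that closure_subset by blast
  moreover have "closure \<Omega> \<noteq> {}" using x by auto
  ultimately obtain m where m: "m \<in> closure \<Omega>" "\<forall>y\<in>closure \<Omega>. v y \<le> v m"
    using continuous_attains_sup[OF _ _ jet2D(1)[OF jv]] by metis
  have "s * (((norm x)\<^sup>2 - R\<^sup>2) / 2) \<ge> s * ((0 - R\<^sup>2) / 2)" using s by (intro mult_left_mono) auto
  then have "v x > 0" using wx vx[of x] by simp
  then have vm: "v m > 0" using m(2) cx[OF x] by force
  have mO: "m \<in> \<Omega>"
  proof (rule ccontr)
    assume "m \<notin> \<Omega>"
    then have "m \<in> frontier \<Omega>" using m op by (auto simp: frontier_def interior_open)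
    then have "v m = s * (((norm m)\<^sup>2 - R\<^sup>2) / 2)" using w0 by (simp add: vx)
    moreover have "(norm m)\<^sup>2 \<le> R\<^sup>2" using bd[OF m(1)] by (rule power_mono) simp
    then have "s * (((norm m)\<^sup>2 - R\<^sup>2) / 2) \<le> 0" using s by (intro mult_nonneg_nonpos) auto
    ultimately show False using vm by simp
  qed
  let ?W = "\<chi> i j. w2 i j m"
  have "psd_matrix (- (\<chi> i j. s * (mat 1 :: real^'n^'n) $ i $ j + - 1 * w2 i j m))"
    by (rule interior_maximum_hessian[OF op jv mO]) (use m cx in auto)
  moreover have "- (\<chi> i j. s * (mat 1 :: real^'n^'n) $ i $ j + - 1 * w2 i j m) = ?W - mat s"
    by (simp add: vec_eq_iff mat_def)
  ultimately have "psd_matrix (P + (?W - mat s))" using P by (intro psd_matrix_add) auto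
  from minor_sum_mono[OF k mat_in_garding_cone[OF k s] this]
  have "minor_sum k (mat s :: real^'n^'n) \<le> minor_sum k (P + ?W)" by (simp add: algebra_simps)
  with M[OF mO] show False by simp
qed

section \<open>Energy estimates\<close>

lemma minor_sum_lin_outer:
  "minor_sum_lin k M (\<chi> i j. a $ i * b $ j) = (\<Sum>i\<in>UNIV. \<Sum>j\<in>UNIV. a $ i * minor_sum_deriv k M i j * b $ j)"
  by (simp add: minor_sum_lin_def mult_ac)

lemma psd_matrix_outer: "psd_matrix (\<chi> i j. a $ i * a $ j)"
proof -
  have "x \<bullet> ((\<chi> i j. a $ i * a $ j) *v x) = (a \<bullet> x)\<^sup>2" for x
    by (simp add: inner_vec_def matrix_vector_mult_def power2_eq_square sum_product sum_distrib_left mult_ac)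
  then show ?thesis by (simp add: psd_matrix_def transpose_def vec_eq_iff mult.commute)
qed

text \<open>Two flux identities, with the roles of weight and potential exchanged; the first uses
  the vanishing gradient of \<open>z\<close>, the second the vanishing of \<open>z\<close>. Their
  mixed terms agree because the coefficient matrix is symmetric.\<close>

lemma green_identity:
  fixes \<Omega> :: "(real^'n) set"
  assumes op: "open \<Omega>" and bd: "bounded \<Omega>" and cv: "convex \<Omega>"
    and u: "jet3 \<Omega> u u1 u2 u3" and z: "jet2 \<Omega> z z1 z2" and \<psi>: "jet2 \<Omega> \<psi> p1 p2"
    and z0: "\<And>x. x \<in> frontier \<Omega> \<Longrightarrow> z x = 0" "\<And>x i. x \<in> frontier \<Omega> \<Longrightarrow> z1 i x = 0"
  shows "(LINT x:\<Omega>|lborel. \<psi> x * minor_sum_lin k (\<chi> i j. u2 i j x) (\<chi> i j. z2 i j x)) =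
         (LINT x:\<Omega>|lborel. z x * minor_sum_lin k (\<chi> i j. u2 i j x) (\<chi> i j. p2 i j x))"
proof -
  have j2: "jet2 \<Omega> u u1 u2" using u by (simp add: jet3_def)
  define S where "S x i j = minor_sum_deriv k (\<chi> i j. u2 i j x) i j" for x i j
  define X where "X x = (\<Sum>i\<in>UNIV. \<Sum>j\<in>UNIV. p1 i x * S x i j * z1 j x)" for x
  define X' where "X' x = (\<Sum>i\<in>UNIV. \<Sum>j\<in>UNIV. z1 i x * S x i j * p1 j x)" for x
  have Sc: "continuous_on (closure \<Omega>) (\<lambda>x. S x i j)" for i j
    unfolding S_def by (rule continuous_on_minor_sum_deriv) (simp add: jet2D(3)[OF j2])
  have Xc: "continuous_on (closure \<Omega>) X" "continuous_on (closure \<Omega>) X'"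
    unfolding X_def X'_def by (intro continuous_intros Sc jet2D(2)[OF z] jet2D(2)[OF \<psi>])+
  have Lc: "continuous_on (closure \<Omega>) (\<lambda>x. minor_sum_lin k (\<chi> i j. u2 i j x) (\<chi> i j. g i j x))"
    if "\<And>i j. continuous_on (closure \<Omega>) (g i j)" for g
    by (rule continuous_on_minor_sum_lin) (simp_all add: that jet2D(3)[OF j2])
  have XX: "X x = X' x" if x: "x \<in> \<Omega>" for x
  proof -
    have "transpose (\<chi> i j. u2 i j x) = (\<chi> i j. u2 i j x)" using jet2D(6)[OF j2 x] by (simp add: transpose_def vec_eq_iff)
    then have s: "S x i j = S x j i" for i j unfolding S_def by (rule minor_sum_deriv_sym)
    have "X x = (\<Sum>j\<in>UNIV. \<Sum>i\<in>UNIV. p1 i x * S x i j * z1 j x)" unfolding X_def by (rule sum.swap)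
    also have "\<dots> = X' x" unfolding X'_def
      by (intro sum.cong refl) (subst s, simp add: mult_ac)
    finally show ?thesis .
  qed
  let ?A = "\<lambda>x. \<psi> x * minor_sum_lin k (\<chi> i j. u2 i j x) (\<chi> i j. z2 i j x)"
  let ?B = "\<lambda>x. z x * minor_sum_lin k (\<chi> i j. u2 i j x) (\<chi> i j. p2 i j x)"
  have iA: "set_integrable lborel \<Omega> ?A" and iB: "set_integrable lborel \<Omega> ?B"
    and iX: "set_integrable lborel \<Omega> X" "set_integrable lborel \<Omega> X'"
    by (intro set_integrable_closure bd op continuous_intros Lc jet2D(1,3)[OF z] jet2D(1,3)[OF \<psi>] Xc)+
  have "(LINT x:\<Omega>|lborel. ?A x + X x) = 0"
    using flux_integral_zero[OF op bd cv u z jet2D(1)[OF \<psi>] jet2D(2)[OF \<psi>] jet2D(4)[OF \<psi>]] z0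
    by (simp add: X_def S_def)
  then have 1: "(LINT x:\<Omega>|lborel. ?A x) + (LINT x:\<Omega>|lborel. X x) = 0"
    using set_integral_add(2)[OF iA iX(1)] by simp
  have "(LINT x:\<Omega>|lborel. ?B x + X' x) = 0"
    using flux_integral_zero[OF op bd cv u \<psi> jet2D(1)[OF z] jet2D(2)[OF z] jet2D(4)[OF z]] z0
    by (simp add: X'_def S_def)
  then have 2: "(LINT x:\<Omega>|lborel. ?B x) + (LINT x:\<Omega>|lborel. X' x) = 0"
    using set_integral_add(2)[OF iB iX(2)] by simp
  have "(LINT x:\<Omega>|lborel. X x) = (LINT x:\<Omega>|lborel. X' x)"
    by (rule set_lebesgue_integral_cong) (use op XX in auto)
  with 1 2 show ?thesis by simp
qed

text \<open>The weights 1 - exp(m w) vanish on the frontier and tend to 1 inside, where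
  \<open>w\<close> is negative. For each of them the flux identity equates the weighted integral
  with that of m exp(m w) times the form \<open>Q\<close> in the gradient of \<open>w\<close>,
  nonnegative by ellipticity. Dominated convergence removes the weight, so no boundary integral has
  to be formed.\<close>

lemma energy_nonneg:
  fixes \<Omega> :: "(real^'n) set"
  assumes op: "open \<Omega>" and bd: "bounded \<Omega>" and cv: "convex \<Omega>" and k: "k \<le> CARD('n)"
    and u: "jet3 \<Omega> u u1 u2 u3" and w: "jet2 \<Omega> w w1 w2"
    and M: "\<And>x. x \<in> \<Omega> \<Longrightarrow> (\<chi> i j. u2 i j x) \<in> garding_cone k"
    and w0: "\<And>x. x \<in> frontier \<Omega> \<Longrightarrow> w x = 0" and wneg: "\<And>x. x \<in> \<Omega> \<Longrightarrow> w x < 0"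
  shows "0 \<le> (LINT x:\<Omega>|lborel. minor_sum_lin k (\<chi> i j. u2 i j x) (\<chi> i j. w2 i j x))"
proof -
  have j2: "jet2 \<Omega> u u1 u2" using u by (simp add: jet3_def)
  define L where "L x = minor_sum_lin k (\<chi> i j. u2 i j x) (\<chi> i j. w2 i j x)" for x
  define Q where "Q x = (\<Sum>i\<in>UNIV. \<Sum>j\<in>UNIV. w1 i x * minor_sum_deriv k (\<chi> i j. u2 i j x) i j * w1 j x)" for x
  have Lc: "continuous_on (closure \<Omega>) L"
    unfolding L_def by (rule continuous_on_minor_sum_lin) (simp_all add: jet2D(3)[OF w] jet2D(3)[OF j2])
  have Sc: "continuous_on (closure \<Omega>) (\<lambda>x. minor_sum_deriv k (\<chi> i j. u2 i j x) i j)" for i j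
    by (rule continuous_on_minor_sum_deriv) (simp add: jet2D(3)[OF j2])
  have Qc: "continuous_on (closure \<Omega>) Q" unfolding Q_def by (intro continuous_intros Sc jet2D(2)[OF w])
  have Q0: "Q x \<ge> 0" if "x \<in> \<Omega>" for x
    using minor_sum_lin_nonneg[OF k M[OF that] psd_matrix_outer[of "\<chi> i. w1 i x"]]
    by (simp add: minor_sum_lin_outer[of k _ "\<chi> i. w1 i x" "\<chi> i. w1 i x", simplified] Q_def)
  have nn: "0 \<le> (LINT x:\<Omega>|lborel. (1 - exp (real m * w x)) * L x)" for m :: nat
  proof -
    let ?c1 = "\<lambda>i x. - (real m * exp (real m * w x)) * w1 i x"
    have "(LINT x:\<Omega>|lborel. (1 - exp (real m * w x)) * L x + (\<Sum>i\<in>UNIV. \<Sum>j\<in>UNIV. ?c1 i x * minor_sum_deriv k (\<chi> i j. u2 i j x) i j * w1 j x)) = 0"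
      unfolding L_def
    proof (rule flux_integral_zero[OF op bd cv u w])
      show "continuous_on (closure \<Omega>) (\<lambda>x. 1 - exp (real m * w x))" by (intro continuous_intros jet2D(1)[OF w])
      show "continuous_on (closure \<Omega>) (?c1 i)" for i by (intro continuous_intros jet2D(1,2)[OF w])
      show "((\<lambda>x. 1 - exp (real m * w x)) has_derivative (\<lambda>h. \<Sum>i\<in>UNIV. ?c1 i x * h $ i)) (at x)" if x: "x \<in> \<Omega>" for x
      proof -
        have "((\<lambda>x. 1 - exp (real m * w x)) has_derivative (\<lambda>h. 0 - (real m * (\<Sum>i\<in>UNIV. w1 i x * h $ i)) * exp (real m * w x))) (at x)"
          by (intro has_derivative_diff has_derivative_const has_derivative_exp has_derivative_mult_right jet2D(4)[OF w x])
        then show ?thesis by (simp add: sum_distrib_left sum_distrib_right sum_negf mult_ac)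
      qed
    qed (simp add: w0)
    moreover have "(\<Sum>i\<in>UNIV. \<Sum>j\<in>UNIV. ?c1 i x * minor_sum_deriv k (\<chi> i j. u2 i j x) i j * w1 j x) = - (real m * exp (real m * w x) * Q x)" for x
      by (simp add: Q_def sum_distrib_left sum_negf mult_ac)
    ultimately have "(LINT x:\<Omega>|lborel. (1 - exp (real m * w x)) * L x - real m * exp (real m * w x) * Q x) = 0" by simp
    moreover have iA: "set_integrable lborel \<Omega> (\<lambda>x. (1 - exp (real m * w x)) * L x)"
      and iB: "set_integrable lborel \<Omega> (\<lambda>x. real m * exp (real m * w x) * Q x)"
      by (intro set_integrable_closure bd op continuous_intros jet2D(1)[OF w] Lc Qc)+
    ultimately have "(LINT x:\<Omega>|lborel. (1 - exp (real m * w x)) * L x) = (LINT x:\<Omega>|lborel. real m * exp (real m * w x) * Q x)"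
      using set_integral_diff(2)[OF iA iB] by simp
    also have "\<dots> \<ge> 0" unfolding set_lebesgue_integral_def
      by (rule Bochner_Integration.integral_nonneg) (auto simp: indicator_def Q0)
    finally show ?thesis .
  qed
  have Lm: "(\<lambda>x. indicator \<Omega> x *\<^sub>R L x) \<in> borel_measurable borel"
    by (rule borel_measurable_continuous_on_indicator) (use op continuous_on_subset[OF Lc closure_subset] in auto)
  have "(\<lambda>m. LINT x|lborel. indicator \<Omega> x *\<^sub>R ((1 - exp (real m * w x)) * L x)) \<longlonglongrightarrow> (LINT x|lborel. indicator \<Omega> x *\<^sub>R L x)"
  proof (rule integral_dominated_convergence[where w="\<lambda>x. \<bar>indicator \<Omega> x *\<^sub>R L x\<bar>"])
    show "(\<lambda>x. indicator \<Omega> x *\<^sub>R L x) \<in> borel_measurable lborel" using Lm by simp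
    have "(\<lambda>x. indicator \<Omega> x *\<^sub>R ((1 - exp (real m * w x)) * L x)) \<in> borel_measurable borel" for m
      by (rule borel_measurable_continuous_on_indicator)
        (use op in \<open>auto intro!: continuous_intros continuous_on_subset[OF Lc closure_subset] continuous_on_subset[OF jet2D(1)[OF w] closure_subset]\<close>)
    then show "(\<lambda>x. indicator \<Omega> x *\<^sub>R ((1 - exp (real m * w x)) * L x)) \<in> borel_measurable lborel" for m by simp
    show "integrable lborel (\<lambda>x. \<bar>indicator \<Omega> x *\<^sub>R L x\<bar>)"
      using set_integrable_closure[OF bd op Lc] unfolding set_integrable_def by (rule integrable_abs)
    show "AE x in lborel. (\<lambda>m. indicator \<Omega> x *\<^sub>R ((1 - exp (real m * w x)) * L x)) \<longlonglongrightarrow> indicator \<Omega> x *\<^sub>R L x"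
    proof (rule AE_I2)
      fix x
      show "(\<lambda>m. indicator \<Omega> x *\<^sub>R ((1 - exp (real m * w x)) * L x)) \<longlonglongrightarrow> indicator \<Omega> x *\<^sub>R L x"
      proof (cases "x \<in> \<Omega>")
        case True
        have "(\<lambda>m. exp (w x) ^ m) \<longlonglongrightarrow> 0" by (rule LIMSEQ_power_zero) (use wneg[OF True] in simp)
        then have "(\<lambda>m. exp (real m * w x)) \<longlonglongrightarrow> 0" by (simp add: exp_of_nat_mult)
        then have "(\<lambda>m. (1 - exp (real m * w x)) * L x) \<longlonglongrightarrow> (1 - 0) * L x" by (intro tendsto_intros)
        then show ?thesis using True by simp
      qed simp
    qed
    show "AE x in lborel. norm (indicator \<Omega> x *\<^sub>R ((1 - exp (real m * w x)) * L x)) \<le> \<bar>indicator \<Omega> x *\<^sub>R L x\<bar>" for m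
    proof (rule AE_I2)
      fix x
      show "norm (indicator \<Omega> x *\<^sub>R ((1 - exp (real m * w x)) * L x)) \<le> \<bar>indicator \<Omega> x *\<^sub>R L x\<bar>"
      proof (cases "x \<in> \<Omega>")
        case True
        have "real m * w x \<le> 0" using wneg[OF True] by (intro mult_nonneg_nonpos) auto
        then have "\<bar>1 - exp (real m * w x)\<bar> \<le> 1" by simp
        then have "\<bar>1 - exp (real m * w x)\<bar> * \<bar>L x\<bar> \<le> 1 * \<bar>L x\<bar>" by (rule mult_right_mono) simp
        then show ?thesis using True by (simp add: abs_mult)
      qed simp
    qed
  qed
  then have "0 \<le> (LINT x|lborel. indicator \<Omega> x *\<^sub>R L x)"
    by (rule LIMSEQ_le_const) (use nn in \<open>auto simp: set_lebesgue_integral_def\<close>)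
  then show ?thesis by (simp add: set_lebesgue_integral_def L_def)
qed

text \<open>Recentring at \<open>s\<close> makes the derivative there a linear Taylor
  coefficient.\<close>

lemma poly_pderiv_sig_poly:
  fixes A B :: "real^'n^'n"
  shows "poly (pderiv (sig_poly k A B)) s = minor_sum_lin k (A + s *\<^sub>R B) B"
proof -
  have "sig_poly k (A + s *\<^sub>R B) B = pcompose (sig_poly k A B) [:s, 1:]"
    by (rule poly_ext) (simp add: poly_pcompose poly_sig_poly_real algebra_simps)
  then have "coeff (sig_poly k (A + s *\<^sub>R B) B) 1 = poly (pderiv (pcompose (sig_poly k A B) [:s, 1:])) 0"
    by (simp add: poly_0_coeff_0 coeff_pderiv)
  then show ?thesis by (simp add: coeff_sig_poly_1[symmetric] pderiv_pcompose poly_pcompose pderiv_pCons)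
qed

text \<open>Integrating the coefficients turns the \<open>s\<close>-dependence into one real
  polynomial. Differentiation under the integral is then formal, and the mean value theorem for
  polynomials applies.\<close>

lemma minor_sum_integral_polynomial:
  fixes \<Omega> :: "(real^'n) set" and A Z :: "real^'n \<Rightarrow> real^'n^'n"
  assumes op: "open \<Omega>" and bd: "bounded \<Omega>" and \<psi>: "continuous_on (closure \<Omega>) \<psi>"
    and A: "\<And>i j. continuous_on (closure \<Omega>) (\<lambda>x. A x $ i $ j)" and Z: "\<And>i j. continuous_on (closure \<Omega>) (\<lambda>x. Z x $ i $ j)"
  obtains Y :: "real poly" where "\<And>s. poly Y s = (LINT x:\<Omega>|lborel. \<psi> x * minor_sum k (A x + s *\<^sub>R Z x))"
    "\<And>s. poly (pderiv Y) s = (LINT x:\<Omega>|lborel. \<psi> x * minor_sum_lin k (A x + s *\<^sub>R Z x) (Z x))"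
proof -
  define c where "c m x = coeff (sig_poly k (A x) (Z x)) m" for m x
  have cc: "continuous_on (closure \<Omega>) (c m)" for m
    unfolding c_def[abs_def] by (rule continuous_on_coeff_sig_poly[OF A Z])
  define Y where "Y = (\<Sum>m\<le>k. monom (LINT x:\<Omega>|lborel. \<psi> x * c m x) m)"
  have int: "set_integrable lborel \<Omega> (\<lambda>x. a * (\<psi> x * c m x))" for a m
    by (intro set_integrable_closure bd op continuous_intros \<psi> cc)
  have sumint: "(\<Sum>m\<in>I. a m * (LINT x:\<Omega>|lborel. \<psi> x * c m x)) = (LINT x:\<Omega>|lborel. \<psi> x * (\<Sum>m\<in>I. a m * c m x))" for a and I :: "nat set"
  proof -
    have "(\<Sum>m\<in>I. a m * (LINT x:\<Omega>|lborel. \<psi> x * c m x)) = (\<Sum>m\<in>I. (LINT x:\<Omega>|lborel. a m * (\<psi> x * c m x)))"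
      by simp
    also have "\<dots> = (LINT x:\<Omega>|lborel. (\<Sum>m\<in>I. a m * (\<psi> x * c m x)))"
      unfolding set_lebesgue_integral_def scaleR_sum_right
      by (rule Bochner_Integration.integral_sum[symmetric]) (use int in \<open>simp add: set_integrable_def\<close>)
    finally show ?thesis by (simp add: sum_distrib_left mult_ac)
  qed
  show thesis
  proof (rule that[of Y])
    fix s
    have m: "sig_poly k (A x) (Z x) = (\<Sum>m\<le>k. monom (c m x) m)" for x
      unfolding c_def by (rule poly_as_sum_of_monoms'[symmetric]) (rule degree_sig_poly_le)
    have ps: "pderiv (\<Sum>m\<le>k. f m) = (\<Sum>m\<le>k. pderiv (f m))" for f :: "nat \<Rightarrow> real poly"
      using higher_pderiv_sum[of 1 f "{..k}"] by simp
    have p: "minor_sum k (A x + s *\<^sub>R Z x) = (\<Sum>m\<le>k. s ^ m * c m x)" for x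
      unfolding poly_sig_poly_real[symmetric] m by (simp add: poly_sum poly_monom mult.commute)
    have "poly Y s = (\<Sum>m\<le>k. s ^ m * (LINT x:\<Omega>|lborel. \<psi> x * c m x))"
      by (simp add: Y_def poly_sum poly_monom mult.commute)
    then show "poly Y s = (LINT x:\<Omega>|lborel. \<psi> x * minor_sum k (A x + s *\<^sub>R Z x))" by (simp only: sumint p)
    have d: "minor_sum_lin k (A x + s *\<^sub>R Z x) (Z x) = (\<Sum>m\<le>k. (real m * s ^ (m - 1)) * c m x)" for x
      unfolding poly_pderiv_sig_poly[symmetric] m ps by (simp add: pderiv_monom poly_sum poly_monom mult_ac)
    have "poly (pderiv Y) s = (\<Sum>m\<le>k. (real m * s ^ (m - 1)) * (LINT x:\<Omega>|lborel. \<psi> x * c m x))"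
      unfolding Y_def ps by (simp add: pderiv_monom poly_sum poly_monom mult_ac)
    then show "poly (pderiv Y) s = (LINT x:\<Omega>|lborel. \<psi> x * minor_sum_lin k (A x + s *\<^sub>R Z x) (Z x))" by (simp only: sumint d)
  qed
qed

text \<open>The index \<open>a\<close> will belong to \<open>f\<^sub>2\<close> and \<open>b\<close>
  to \<open>f\<^sub>1\<close>. The mean value theorem selects one \<open>s\<close> strictly between
  0 and 1, and at the same matrix field \<open>M s\<close> the Green identity moves the derivatives
  to the test function and the Euler bound controls the integral of L(P).\<close>

lemma difference_bound:
  fixes \<Omega> :: "(real^'n) set" and P :: "real^'n^'n"
  assumes op: "open \<Omega>" and bd: "bounded \<Omega>" and cv: "convex \<Omega>" and k: "k \<le> CARD('n)"
    and symP: "transpose P = P" and t: "t > 0" and C: "C \<ge> 0"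
    and ja: "jet3 \<Omega> wa wa1 wa2 wa3" and jb: "jet3 \<Omega> wb wb1 wb2 wb3"
    and fr: "\<And>x. x \<in> frontier \<Omega> \<Longrightarrow> wa x = 0" "\<And>x. x \<in> frontier \<Omega> \<Longrightarrow> wb x = 0"
      "\<And>x i. x \<in> frontier \<Omega> \<Longrightarrow> wa1 i x = wb1 i x"
    and Ca: "\<And>x. x \<in> \<Omega> \<Longrightarrow> t *\<^sub>R P + (\<chi> i j. wa2 i j x) \<in> garding_cone k"
    and Cb: "\<And>x. x \<in> \<Omega> \<Longrightarrow> t *\<^sub>R P + (\<chi> i j. wb2 i j x) \<in> garding_cone k"
    and na: "\<And>x. x \<in> \<Omega> \<Longrightarrow> - K \<le> wa x \<and> wa x < 0" and nb: "\<And>x. x \<in> \<Omega> \<Longrightarrow> - K \<le> wb x \<and> wb x < 0"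
    and \<psi>: "jet2 \<Omega> \<psi> p1 p2"
    and psd: "\<And>x. x \<in> \<Omega> \<Longrightarrow> psd_matrix (C *\<^sub>R P + (\<chi> i j. p2 i j x))" "\<And>x. x \<in> \<Omega> \<Longrightarrow> psd_matrix (C *\<^sub>R P + - 1 *\<^sub>R (\<chi> i j. p2 i j x))"
  shows "\<bar>(LINT x:\<Omega>|lborel. \<psi> x * minor_sum k (t *\<^sub>R P + (\<chi> i j. wb2 i j x))) - (LINT x:\<Omega>|lborel. \<psi> x * minor_sum k (t *\<^sub>R P + (\<chi> i j. wa2 i j x)))\<bar>
     \<le> K * C * (real k / t * (LINT x:\<Omega>|lborel. minor_sum k (t *\<^sub>R P + (\<chi> i j. wa2 i j x))))"
proof -
  have ja2: "jet2 \<Omega> wa wa1 wa2" and jb2: "jet2 \<Omega> wb wb1 wb2" using ja jb by (auto simp: jet3_def)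
  define A where "A x = t *\<^sub>R P + (\<chi> i j. wa2 i j x)" for x
  define Z where "Z x = (\<chi> i j. 1 * wb2 i j x + (- 1) * wa2 i j x)" for x
  define z where "z x = 1 * wb x + (- 1) * wa x" for x
  have jz: "jet2 \<Omega> z (\<lambda>i x. 1 * wb1 i x + (- 1) * wa1 i x) (\<lambda>i j x. 1 * wb2 i j x + (- 1) * wa2 i j x)"
    unfolding z_def by (rule jet2_lincomb[OF jb2 ja2])
  have z0: "z x = 0" "1 * wb1 i x + (- 1) * wa1 i x = 0" if "x \<in> frontier \<Omega>" for x i
    using fr that by (auto simp: z_def)
  have Ac: "continuous_on (closure \<Omega>) (\<lambda>x. A x $ i $ j)" and Zc: "continuous_on (closure \<Omega>) (\<lambda>x. Z x $ i $ j)" for i j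
    by (auto simp: A_def Z_def intro!: continuous_intros jet2D(3)[OF ja2] jet2D(3)[OF jb2])
  define u where "u s x = t * ((x \<bullet> (P *v x) + 0) / 2) + 1 * ((1 - s) * wa x + s * wb x)" for s x
  define M where "M s x = (\<chi> i j. t * P $ i $ j + 1 * ((1 - s) * wa2 i j x + s * wb2 i j x))" for s x
  have ju: "\<exists>u1 u3. jet3 \<Omega> (u s) u1 (\<lambda>i j x. t * P $ i $ j + 1 * ((1 - s) * wa2 i j x + s * wb2 i j x)) u3" for s
    unfolding u_def using jet3_lincomb[OF jet3_quadratic_form[OF symP] jet3_lincomb[OF ja jb]] by blast
  have MA: "M s x = A x + s *\<^sub>R Z x" for s x
    by (simp add: M_def A_def Z_def vec_eq_iff algebra_simps)
  have swap: "(LINT x:\<Omega>|lborel. \<phi> x * minor_sum_lin k (M s x) (Z x)) = (LINT x:\<Omega>|lborel. z x * minor_sum_lin k (M s x) (\<chi> i j. q2 i j x))"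
    if "jet2 \<Omega> \<phi> q1 q2" for \<phi> q1 q2 s
  proof -
    obtain u1 u3 where "jet3 \<Omega> (u s) u1 (\<lambda>i j x. t * P $ i $ j + 1 * ((1 - s) * wa2 i j x + s * wb2 i j x)) u3" using ju by blast
    from green_identity[OF op bd cv this jz that z0] show ?thesis unfolding M_def Z_def .
  qed
  have cone: "M s x \<in> garding_cone k" if "x \<in> \<Omega>" "0 \<le> s" "s \<le> 1" for s x
  proof -
    have "M s x = (1 - s) *\<^sub>R (t *\<^sub>R P + (\<chi> i j. wa2 i j x)) + s *\<^sub>R (t *\<^sub>R P + (\<chi> i j. wb2 i j x))"
      by (simp add: M_def vec_eq_iff algebra_simps)
    then show ?thesis using garding_cone_convex[OF k Ca[OF that(1)] Cb[OF that(1)] that(2,3)] by simp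
  qed
  let ?F = "LINT x:\<Omega>|lborel. minor_sum k (A x)"
  \<comment> \<open>The Green identity with test function 1, whose Hessian is zero, makes the
    derivative in \<open>s\<close> vanish.\<close>
  have mass: "(LINT x:\<Omega>|lborel. minor_sum k (M s x)) = ?F" if s: "0 < s" for s
  proof -
    obtain Y where Y: "\<And>s. poly Y s = (LINT x:\<Omega>|lborel. 1 * minor_sum k (A x + s *\<^sub>R Z x))"
      "\<And>s. poly (pderiv Y) s = (LINT x:\<Omega>|lborel. 1 * minor_sum_lin k (A x + s *\<^sub>R Z x) (Z x))"
      using minor_sum_integral_polynomial[OF op bd continuous_on_const Ac Zc] by blast
    have "poly (pderiv Y) s = 0" for s
    proof -
      have "minor_sum_lin k B (\<chi> i j. 0) = 0" for B :: "real^'n^'n" by (simp add: minor_sum_lin_def)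
      then show ?thesis using swap[OF jet2_const[of \<Omega> 1], of s] by (simp add: Y(2) MA)
    qed
    then have "poly Y s = poly Y 0" using poly_MVT[OF s, of Y] by auto
    then show ?thesis using Y(1)[of s] Y(1)[of 0] by (simp add: MA)
  qed
  have main: "t * (LINT x:\<Omega>|lborel. minor_sum_lin k (M s x) P) \<le> real k * ?F" if s: "0 < s" "s < 1" for s
  proof -
    let ?W = "\<lambda>x. \<chi> i j. (1 - s) * wa2 i j x + s * wb2 i j x"
    obtain u1 u3 where u: "jet3 \<Omega> (u s) u1 (\<lambda>i j x. t * P $ i $ j + 1 * ((1 - s) * wa2 i j x + s * wb2 i j x)) u3" using ju by blast
    have jw: "jet2 \<Omega> (\<lambda>x. (1 - s) * wa x + s * wb x) (\<lambda>i x. (1 - s) * wa1 i x + s * wb1 i x) (\<lambda>i j x. (1 - s) * wa2 i j x + s * wb2 i j x)"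
      by (rule jet2_lincomb[OF ja2 jb2])
    have neg: "(1 - s) * wa x + s * wb x < 0" if "x \<in> \<Omega>" for x
      using na[OF that] nb[OF that] s by (intro add_neg_neg mult_pos_neg) auto
    have nonneg: "0 \<le> (LINT x:\<Omega>|lborel. minor_sum_lin k (M s x) (?W x))"
      using energy_nonneg[OF op bd cv k u jw cone[unfolded M_def] _ neg] fr s by (simp add: M_def)
    have euler: "real k * minor_sum k (M s x) = t * minor_sum_lin k (M s x) P + minor_sum_lin k (M s x) (?W x)" for x
    proof -
      \<comment> \<open>Euler's identity at \<open>M s x\<close>, with the argument split into its
        large part t P and the Hessian of a function to which \<open>energy_nonneg\<close>
        applies.\<close>
      have eq: "t *\<^sub>R P + ?W x = M s x" by (simp add: M_def vec_eq_iff)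
      have "minor_sum_lin k (M s x) (t *\<^sub>R P + ?W x) = t * minor_sum_lin k (M s x) P + minor_sum_lin k (M s x) (?W x)"
        by (simp only: minor_sum_lin_add minor_sum_lin_scaleR)
      then show ?thesis unfolding eq minor_sum_lin_self .
    qed
    have Mc: "continuous_on (closure \<Omega>) (\<lambda>x. M s x $ i $ j)" for i j
      by (auto simp: M_def intro!: continuous_intros jet2D(3)[OF ja2] jet2D(3)[OF jb2])
    have i1: "set_integrable lborel \<Omega> (\<lambda>x. t * minor_sum_lin k (M s x) P)"
      by (intro set_integrable_closure bd op continuous_intros continuous_on_minor_sum_lin Mc)
    have i2: "set_integrable lborel \<Omega> (\<lambda>x. minor_sum_lin k (M s x) (?W x))"
      by (intro set_integrable_closure bd op continuous_on_minor_sum_lin Mc) (auto intro!: continuous_intros jet2D(3)[OF ja2] jet2D(3)[OF jb2])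
    have "real k * (LINT x:\<Omega>|lborel. minor_sum k (M s x)) = (LINT x:\<Omega>|lborel. real k * minor_sum k (M s x))"
      by (rule set_integral_mult_right[symmetric])
    also have "\<dots> = (LINT x:\<Omega>|lborel. t * minor_sum_lin k (M s x) P) + (LINT x:\<Omega>|lborel. minor_sum_lin k (M s x) (?W x))"
      unfolding euler by (rule set_integral_add(2)[OF i1 i2])
    also have "(LINT x:\<Omega>|lborel. t * minor_sum_lin k (M s x) P) = t * (LINT x:\<Omega>|lborel. minor_sum_lin k (M s x) P)"
      by (rule set_integral_mult_right)
    finally show ?thesis using nonneg unfolding mass[OF s(1)] by linarith
  qed
  obtain Y where Y: "\<And>s. poly Y s = (LINT x:\<Omega>|lborel. \<psi> x * minor_sum k (A x + s *\<^sub>R Z x))"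
    "\<And>s. poly (pderiv Y) s = (LINT x:\<Omega>|lborel. \<psi> x * minor_sum_lin k (A x + s *\<^sub>R Z x) (Z x))"
    using minor_sum_integral_polynomial[OF op bd jet2D(1)[OF \<psi>] Ac Zc] by blast
  obtain s where s: "0 < s" "s < 1" "poly Y 1 - poly Y 0 = (1 - 0) * poly (pderiv Y) s"
    using poly_MVT[of 0 1 Y] by auto
  have B1: "A x + 1 *\<^sub>R Z x = t *\<^sub>R P + (\<chi> i j. wb2 i j x)" for x
    by (simp add: A_def Z_def vec_eq_iff)
  have Mc: "continuous_on (closure \<Omega>) (\<lambda>x. M s x $ i $ j)" for i j
    by (auto simp: M_def intro!: continuous_intros jet2D(3)[OF ja2] jet2D(3)[OF jb2])
  have K0: "K \<ge> 0" if "x \<in> \<Omega>" for x using na[OF that] by linarith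
  have bnd: "\<bar>z x * minor_sum_lin k (M s x) (\<chi> i j. p2 i j x)\<bar> \<le> K * (C * minor_sum_lin k (M s x) P)" if x: "x \<in> \<Omega>" for x
  proof -
    \<comment> \<open>\<open>z\<close> is a difference of two numbers between \<open>- K\<close> and
      0. The two semidefinite matrices then bound the linearisation of the test Hessian from both
      sides by that of \<open>C *\<^sub>R P\<close>.\<close>
    have "z x \<le> K" "- z x \<le> K" using na[OF x] nb[OF x] by (auto simp: z_def)
    then have "\<bar>z x\<bar> \<le> K" by simp
    moreover have "\<bar>minor_sum_lin k (M s x) (\<chi> i j. p2 i j x)\<bar> \<le> C * minor_sum_lin k (M s x) P"
      using minor_sum_lin_nonneg[OF k cone[OF x less_imp_le[OF s(1)] less_imp_le[OF s(2)]] psd(1)[OF x]]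
        minor_sum_lin_nonneg[OF k cone[OF x less_imp_le[OF s(1)] less_imp_le[OF s(2)]] psd(2)[OF x]]
      unfolding minor_sum_lin_add minor_sum_lin_scaleR by linarith
    ultimately show ?thesis unfolding abs_mult using K0[OF x] by (intro mult_mono) auto
  qed
  have i1: "set_integrable lborel \<Omega> (\<lambda>x. z x * minor_sum_lin k (M s x) (\<chi> i j. p2 i j x))"
    by (intro set_integrable_closure bd op continuous_intros continuous_on_minor_sum_lin Mc jet2D(1)[OF jz]) (simp add: jet2D(3)[OF \<psi>])
  have i2: "set_integrable lborel \<Omega> (\<lambda>x. K * (C * minor_sum_lin k (M s x) P))"
    by (intro set_integrable_closure bd op continuous_intros continuous_on_minor_sum_lin Mc)
  have "\<bar>poly Y 1 - poly Y 0\<bar> = \<bar>LINT x:\<Omega>|lborel. z x * minor_sum_lin k (M s x) (\<chi> i j. p2 i j x)\<bar>"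
    using s(3) swap[OF \<psi>, of s] by (simp add: Y(2) MA)
  also have "\<dots> \<le> (LINT x:\<Omega>|lborel. \<bar>z x * minor_sum_lin k (M s x) (\<chi> i j. p2 i j x)\<bar>)"
    using set_integral_norm_bound[OF i1] by simp
  also have "\<dots> \<le> (LINT x:\<Omega>|lborel. K * (C * minor_sum_lin k (M s x) P))"
    by (rule set_integral_mono[OF set_integrable_abs[OF i1] i2]) (rule bnd)
  also have "\<dots> = K * C * (LINT x:\<Omega>|lborel. minor_sum_lin k (M s x) P)" by simp
  also have "\<dots> \<le> K * C * (real k / t * ?F)"
  proof (cases "\<Omega> = {}")
    case False
    then have "K \<ge> 0" using K0 by blast
    moreover have "(LINT x:\<Omega>|lborel. minor_sum_lin k (M s x) P) \<le> real k / t * ?F"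
      using main[OF s(1,2)] t by (simp add: pos_le_divide_eq mult.commute)
    ultimately show ?thesis using C by (intro mult_left_mono) auto
  qed (simp add: set_lebesgue_integral_def)
  finally have "\<bar>poly Y 1 - poly Y 0\<bar> \<le> K * C * (real k / t * ?F)" .
  moreover have "poly Y 1 = (LINT x:\<Omega>|lborel. \<psi> x * minor_sum k (t *\<^sub>R P + (\<chi> i j. wb2 i j x)))"
    by (simp only: Y(1) B1)
  moreover have "poly Y 0 = (LINT x:\<Omega>|lborel. \<psi> x * minor_sum k (A x))" by (simp add: Y(1))
  ultimately show ?thesis by (simp only: A_def)
qed

section \<open>The test functions and their Hessians\<close>

lemma positive_part_power_derivative:
  assumes n: "n \<ge> 2"
  shows "((\<lambda>y. (max 0 y) ^ n) has_real_derivative real n * (max 0 y) ^ (n - 1)) (at y)"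
proof -
  have zn: "0 ^ n = (0::real)" "0 ^ (n - Suc 0) = (0::real)" using n by (auto simp: power_0_left)
  show ?thesis
  proof (cases y "0::real" rule: linorder_cases)
    case less
    have "((\<lambda>y. (max 0 y) ^ n) has_real_derivative 0) (at y)"
      by (rule has_field_derivative_transform_within_open[of "\<lambda>_. 0" 0 y "{..<0}"]) (use less n in auto)
    then show ?thesis using less by (simp add: zn)
  next
    case equal
    have "((\<lambda>h. ((max 0 (0 + h)) ^ n - (max 0 0) ^ n) / h) \<longlongrightarrow> 0) (at (0::real))"
    proof (rule Lim_null_comparison)
      show "((\<lambda>h. \<bar>h\<bar>) \<longlongrightarrow> 0) (at (0::real))" by (rule tendsto_rabs_zero[OF tendsto_ident_at])
      have "\<forall>\<^sub>F h in at (0::real). \<bar>h\<bar> < 1"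
        unfolding eventually_at by (intro exI[of _ 1]) (auto simp: dist_real_def)
      then show "\<forall>\<^sub>F h in at (0::real). norm (((max 0 (0 + h)) ^ n - (max 0 0) ^ n) / h) \<le> \<bar>h\<bar>"
      proof eventually_elim
        case (elim h)
        show ?case
        proof (cases "h > 0")
          case True
          have "h ^ n = h * h * h ^ (n - 2)" using n by (metis le_add_diff_inverse power2_eq_square power_add)
          also have "\<dots> \<le> h * h * 1" using True elim by (intro mult_left_mono power_le_one) auto
          finally have "h ^ n / h \<le> h" using True by (simp add: divide_le_eq)
          then show ?thesis using True by (simp add: max_def zn)
        qed (simp add: max_def zn)
      qed
    qed
    then show ?thesis by (simp add: DERIV_def equal zn)
  next
    case greater
    have "((\<lambda>y. (max 0 y) ^ n) has_real_derivative real n * y ^ (n - Suc 0)) (at y)"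
      by (rule has_field_derivative_transform_within_open[of "\<lambda>y. y ^ n" _ y "{0<..}"]) (use greater DERIV_pow[of n y UNIV] in auto)
    then show ?thesis using greater by simp
  qed
qed

lemma projection_norm:
  fixes P :: "real^'n^'n"
  assumes sym: "transpose P = P" and idem: "P ** P = P"
  shows "x \<bullet> (P *v x) = (norm (P *v x))\<^sup>2" "(P *v x) \<bullet> y = x \<bullet> (P *v y)"
proof -
  show s: "(P *v x) \<bullet> y = x \<bullet> (P *v y)" for y
    using dot_lmul_matrix[of x P y] sym by (metis transpose_matrix_vector)
  show "x \<bullet> (P *v x) = (norm (P *v x))\<^sup>2"
    using s[of "P *v x"] by (simp add: power2_norm_eq_inner matrix_vector_mul_assoc idem)
qed

lemma scaleR_matrix_vector: "(c *\<^sub>R A) *v x = c *\<^sub>R (A *v x)" for A :: "real^'n^'m"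
  by (simp add: matrix_vector_mult_def vec_eq_iff sum_distrib_left mult_ac)

text \<open>With d = P x - y0 and m the positive part of \<delta>^2 - |d|^2, the Hessian of m^3 is
  24 m d d^T - 6 m^2 P. Where m is nonzero, |d| \<le> \<delta> and m \<le> \<delta>^2, so the two
  terms are bounded by 24 \<delta>^4 P and 6 \<delta>^4 P; this is the constant 30. The first bound
  uses that \<open>d\<close> lies in the range of \<open>P\<close>.\<close>

lemma bump_jet:
  fixes P :: "real^'n^'n"
  assumes sym: "transpose P = P" and idem: "P ** P = P" and y0: "P *v y0 = y0"
  shows "\<exists>p1 p2. jet2 \<Omega> (\<lambda>x. (max 0 (\<delta>\<^sup>2 - (norm (P *v x - y0))\<^sup>2)) ^ 3) p1 p2 \<and>
    (\<forall>x. psd_matrix ((30 * \<delta> ^ 4) *\<^sub>R P + (\<chi> i j. p2 i j x)) \<and> psd_matrix ((30 * \<delta> ^ 4) *\<^sub>R P + - 1 *\<^sub>R (\<chi> i j. p2 i j x)))"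
proof -
  note pn = projection_norm[OF sym idem]
  define g where "g x = \<delta>\<^sup>2 - (norm (P *v x - y0))\<^sup>2" for x
  define d where "d x = P *v x - y0" for x
  define m where "m x = max 0 (g x)" for x
  have g: "g x = - 1 * (x \<bullet> (P *v x)) + 2 * (x \<bullet> y0) + (\<delta>\<^sup>2 - y0 \<bullet> y0)" for x
    using pn(1)[of x] pn(2)[of x y0] y0 unfolding g_def power2_norm_eq_inner
    by (simp add: inner_diff_left inner_diff_right inner_commute)
  have gd: "(g has_derivative (\<lambda>h. \<Sum>i\<in>UNIV. (- 2 * d x $ i) * h $ i)) (at x)" for x
  proof -
    have "((\<lambda>x. - 1 * (x \<bullet> (P *v x)) + 2 * (x \<bullet> y0) + (\<delta>\<^sup>2 - y0 \<bullet> y0)) has_derivative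
      (\<lambda>h. - 1 * (\<Sum>i\<in>UNIV. 2 * (P *v x) $ i * h $ i) + 2 * (h \<bullet> y0) + 0)) (at x)"
      by (intro has_derivative_add has_derivative_mult_right quadratic_form_derivative sym has_derivative_inner_left has_derivative_ident has_derivative_const)
    moreover have "(\<lambda>h. - 1 * (\<Sum>i\<in>UNIV. 2 * (P *v x) $ i * h $ i) + 2 * (h \<bullet> y0) + 0) = (\<lambda>h. \<Sum>i\<in>UNIV. (- 2 * d x $ i) * h $ i)"
      by (rule ext) (simp add: d_def inner_vec_def sum_distrib_left sum_negf[symmetric] sum.distrib[symmetric] algebra_simps)
    moreover have "g = (\<lambda>x. - 1 * (x \<bullet> (P *v x)) + 2 * (x \<bullet> y0) + (\<delta>\<^sup>2 - y0 \<bullet> y0))" by (rule ext) (rule g)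
    ultimately show ?thesis by simp
  qed
  have dd: "((\<lambda>x. d x $ i) has_derivative (\<lambda>h. \<Sum>j\<in>UNIV. P $ i $ j * h $ j)) (at x)" for x i
    using has_derivative_diff[OF matrix_vector_component_derivative[of P i x] has_derivative_const[of "y0 $ i"]]
    by (simp add: d_def)
  have md: "((\<lambda>x. m x ^ n) has_derivative (\<lambda>h. \<Sum>i\<in>UNIV. (real n * m x ^ (n - 1) * (- 2 * d x $ i)) * h $ i)) (at x)" if "n \<ge> 2" for n x
  proof -
    have "((\<lambda>y. (max 0 y) ^ n) has_derivative (*) (real n * (max 0 (g x)) ^ (n - 1))) (at (g x))"
      using positive_part_power_derivative[OF that] by (simp add: has_field_derivative_def)
    from has_derivative_compose[OF gd this]
    show ?thesis by (simp add: m_def sum_distrib_left mult.assoc)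
  qed
  define p1 where "p1 i x = - 6 * (m x ^ 2 * d x $ i)" for i x
  define p2 where "p2 i j x = - 6 * (m x ^ 2 * P $ i $ j + (2 * m x * (- 2 * d x $ j)) * d x $ i)" for i j x
  have mc: "continuous_on A m" for A
  proof -
    have "continuous_on A g" using has_derivative_continuous[OF gd] continuous_at_imp_continuous_on by blast
    then show ?thesis unfolding m_def[abs_def] by (intro continuous_intros)
  qed
  have dc: "continuous_on A (\<lambda>x. d x $ i)" for A i
    using has_derivative_continuous[OF dd] continuous_at_imp_continuous_on by blast
  have d1: "((\<lambda>x. m x ^ 3) has_derivative (\<lambda>h. \<Sum>i\<in>UNIV. p1 i x * h $ i)) (at x)" for x
    using md[of 3 x] by (simp add: p1_def mult_ac)
  have d2: "(p1 i has_derivative (\<lambda>h. \<Sum>j\<in>UNIV. p2 i j x * h $ j)) (at x)" for i x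
  proof -
    have "((\<lambda>x. - 6 * (m x ^ 2 * d x $ i)) has_derivative (\<lambda>h. - 6 * (m x ^ 2 * (\<Sum>j\<in>UNIV. P $ i $ j * h $ j) +
        (\<Sum>j\<in>UNIV. (real 2 * m x ^ (2 - 1) * (- 2 * d x $ j)) * h $ j) * d x $ i))) (at x)"
      by (intro has_derivative_mult_right has_derivative_mult md dd) simp
    moreover have "(\<lambda>h. - 6 * (m x ^ 2 * (\<Sum>j\<in>UNIV. P $ i $ j * h $ j) +
        (\<Sum>j\<in>UNIV. (real 2 * m x ^ (2 - 1) * (- 2 * d x $ j)) * h $ j) * d x $ i)) = (\<lambda>h. \<Sum>j\<in>UNIV. p2 i j x * h $ j)"
      by (rule ext) (simp only: p2_def sum_distrib_left sum_distrib_right sum.distrib[symmetric], rule sum.cong, auto simp: algebra_simps)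
    ultimately show ?thesis unfolding p1_def[abs_def] by simp
  qed
  have jet: "jet2 \<Omega> (\<lambda>x. m x ^ 3) p1 p2"
    unfolding jet2_def
    using d1 d2 symmetric_entry[OF sym]
    by (auto simp: p1_def[abs_def] p2_def[abs_def] mult_ac intro!: continuous_intros mc dc)
  have mat: "(\<chi> i j. p2 i j x) = (24 * m x) *\<^sub>R (\<chi> i j. d x $ i * d x $ j) + (- 6 * m x ^ 2) *\<^sub>R P" for x
    by (simp add: p2_def vec_eq_iff algebra_simps)
  have tr: "transpose (\<chi> i j. p2 i j x) = (\<chi> i j. p2 i j x)" for x
    using symmetric_entry[OF sym] by (simp add: transpose_def vec_eq_iff p2_def mult_ac)
  have form: "\<xi> \<bullet> ((\<chi> i j. p2 i j x) *v \<xi>) = 24 * m x * (d x \<bullet> \<xi>)\<^sup>2 - 6 * m x ^ 2 * (norm (P *v \<xi>))\<^sup>2" for x \<xi>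
  proof -
    have "\<xi> \<bullet> ((\<chi> i j. d x $ i * d x $ j) *v \<xi>) = (d x \<bullet> \<xi>)\<^sup>2"
      by (simp add: inner_vec_def matrix_vector_mult_def power2_eq_square sum_product sum_distrib_left mult_ac)
    then show ?thesis unfolding mat matrix_vector_mult_add_rdistrib scaleR_matrix_vector inner_add_right inner_scaleR_right pn(1)
      by simp
  qed
  have m0: "0 \<le> m x" "m x \<le> \<delta>\<^sup>2" for x by (auto simp: m_def g_def)
  have b1: "24 * m x * (d x \<bullet> \<xi>)\<^sup>2 \<le> 24 * \<delta> ^ 4 * (norm (P *v \<xi>))\<^sup>2" for x \<xi>
  proof (cases "m x = 0")
    case False
    then have "(norm (d x))\<^sup>2 \<le> \<delta>\<^sup>2" by (auto simp: m_def g_def d_def max_def split: if_splits)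
    have "P *v d x = d x" by (simp add: d_def matrix_vector_mult_diff_distrib matrix_vector_mul_assoc idem y0)
    then have "d x \<bullet> \<xi> = d x \<bullet> (P *v \<xi>)" using pn(2)[of "d x" \<xi>] by simp
    then have "\<bar>d x \<bullet> \<xi>\<bar> \<le> norm (d x) * norm (P *v \<xi>)" by (simp add: Cauchy_Schwarz_ineq2)
    then have "(d x \<bullet> \<xi>)\<^sup>2 \<le> (norm (d x) * norm (P *v \<xi>))\<^sup>2" by (metis abs_le_square_iff abs_mult abs_norm_cancel)
    also have "\<dots> \<le> \<delta>\<^sup>2 * (norm (P *v \<xi>))\<^sup>2"
      unfolding power_mult_distrib by (rule mult_right_mono) (use \<open>(norm (d x))\<^sup>2 \<le> \<delta>\<^sup>2\<close> in auto)
    finally have "m x * (d x \<bullet> \<xi>)\<^sup>2 \<le> \<delta>\<^sup>2 * (\<delta>\<^sup>2 * (norm (P *v \<xi>))\<^sup>2)"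
      using m0[of x] by (intro mult_mono) auto
    also have "\<dots> = \<delta> ^ 4 * (norm (P *v \<xi>))\<^sup>2" by (simp add: power4_eq_xxxx power2_eq_square)
    finally show ?thesis by simp
  qed simp
  have b2: "6 * m x ^ 2 * (norm (P *v \<xi>))\<^sup>2 \<le> 6 * \<delta> ^ 4 * (norm (P *v \<xi>))\<^sup>2" for x \<xi>
  proof -
    have "m x ^ 2 \<le> (\<delta>\<^sup>2) ^ 2" using m0[of x] by (intro power_mono) auto
    then have "6 * m x ^ 2 \<le> 6 * \<delta> ^ 4" by simp
    then show ?thesis by (rule mult_right_mono) simp
  qed
  have trC: "transpose (a *\<^sub>R P + c *\<^sub>R (\<chi> i j. p2 i j x)) = a *\<^sub>R P + c *\<^sub>R (\<chi> i j. p2 i j x)" for a c x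
    using symmetric_entry[OF sym] by (simp add: transpose_def vec_eq_iff p2_def mult_ac)
  have pos: "0 \<le> 24 * m x * (d x \<bullet> \<xi>)\<^sup>2" "0 \<le> 6 * m x ^ 2 * (norm (P *v \<xi>))\<^sup>2" for x \<xi> using m0 by auto
  have split: "30 * \<delta> ^ 4 * (norm (P *v \<xi>))\<^sup>2 = 24 * \<delta> ^ 4 * (norm (P *v \<xi>))\<^sup>2 + 6 * \<delta> ^ 4 * (norm (P *v \<xi>))\<^sup>2" for \<xi> by simp
  have q: "\<xi> \<bullet> (((30 * \<delta> ^ 4) *\<^sub>R P + c *\<^sub>R (\<chi> i j. p2 i j x)) *v \<xi>) = 30 * \<delta> ^ 4 * (norm (P *v \<xi>))\<^sup>2 + c * (24 * m x * (d x \<bullet> \<xi>)\<^sup>2 - 6 * m x ^ 2 * (norm (P *v \<xi>))\<^sup>2)" for c x \<xi>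
    unfolding matrix_vector_mult_add_rdistrib scaleR_matrix_vector inner_add_right inner_scaleR_right pn(1) form ..
  have aux1: "0 \<le> a + d + 1 * (b - c)" if "0 \<le> a" "0 \<le> b" "c \<le> d" for a b c d :: real using that by simp
  have aux2: "0 \<le> a + d + - 1 * (b - c)" if "b \<le> a" "0 \<le> c" "0 \<le> d" for a b c d :: real using that by simp
  have "psd_matrix ((30 * \<delta> ^ 4) *\<^sub>R P + 1 *\<^sub>R (\<chi> i j. p2 i j x))" for x
    unfolding psd_matrix_def trC q split
  proof (intro conjI refl allI)
    fix \<xi>
    have "0 \<le> 24 * \<delta> ^ 4 * (norm (P *v \<xi>))\<^sup>2" by simp
    then show "0 \<le> 24 * \<delta> ^ 4 * (norm (P *v \<xi>))\<^sup>2 + 6 * \<delta> ^ 4 * (norm (P *v \<xi>))\<^sup>2 + 1 * (24 * m x * (d x \<bullet> \<xi>)\<^sup>2 - 6 * m x ^ 2 * (norm (P *v \<xi>))\<^sup>2)"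
      by (rule aux1[OF _ pos(1) b2])
  qed
  moreover have "psd_matrix ((30 * \<delta> ^ 4) *\<^sub>R P + - 1 *\<^sub>R (\<chi> i j. p2 i j x))" for x
    unfolding psd_matrix_def trC q split
  proof (intro conjI refl allI)
    fix \<xi>
    have "0 \<le> 6 * \<delta> ^ 4 * (norm (P *v \<xi>))\<^sup>2" by simp
    then show "0 \<le> 24 * \<delta> ^ 4 * (norm (P *v \<xi>))\<^sup>2 + 6 * \<delta> ^ 4 * (norm (P *v \<xi>))\<^sup>2 + - 1 * (24 * m x * (d x \<bullet> \<xi>)\<^sup>2 - 6 * m x ^ 2 * (norm (P *v \<xi>))\<^sup>2)"
      by (intro aux2[OF b1 pos(2)])
  qed
  ultimately show ?thesis using jet unfolding m_def g_def by (intro exI[of _ p1] exI[of _ p2]) simp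
qed

section \<open>The integral identity\<close>

text \<open>Translates admissibility and the equation into the cone and minor-sum language, and
  fixes the sup bound s R^2 / 2, the same for all \<open>t\<close>.\<close>

lemma hessian_solution_remainder:
  fixes \<Omega> E :: "(real^'n) set" and P :: "real^'n^'n"
  assumes op: "open \<Omega>" and bd: "bounded \<Omega>" and k: "1 \<le> k" "k \<le> CARD('n)" and t: "t > 0"
    and R: "\<And>x. x \<in> closure \<Omega> \<Longrightarrow> norm x \<le> R"
    and sym: "transpose P = P" and idem: "P ** P = P" and proj: "\<And>x. orth_proj E x = P *v x" and P0: "minor_sum k P = 0"
    and sol: "hessian_solution k \<Omega> f (\<lambda>x. t * phi E x) u"
    and s: "s \<ge> 1" "\<And>x. x \<in> \<Omega> \<Longrightarrow> f x < s"
  shows "\<exists>w1 w2 w3. jet3 \<Omega> (\<lambda>x. u x - t * phi E x) w1 w2 w3 \<and>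
    (\<forall>x\<in>\<Omega>. t *\<^sub>R P + (\<chi> i j. w2 i j x) \<in> garding_cone k \<and> minor_sum k (t *\<^sub>R P + (\<chi> i j. w2 i j x)) = f x \<and>
       - (s * R\<^sup>2 / 2) \<le> u x - t * phi E x \<and> u x - t * phi E x < 0)"
proof -
  have solD: "Cinf_closure \<Omega> u" "\<And>x. x \<in> \<Omega> \<Longrightarrow> eigenvalues (hessian u x) \<in> Gamma_cone k"
    "\<And>x. x \<in> \<Omega> \<Longrightarrow> sigma_mat k (hessian u x) = f x" "\<And>x. x \<in> frontier \<Omega> \<Longrightarrow> u x = t * phi E x"
    using sol by (auto simp: hessian_solution_def admissible_def)
  note pn = projection_norm[OF sym idem]
  have phi: "phi E x = (x \<bullet> (P *v x) + 0) / 2" for x by (simp add: phi_def proj pn(1))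
  obtain u1 u2 u3 where ju: "jet3 \<Omega> u u1 u2 u3"
    using Ck_closure_jet3[OF op, of u] solD(1) by (auto simp: Cinf_closure_def)
  define w where "w x = 1 * u x + (- t) * ((x \<bullet> (P *v x) + 0) / 2)" for x
  define w2 where "w2 i j x = 1 * u2 i j x + (- t) * P $ i $ j" for i j x
  have jw: "\<exists>w1 w3. jet3 \<Omega> w w1 w2 w3"
    unfolding w_def w2_def using jet3_lincomb[OF ju jet3_quadratic_form[OF sym], of 1 "- t"] by blast
  then obtain w1 w3 where jw: "jet3 \<Omega> w w1 w2 w3" by blast
  have jw2: "jet2 \<Omega> w w1 w2" using jw by (simp add: jet3_def)
  have wu: "w = (\<lambda>x. u x - t * phi E x)" by (rule ext) (simp add: w_def phi)
  have ju2: "jet2 \<Omega> u u1 u2" using ju by (simp add: jet3_def)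
  have hess: "t *\<^sub>R P + (\<chi> i j. w2 i j x) = hessian u x" "transpose (hessian u x) = hessian u x" if "x \<in> \<Omega>" for x
    using jet2D(6)[OF ju2 that] by (auto simp: jet2_hessian[OF op ju2 that] w2_def vec_eq_iff transpose_def)
  have cone: "t *\<^sub>R P + (\<chi> i j. w2 i j x) \<in> garding_cone k" if "x \<in> \<Omega>" for x
    unfolding hess(1)[OF that] by (rule Gamma_cone_subset_garding_cone[OF hess(2)[OF that] k solD(2)[OF that]])
  have ms: "minor_sum k (t *\<^sub>R P + (\<chi> i j. w2 i j x)) = f x" if "x \<in> \<Omega>" for x
    unfolding hess(1)[OF that] using sigma_mat_eq_minor_sum[OF hess(2)[OF that] k(2)] solD(3)[OF that] by simp
  have w0: "w x = 0" if "x \<in> frontier \<Omega>" for x using solD(4)[OF that] by (simp add: wu)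
  have tP0: "minor_sum k (t *\<^sub>R P) = 0" by (simp add: minor_sum_scaleR P0)
  have neg: "w x < 0" if "x \<in> \<Omega>" for x
    by (rule comparison_upper[OF op bd k(2) jw2 w0 tP0 cone that])
  have "psd_matrix P" by (simp add: psd_matrix_def sym pn(1))
  then have psd: "psd_matrix (t *\<^sub>R P)" using t by (intro psd_matrix_scaleR) auto
  \<comment> \<open>Since \<open>s \<ge> 1\<close>, \<sigma>_k(s I) \<ge> s^k \<ge> s, and
    \<open>s\<close> exceeds \<open>f\<close>. This makes s I a strict barrier.\<close>
  have "s ^ 1 \<le> s ^ k" using s(1) k(1) by (intro power_increasing) auto
  moreover have "s ^ k * 1 \<le> s ^ k * minor_sum k (mat 1 :: real^'n^'n)"
    using s(1) minor_sum_mat_1[OF k(2)] by (intro mult_left_mono) auto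
  moreover have "minor_sum k (mat s :: real^'n^'n) = s ^ k * minor_sum k (mat 1 :: real^'n^'n)"
    using minor_sum_scaleR[of k s "mat 1 :: real^'n^'n"] by (simp add: mat_scaleR)
  ultimately have big: "s \<le> minor_sum k (mat s :: real^'n^'n)" by simp
  have low: "- (s * R\<^sup>2 / 2) \<le> w x" if "x \<in> \<Omega>" for x
  proof (rule comparison_lower[OF op R k(2) jw2 w0 psd _ _ that])
    show "minor_sum k (t *\<^sub>R P + (\<chi> i j. w2 i j x)) < minor_sum k (mat s :: real^'n^'n)" if "x \<in> \<Omega>" for x
      using ms[OF that] s(2)[OF that] big by simp
  qed (use s in auto)
  show ?thesis using jw cone ms low neg unfolding wu by blast
qed

theorem proposition5p2:
  fixes k q :: nat and \<Omega> E V :: "(real^'n) set" and f\<^sub>1 f\<^sub>2 :: "real^'n \<Rightarrow> real"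
  assumes "2 \<le> k" and "k \<le> CARD('n)" and "q = CARD('n) - k + 1"
    and "bounded \<Omega>" and "smooth_domain \<Omega>" and "uniformly_convex \<Omega>"
    and "Cinf_closure \<Omega> f\<^sub>1" and "\<forall>x\<in>closure \<Omega>. f\<^sub>1 x > 0"
    and "Cinf_closure \<Omega> f\<^sub>2" and "\<forall>x\<in>closure \<Omega>. f\<^sub>2 x > 0"
    and "E \<in> Grassmannian (k - 1)" and "V = orthogonal_comp E"
    and "\<forall>\<^sub>F t in at_top. \<exists>h. has_DN_map k \<Omega> f\<^sub>1 (\<lambda>x. t * phi E x) h \<and>
                              has_DN_map k \<Omega> f\<^sub>2 (\<lambda>x. t * phi E x) h"
  shows "\<forall>y\<in>E. (LINT x : \<Omega> \<inter> ((+) y ` V) | hausdorff_measure q. f\<^sub>1 x - f\<^sub>2 x) = 0"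
proof
  fix y0 assume y0: "y0 \<in> E"
  have op: "open \<Omega>" and cv: "convex \<Omega>"
    using smooth_domain_open uniformly_convex_imp_convex assms(5,6) by blast+
  note bd = assms(4)
  have k1: "1 \<le> k" using assms(1) by simp
  have E: "subspace E" "dim E = k - 1" using assms(11) by (auto simp: Grassmannian_def)
  obtain P :: "real^'n^'n" where sym: "transpose P = P" and PP: "P ** P = P"
    and tr: "(\<Sum>i\<in>UNIV. P $ i $ i) = real (dim E)" and proj: "\<And>x. orth_proj E x = P *v x"
    and fixE: "\<And>x. x \<in> E \<Longrightarrow> P *v x = x" and VP: "orthogonal_comp E = {x. P *v x = 0}"
    by (rule projection_matrix[OF E(1)]) (rule that)
  note pn = projection_norm[OF sym PP]
  \<comment> \<open>The trace of the projection is k - 1, just below \<open>k\<close>.\<close>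
  have P0: "minor_sum k P = 0"
    by (rule minor_sum_projection[OF sym PP _ assms(2)]) (use tr E(2) k1 in simp)
  have "q = dim V" using dim_orthogonal_comp[OF E(1)] E(2) assms(2,3,12) k1 by simp
  then interpret orthogonal_splitting "\<lambda>x. P *v x" V q
  proof (intro orthogonal_splitting.intro)
    show "P *v (P *v x) = P *v x" for x by (simp add: matrix_vector_mul_assoc PP)
    show "(P *v x) \<bullet> (x - P *v x) = 0" for x
      using pn(1)[of x] by (simp only: inner_diff_right inner_commute[of "P *v x" x] power2_norm_eq_inner diff_self)
    show "V = {x. P *v x = 0}" by (simp add: assms(12) VP)
  qed simp_all
  have f1c: "continuous_on (closure \<Omega>) f\<^sub>1" and f2c: "continuous_on (closure \<Omega>) f\<^sub>2"
    using assms(7,9) unfolding Cinf_closure_def by (auto intro: Ck_closure_continuous)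
  have cpt: "compact (closure \<Omega>)" using bd by (simp add: compact_closure)
  have bounded_on: "\<exists>K. \<forall>x\<in>closure \<Omega>. \<bar>g x\<bar> \<le> K" if "continuous_on (closure \<Omega>) g" for g :: "real^'n \<Rightarrow> real"
    using compact_imp_bounded[OF compact_continuous_image[OF that cpt]] unfolding bounded_iff by auto
  obtain K1 K2 where K12: "\<And>x. x \<in> closure \<Omega> \<Longrightarrow> \<bar>f\<^sub>1 x\<bar> \<le> K1" "\<And>x. x \<in> closure \<Omega> \<Longrightarrow> \<bar>f\<^sub>2 x\<bar> \<le> K2"
    using bounded_on[OF f1c] bounded_on[OF f2c] by auto
  obtain R where R: "\<And>x. x \<in> closure \<Omega> \<Longrightarrow> norm x \<le> R"
    using compact_imp_bounded[OF cpt] unfolding bounded_iff by blast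
  have cl: "x \<in> closure \<Omega>" if "x \<in> \<Omega>" for x using that closure_subset by blast
  \<comment> \<open>Exceeds both right-hand sides and is at least 1, so one sup bound serves both
    remainders and every \<open>t\<close>.\<close>
  define s where "s = 1 + \<bar>K1\<bar> + \<bar>K2\<bar>"
  have s1: "s \<ge> 1" by (simp add: s_def)
  have sf: "f\<^sub>1 x < s" "f\<^sub>2 x < s" if "x \<in> \<Omega>" for x
    using K12[OF cl[OF that]] by (auto simp: s_def)
  have hyp: "set_lebesgue_integral lborel \<Omega> (\<lambda>x. bump y0 \<delta> x * (f\<^sub>1 x - f\<^sub>2 x)) = 0" if \<delta>: "\<delta> > 0" for \<delta>
  proof -
    obtain p1 p2 where jb: "jet2 \<Omega> (bump y0 \<delta>) p1 p2"
      and psd: "\<And>x. psd_matrix ((30 * \<delta> ^ 4) *\<^sub>R P + (\<chi> i j. p2 i j x))" "\<And>x. psd_matrix ((30 * \<delta> ^ 4) *\<^sub>R P + - 1 *\<^sub>R (\<chi> i j. p2 i j x))"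
      using bump_jet[OF sym PP fixE[OF y0], of \<Omega> \<delta>] unfolding bump_def[abs_def] by blast
    let ?I = "set_lebesgue_integral lborel \<Omega> (\<lambda>x. bump y0 \<delta> x * (f\<^sub>1 x - f\<^sub>2 x))"
    let ?K = "s * R\<^sup>2 / 2"
    let ?B = "\<lambda>t. ?K * (30 * \<delta> ^ 4) * (real k / t * (LINT x:\<Omega>|lborel. f\<^sub>2 x))"
    have bound: "\<bar>?I\<bar> \<le> ?B t"
      if t: "t > 0" and DN: "has_DN_map k \<Omega> f\<^sub>1 (\<lambda>x. t * phi E x) h" "has_DN_map k \<Omega> f\<^sub>2 (\<lambda>x. t * phi E x) h" for t h
    proof -
      obtain ub where ub: "hessian_solution k \<Omega> f\<^sub>1 (\<lambda>x. t * phi E x) ub" "\<forall>p\<in>frontier \<Omega>. has_normal_derivative \<Omega> ub p (h p)"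
        using DN(1) unfolding has_DN_map_def by blast
      obtain ua where ua: "hessian_solution k \<Omega> f\<^sub>2 (\<lambda>x. t * phi E x) ua" "\<forall>p\<in>frontier \<Omega>. has_normal_derivative \<Omega> ua p (h p)"
        using DN(2) unfolding has_DN_map_def by blast
      let ?wa = "\<lambda>x. ua x - t * phi E x" and ?wb = "\<lambda>x. ub x - t * phi E x"
      obtain wa1 wa2 wa3 where ja: "jet3 \<Omega> ?wa wa1 wa2 wa3"
        and wa: "\<And>x. x \<in> \<Omega> \<Longrightarrow> t *\<^sub>R P + (\<chi> i j. wa2 i j x) \<in> garding_cone k \<and> minor_sum k (t *\<^sub>R P + (\<chi> i j. wa2 i j x)) = f\<^sub>2 x \<and> - ?K \<le> ?wa x \<and> ?wa x < 0"
        using hessian_solution_remainder[OF op bd k1 assms(2) t R sym PP proj P0 ua(1) s1 sf(2)] by blast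
      obtain wb1 wb2 wb3 where jb3: "jet3 \<Omega> ?wb wb1 wb2 wb3"
        and wb: "\<And>x. x \<in> \<Omega> \<Longrightarrow> t *\<^sub>R P + (\<chi> i j. wb2 i j x) \<in> garding_cone k \<and> minor_sum k (t *\<^sub>R P + (\<chi> i j. wb2 i j x)) = f\<^sub>1 x \<and> - ?K \<le> ?wb x \<and> ?wb x < 0"
        using hessian_solution_remainder[OF op bd k1 assms(2) t R sym PP proj P0 ub(1) s1 sf(1)] by blast
      have fa: "?wa x = 0" and fb: "?wb x = 0" if "x \<in> frontier \<Omega>" for x
        using ua(1) ub(1) that by (auto simp: hessian_solution_def)
      have ja2: "jet2 \<Omega> ?wa wa1 wa2" and jb2: "jet2 \<Omega> ?wb wb1 wb2" using ja jb3 by (auto simp: jet3_def)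
      \<comment> \<open>Equal boundary values and equal normal derivatives give equal full
        gradients, which is the Cauchy condition used in \<open>difference_bound\<close>.\<close>
      have grad: "wa1 i p = wb1 i p" if p: "p \<in> frontier \<Omega>" for i p
      proof -
        note jz = jet2_lincomb[OF jb2 ja2, of 1 "- 1"]
        have nd: "has_normal_derivative \<Omega> (\<lambda>x. 1 * ?wb x + - 1 * ?wa x) p 0"
        proof -
          have "((\<lambda>s. ub (p + s *\<^sub>R outward_unit_normal \<Omega> p) - ua (p + s *\<^sub>R outward_unit_normal \<Omega> p)) has_real_derivative (h p - h p)) (at_left 0)"
            using ua(2) ub(2) p unfolding has_normal_derivative_def by (intro DERIV_diff) auto
          then show ?thesis unfolding has_normal_derivative_def by simp
        qed
        have "1 * wb1 i p + - 1 * wa1 i p = 0"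
          by (rule boundary_gradient_zero[OF assms(5) cv bd jet2D(1)[OF jz] jet2D(2)[OF jz] jet2D(4)[OF jz] _ p nd]) (use fa fb in auto)
        then show ?thesis by simp
      qed
      have "\<bar>(LINT x:\<Omega>|lborel. bump y0 \<delta> x * minor_sum k (t *\<^sub>R P + (\<chi> i j. wb2 i j x))) - (LINT x:\<Omega>|lborel. bump y0 \<delta> x * minor_sum k (t *\<^sub>R P + (\<chi> i j. wa2 i j x)))\<bar>
        \<le> ?K * (30 * \<delta> ^ 4) * (real k / t * (LINT x:\<Omega>|lborel. minor_sum k (t *\<^sub>R P + (\<chi> i j. wa2 i j x))))"
        by (rule difference_bound[OF op bd cv assms(2) sym t _ ja jb3 fa fb grad _ _ _ _ jb psd]) (use wa wb in auto)
      moreover have "(LINT x:\<Omega>|lborel. bump y0 \<delta> x * minor_sum k (t *\<^sub>R P + (\<chi> i j. wb2 i j x))) = (LINT x:\<Omega>|lborel. bump y0 \<delta> x * f\<^sub>1 x)"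
        "(LINT x:\<Omega>|lborel. bump y0 \<delta> x * minor_sum k (t *\<^sub>R P + (\<chi> i j. wa2 i j x))) = (LINT x:\<Omega>|lborel. bump y0 \<delta> x * f\<^sub>2 x)"
        "(LINT x:\<Omega>|lborel. minor_sum k (t *\<^sub>R P + (\<chi> i j. wa2 i j x))) = (LINT x:\<Omega>|lborel. f\<^sub>2 x)"
        using op wa wb by (auto intro!: set_lebesgue_integral_cong)
      moreover have "?I = (LINT x:\<Omega>|lborel. bump y0 \<delta> x * f\<^sub>1 x) - (LINT x:\<Omega>|lborel. bump y0 \<delta> x * f\<^sub>2 x)"
      proof -
        have "set_integrable lborel \<Omega> (\<lambda>x. bump y0 \<delta> x * f\<^sub>1 x)" "set_integrable lborel \<Omega> (\<lambda>x. bump y0 \<delta> x * f\<^sub>2 x)"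
          by (intro set_integrable_closure bd op continuous_intros jet2D(1)[OF jb] f1c f2c)+
        from set_integral_diff(2)[OF this] show ?thesis by (simp add: right_diff_distrib)
      qed
      ultimately show ?thesis by simp
    qed
    \<comment> \<open>\<open>?I\<close> does not depend on \<open>t\<close> while
      \<open>?B t\<close> is a constant divided by \<open>t\<close>, so the limit forces
      \<open>?I = 0\<close>.\<close>
    have "\<forall>\<^sub>F t in at_top. \<bar>?I\<bar> \<le> ?B t"
      using assms(13) eventually_gt_at_top[of 0] by eventually_elim (use bound in blast)
    moreover have "(?B \<longlongrightarrow> ?K * (30 * \<delta> ^ 4) * (0 * (LINT x:\<Omega>|lborel. f\<^sub>2 x))) at_top"
      by (intro tendsto_intros tendsto_divide_0[OF tendsto_const] filterlim_at_top_imp_at_infinity filterlim_ident)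
    ultimately have "\<bar>?I\<bar> \<le> ?K * (30 * \<delta> ^ 4) * (0 * (LINT x:\<Omega>|lborel. f\<^sub>2 x))"
      by (intro tendsto_lowerbound) auto
    then show ?thesis by simp
  qed
  show "(LINT x : \<Omega> \<inter> ((+) y0 ` V) | hausdorff_measure q. f\<^sub>1 x - f\<^sub>2 x) = 0"
  proof (rule slice_integral_zero[OF op cv bd _ _ fixE[OF y0] hyp])
    show "continuous_on \<Omega> (\<lambda>x. f\<^sub>1 x - f\<^sub>2 x)"
      by (intro continuous_intros continuous_on_subset[OF f1c closure_subset] continuous_on_subset[OF f2c closure_subset])
    show "\<bar>f\<^sub>1 x - f\<^sub>2 x\<bar> \<le> K1 + K2" if "x \<in> \<Omega>" for x
      using K12[OF cl[OF that]] abs_triangle_ineq4[of "f\<^sub>1 x" "f\<^sub>2 x"] by linarith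
  qed
qed

thm_deps proposition5p2

end
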